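(* Let $(M,g)$ be a Riemannian manifold of dimension $n>1$, let $A>0$, and let $\lambda,b_1:(0,\infty)\to\mathbf{R}$ be smooth functions with $\lambda(t)>0$, $A\lambda(t)+2b_1(t)>0$ and $\lambda(t)+2t\lambda'(t)\neq 0$ for all $t>0$. Let $J$ be the natural almost complex structure of diagonal type on $T^*_0M$ given by $$J\frac{\delta}{\delta q^i}=(At\lambda\, g_{ij}+b_1p_ip_j)\frac{\partial}{\partial p_j},\qquad J\frac{\partial}{\partial p_i}=-\Big(\frac{1}{At\lambda}g^{ij}-\frac{b_1}{At^2\lambda(A\lambda+2b_1)}g^{0i}g^{0j}\Big)\frac{\delta}{\delta q^j}.$$ Assume that the limit $\lim_{t\to 0}At(\lambda+2t\lambda')(b_1+A\lambda)$ exists in $\mathbf{R}$. Then $J$ is integrable if and only if $(M,g)$ has constant sectional curvature $c$ and the function $b_1$ is given by $$b_1=\frac{c-A^2t\lambda(\lambda+t\lambda')}{At(\lambda+2t\lambda')}.$$ In this case the parameter $\lambda$ must fulfill the conditions $$\lambda>0,\qquad \frac{2c-A^2t\lambda^2}{\lambda+2t\lambda'}>0\qquad\text{for all } t>0 .$$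
   Context: Everything is smooth; repeated indices are summed over $1,\dots,n$. $(M,g)$ is a smooth $n$-dimensional Riemannian manifold, $\pi:T^*M\to M$ its cotangent bundle, $T^*_0M$ is $T^*M$ minus the zero section. A chart $(U,x^1,\dots,x^n)$ of $M$ induces the chart $(\pi^{-1}(U),q^1,\dots,q^n,p_1,\dots,p_n)$ of $T^*M$, where $q^i=x^i\circ\pi$ and $p=p_i\,dx^i_{\pi(p)}$. With $\Gamma^k_{ih}$ the Christoffel symbols of $g$, put $\Gamma^0_{ih}=p_k\Gamma^k_{ih}$ and $\frac{\delta}{\delta q^i}=\frac{\partial}{\partial q^i}+\Gamma^0_{ih}\frac{\partial}{\partial p_h}$. The vector fields $\frac{\delta}{\delta q^i},\frac{\partial}{\partial p_i}$ form a local frame of $T(T^*M)$ over $\pi^{-1}(U)$. Further, $(g^{ij})$ is the inverse of $(g_{ij})$, $g^{0i}=p_hg^{hi}$, and $t=\frac12 g^{ij}p_ip_j>0$ on $T^*_0M$ is the energy density. The functions of $t$ (such as $\lambda$, $b_1$, $\lambda'=d\lambda/dt$) are evaluated at the energy density. Integrability of $J$ means vanishing of its Nijenhuis tensor $N(X,Y)=[JX,JY]-J[JX,Y]-J[X,JY]-[X,Y]$. *)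

theory Defs
  imports "HOL-Analysis.Analysis" "HOL-Library.Function_Algebras"
begin

instantiation "fun" :: (type, scaleR) scaleR
begin

definition scaleR_fun :: "real \<Rightarrow> ('a \<Rightarrow> 'b) \<Rightarrow> 'a \<Rightarrow> 'b"
  where "scaleR_fun r f = (\<lambda>x. r *\<^sub>R f x)"

instance ..

end

instance "fun" :: (type, real_vector) real_vector
  by standard
    (simp_all add: scaleR_fun_def plus_fun_def fun_eq_iff scaleR_add_right scaleR_add_left)

text \<open>Intended for open \<open>S\<close> only: derivatives are taken in the full space.\<close>

primrec Ck_on :: "nat \<Rightarrow> 'a::real_normed_vector set \<Rightarrow> ('a \<Rightarrow> 'b::real_normed_vector) \<Rightarrow> bool" where
  "Ck_on 0 S f \<longleftrightarrow> continuous_on S f"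
| "Ck_on (Suc k) S f \<longleftrightarrow>
     (\<forall>x\<in>S. f differentiable (at x)) \<and>
     (\<forall>v. Ck_on k S (\<lambda>x. frechet_derivative f (at x) v))"

definition smooth_on :: "'a::real_normed_vector set \<Rightarrow> ('a \<Rightarrow> 'b::real_normed_vector) \<Rightarrow> bool"
  where "smooth_on S f \<longleftrightarrow> (\<forall>k. Ck_on k S f)"

text \<open>
  A manifold modelled on \<open>'e\<close> is a topological space on points of type \<open>'a\<close> with an atlas
  indexed by \<open>charts\<close>; \<open>chart_map i\<close> is meaningful on \<open>chart_dom i\<close> only.
\<close>

record ('a, 'i, 'e) manifold =
  space_of :: "'a topology"
  charts :: "'i set"
  chart_dom :: "'i \<Rightarrow> 'a set"
  chart_map :: "'i \<Rightarrow> 'a \<Rightarrow> 'e"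

definition points :: "('a, 'i, 'e) manifold \<Rightarrow> 'a set"
  where "points N = topspace (space_of N)"

definition charts_at :: "('a, 'i, 'e) manifold \<Rightarrow> 'a \<Rightarrow> 'i set"
  where "charts_at N x = {i \<in> charts N. x \<in> chart_dom N i}"

definition chart_inv :: "('a, 'i, 'e) manifold \<Rightarrow> 'i \<Rightarrow> 'e \<Rightarrow> 'a"
  where "chart_inv N i = inv_into (chart_dom N i) (chart_map N i)"

definition smooth_manifold :: "('a, 'i, 'e::euclidean_space) manifold \<Rightarrow> bool" where
  "smooth_manifold N \<longleftrightarrow>
     Hausdorff_space (space_of N) \<and>
     second_countable (space_of N) \<and>
     points N = (\<Union>i\<in>charts N. chart_dom N i) \<and>
     (\<forall>i\<in>charts N.
        openin (space_of N) (chart_dom N i) \<and>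
        open (chart_map N i ` chart_dom N i) \<and>
        homeomorphic_map (subtopology (space_of N) (chart_dom N i))
          (top_of_set (chart_map N i ` chart_dom N i)) (chart_map N i)) \<and>
     (\<forall>i\<in>charts N. \<forall>j\<in>charts N.
        smooth_on (chart_map N i ` (chart_dom N i \<inter> chart_dom N j))
          (chart_map N j \<circ> chart_inv N i))"

text \<open>
  A tangent vector at \<open>x\<close> is the family of its component vectors in all charts at \<open>x\<close>, related by
  the Jacobians of the coordinate changes; the family is \<open>0\<close> at all other indices.
\<close>

definition transition_deriv ::
  "('a, 'i, 'e::euclidean_space) manifold \<Rightarrow> 'i \<Rightarrow> 'i \<Rightarrow> 'a \<Rightarrow> 'e \<Rightarrow> 'e" where
  "transition_deriv N i j x =
     frechet_derivative (chart_map N j \<circ> chart_inv N i) (at (chart_map N i x))"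

definition tangent_space ::
  "('a, 'i, 'e::euclidean_space) manifold \<Rightarrow> 'a \<Rightarrow> ('i \<Rightarrow> 'e) set" where
  "tangent_space N x =
     {v. (\<forall>i\<in>charts_at N x. \<forall>j\<in>charts_at N x. v j = transition_deriv N i j x (v i)) \<and>
         (\<forall>i. i \<notin> charts_at N x \<longrightarrow> v i = 0)}"

text \<open>The tangent vector at \<open>x\<close> whose components in the chart \<open>i\<close> are \<open>e\<close>.\<close>

definition tangent_vector ::
  "('a, 'i, 'e::euclidean_space) manifold \<Rightarrow> 'i \<Rightarrow> 'a \<Rightarrow> 'e \<Rightarrow> 'i \<Rightarrow> 'e" where
  "tangent_vector N i x e = (\<lambda>j. if j \<in> charts_at N x then transition_deriv N i j x e else 0)"

definition local_rep ::
  "('a, 'i, 'e::euclidean_space) manifold \<Rightarrow> 'i \<Rightarrow> ('a \<Rightarrow> 'i \<Rightarrow> 'e) \<Rightarrow> 'e \<Rightarrow> 'e" where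
  "local_rep N i X = (\<lambda>z. X (chart_inv N i z) i)"

definition smooth_vector_field_on ::
  "('a, 'i, 'e::euclidean_space) manifold \<Rightarrow> 'a set \<Rightarrow> ('a \<Rightarrow> 'i \<Rightarrow> 'e) \<Rightarrow> bool" where
  "smooth_vector_field_on N W X \<longleftrightarrow>
     (\<forall>x\<in>W. X x \<in> tangent_space N x) \<and>
     (\<forall>i\<in>charts N. smooth_on (chart_map N i ` (W \<inter> chart_dom N i)) (local_rep N i X))"

definition lie_bracket ::
  "('a, 'i, 'e::euclidean_space) manifold \<Rightarrow> ('a \<Rightarrow> 'i \<Rightarrow> 'e) \<Rightarrow> ('a \<Rightarrow> 'i \<Rightarrow> 'e) \<Rightarrow> 'a \<Rightarrow> 'i \<Rightarrow> 'e" where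
  "lie_bracket N X Y = (\<lambda>x i.
     if i \<in> charts_at N x then
       frechet_derivative (local_rep N i Y) (at (chart_map N i x)) (X x i)
       - frechet_derivative (local_rep N i X) (at (chart_map N i x)) (Y x i)
     else 0)"

definition endomorphism_field_on ::
  "('a, 'i, 'e::euclidean_space) manifold \<Rightarrow> 'a set \<Rightarrow> ('a \<Rightarrow> ('i \<Rightarrow> 'e) \<Rightarrow> ('i \<Rightarrow> 'e)) \<Rightarrow> bool" where
  "endomorphism_field_on N W J \<longleftrightarrow>
     (\<forall>x\<in>W.
        (\<forall>v\<in>tangent_space N x. J x v \<in> tangent_space N x) \<and>
        (\<forall>v\<in>tangent_space N x. \<forall>w\<in>tangent_space N x. \<forall>a b.
           J x (a *\<^sub>R v + b *\<^sub>R w) = a *\<^sub>R J x v + b *\<^sub>R J x w))"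

definition apply_field :: "('a \<Rightarrow> 'v \<Rightarrow> 'v) \<Rightarrow> ('a \<Rightarrow> 'v) \<Rightarrow> 'a \<Rightarrow> 'v"
  where "apply_field J X = (\<lambda>x. J x (X x))"

definition nijenhuis ::
  "('a, 'i, 'e::euclidean_space) manifold \<Rightarrow> ('a \<Rightarrow> ('i \<Rightarrow> 'e) \<Rightarrow> ('i \<Rightarrow> 'e)) \<Rightarrow>
   ('a \<Rightarrow> 'i \<Rightarrow> 'e) \<Rightarrow> ('a \<Rightarrow> 'i \<Rightarrow> 'e) \<Rightarrow> 'a \<Rightarrow> 'i \<Rightarrow> 'e" where
  "nijenhuis N J X Y =
     lie_bracket N (apply_field J X) (apply_field J Y)
     - apply_field J (lie_bracket N (apply_field J X) Y)
     - apply_field J (lie_bracket N X (apply_field J Y))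
     - lie_bracket N X Y"

text \<open>The vector fields range over all open subsets, so that local frames are included.\<close>

definition nijenhuis_integrable_on ::
  "('a, 'i, 'e::euclidean_space) manifold \<Rightarrow> 'a set \<Rightarrow> ('a \<Rightarrow> ('i \<Rightarrow> 'e) \<Rightarrow> ('i \<Rightarrow> 'e)) \<Rightarrow> bool" where
  "nijenhuis_integrable_on N W J \<longleftrightarrow>
     (\<forall>V X Y. openin (space_of N) V \<and> V \<subseteq> W \<and>
        smooth_vector_field_on N V X \<and> smooth_vector_field_on N V Y \<longrightarrow>
        (\<forall>x\<in>V. nijenhuis N J X Y x = 0))"

type_synonym ('a, 'i, 'n) metric =
  "'a \<Rightarrow> ('i \<Rightarrow> real ^ 'n) \<Rightarrow> ('i \<Rightarrow> real ^ 'n) \<Rightarrow> real"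

definition coord_vector ::
  "('a, 'i, real ^ 'n) manifold \<Rightarrow> 'i \<Rightarrow> 'a \<Rightarrow> 'n::finite \<Rightarrow> 'i \<Rightarrow> real ^ 'n" where
  "coord_vector M c x i = tangent_vector M c x (axis i 1)"

definition metric_matrix ::
  "('a, 'i, real ^ 'n) manifold \<Rightarrow> ('a, 'i, 'n::finite) metric \<Rightarrow> 'i \<Rightarrow> 'a \<Rightarrow> real ^ 'n ^ 'n" where
  "metric_matrix M g c x = (\<chi> i j. g x (coord_vector M c x i) (coord_vector M c x j))"

definition inverse_metric_matrix ::
  "('a, 'i, real ^ 'n) manifold \<Rightarrow> ('a, 'i, 'n::finite) metric \<Rightarrow> 'i \<Rightarrow> 'a \<Rightarrow> real ^ 'n ^ 'n" where
  "inverse_metric_matrix M g c x = matrix_inv (metric_matrix M g c x)"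

definition riemannian_metric ::
  "('a, 'i, real ^ 'n) manifold \<Rightarrow> ('a, 'i, 'n::finite) metric \<Rightarrow> bool" where
  "riemannian_metric M g \<longleftrightarrow>
     (\<forall>x\<in>points M.
        (\<forall>v\<in>tangent_space M x. \<forall>w\<in>tangent_space M x. g x v w = g x w v) \<and>
        (\<forall>u\<in>tangent_space M x. \<forall>v\<in>tangent_space M x. \<forall>w\<in>tangent_space M x. \<forall>a b.
           g x (a *\<^sub>R u + b *\<^sub>R v) w = a * g x u w + b * g x v w) \<and>
        (\<forall>v\<in>tangent_space M x. v \<noteq> 0 \<longrightarrow> g x v v > 0)) \<and>
     (\<forall>c\<in>charts M. \<forall>i j.
        smooth_on (chart_map M c ` chart_dom M c)
          (\<lambda>z. metric_matrix M g c (chart_inv M c z) $ i $ j))"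

definition partial_deriv ::
  "('a, 'i, real ^ 'n) manifold \<Rightarrow> 'i \<Rightarrow> 'n::finite \<Rightarrow> ('a \<Rightarrow> real) \<Rightarrow> 'a \<Rightarrow> real" where
  "partial_deriv M c i f x =
     frechet_derivative (f \<circ> chart_inv M c) (at (chart_map M c x)) (axis i 1)"

text \<open>\<open>christoffel M g c k i j\<close> is \<open>\<Gamma>\<close> with upper index \<open>k\<close> and lower indices \<open>i, j\<close>.\<close>

definition christoffel ::
  "('a, 'i, real ^ 'n) manifold \<Rightarrow> ('a, 'i, 'n::finite) metric \<Rightarrow> 'i \<Rightarrow> 'n \<Rightarrow> 'n \<Rightarrow> 'n \<Rightarrow> 'a \<Rightarrow> real" where
  "christoffel M g c k i j x =
     (\<Sum>l\<in>UNIV. 1/2 * inverse_metric_matrix M g c x $ k $ l *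
        (partial_deriv M c i (\<lambda>y. metric_matrix M g c y $ j $ l) x
         + partial_deriv M c j (\<lambda>y. metric_matrix M g c y $ i $ l) x
         - partial_deriv M c l (\<lambda>y. metric_matrix M g c y $ i $ j) x))"

text \<open>
  \<open>curvature_coeff M g c k h i j\<close> is the \<open>k\<close>-th component of \<open>R(\<partial>\<^sub>i, \<partial>\<^sub>j) \<partial>\<^sub>h\<close>, where
  \<open>R(X, Y) = [\<nabla>\<^sub>X, \<nabla>\<^sub>Y] - \<nabla>\<^bsub>[X, Y]\<^esub>\<close>.
\<close>

definition curvature_coeff ::
  "('a, 'i, real ^ 'n) manifold \<Rightarrow> ('a, 'i, 'n::finite) metric \<Rightarrow> 'i \<Rightarrow>
   'n \<Rightarrow> 'n \<Rightarrow> 'n \<Rightarrow> 'n \<Rightarrow> 'a \<Rightarrow> real" where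
  "curvature_coeff M g c k h i j x =
     partial_deriv M c i (christoffel M g c k j h) x
     - partial_deriv M c j (christoffel M g c k i h) x
     + (\<Sum>m\<in>UNIV. christoffel M g c k i m x * christoffel M g c m j h x
                - christoffel M g c k j m x * christoffel M g c m i h x)"

definition curvature ::
  "('a, 'i, real ^ 'n) manifold \<Rightarrow> ('a, 'i, 'n::finite) metric \<Rightarrow> 'i \<Rightarrow> 'a \<Rightarrow>
   ('i \<Rightarrow> real ^ 'n) \<Rightarrow> ('i \<Rightarrow> real ^ 'n) \<Rightarrow> ('i \<Rightarrow> real ^ 'n) \<Rightarrow> 'i \<Rightarrow> real ^ 'n" where
  "curvature M g c x v w z = tangent_vector M c x
     (\<chi> k. \<Sum>h\<in>UNIV. \<Sum>i\<in>UNIV. \<Sum>j\<in>UNIV.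
        curvature_coeff M g c k h i j x * v c $ i * w c $ j * z c $ h)"

definition sectional_curvature ::
  "('a, 'i, real ^ 'n) manifold \<Rightarrow> ('a, 'i, 'n::finite) metric \<Rightarrow> 'i \<Rightarrow> 'a \<Rightarrow>
   ('i \<Rightarrow> real ^ 'n) \<Rightarrow> ('i \<Rightarrow> real ^ 'n) \<Rightarrow> real" where
  "sectional_curvature M g c x v w =
     g x (curvature M g c x v w w) v / (g x v v * g x w w - (g x v w)\<^sup>2)"

definition constant_sectional_curvature ::
  "('a, 'i, real ^ 'n) manifold \<Rightarrow> ('a, 'i, 'n::finite) metric \<Rightarrow> real \<Rightarrow> bool" where
  "constant_sectional_curvature M g \<kappa> \<longleftrightarrow>
     (\<forall>c\<in>charts M. \<forall>x\<in>chart_dom M c. \<forall>v\<in>tangent_space M x. \<forall>w\<in>tangent_space M x.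
        v \<noteq> w \<and> independent {v, w} \<longrightarrow> sectional_curvature M g c x v w = \<kappa>)"

text \<open>
  A covector at \<open>x\<close> is the family of its component vectors in all charts at \<open>x\<close>: those families
  for which the pairing with each tangent vector does not depend on the chart.
\<close>

definition cotangent_space ::
  "('a, 'i, real ^ 'n) manifold \<Rightarrow> 'a \<Rightarrow> ('i \<Rightarrow> real ^ 'n::finite) set" where
  "cotangent_space M x =
     {\<omega>. (\<forall>v\<in>tangent_space M x. \<forall>i\<in>charts_at M x. \<forall>j\<in>charts_at M x.
            \<omega> i \<bullet> v i = \<omega> j \<bullet> v j) \<and>
         (\<forall>i. i \<notin> charts_at M x \<longrightarrow> \<omega> i = 0)}"

type_synonym ('a, 'i, 'n) copoint = "'a \<times> ('i \<Rightarrow> real ^ 'n)"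

definition induced_chart_dom ::
  "('a, 'i, real ^ 'n) manifold \<Rightarrow> 'i \<Rightarrow> ('a, 'i, 'n::finite) copoint set" where
  "induced_chart_dom M c = {(x, \<omega>). x \<in> chart_dom M c \<and> \<omega> \<in> cotangent_space M x}"

definition induced_chart_map ::
  "('a, 'i, real ^ 'n) manifold \<Rightarrow> 'i \<Rightarrow> ('a, 'i, 'n::finite) copoint \<Rightarrow> (real ^ 'n) \<times> (real ^ 'n)" where
  "induced_chart_map M c = (\<lambda>(x, \<omega>). (chart_map M c x, \<omega> c))"

definition cotangent_bundle ::
  "('a, 'i, real ^ 'n) manifold \<Rightarrow>
   (('a, 'i, 'n::finite) copoint, 'i, (real ^ 'n) \<times> (real ^ 'n)) manifold" where
  "cotangent_bundle M =
     \<lparr> space_of = topology_generated_by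
         {{u \<in> induced_chart_dom M c. induced_chart_map M c u \<in> S} | c S. c \<in> charts M \<and> open S},
       charts = charts M,
       chart_dom = induced_chart_dom M,
       chart_map = induced_chart_map M \<rparr>"

definition nonzero_cotangent ::
  "('a, 'i, real ^ 'n) manifold \<Rightarrow> ('a, 'i, 'n::finite) copoint set" where
  "nonzero_cotangent M = {(x, \<omega>). x \<in> points M \<and> \<omega> \<in> cotangent_space M x \<and> \<omega> \<noteq> 0}"

text \<open>
  In the chart induced by \<open>c\<close>: \<open>fibre_coord\<close>, \<open>g_low\<close>, \<open>g_up\<close>, \<open>g_up0\<close> and \<open>christoffel0\<close> are
  \<open>p\<^sub>i\<close>, \<open>g\<^sub>i\<^sub>j\<close>, \<open>g\<^sup>i\<^sup>j\<close>, \<open>g\<^sup>0\<^sup>i = p\<^sub>h g\<^sup>h\<^sup>i\<close> and \<open>\<Gamma>\<^sup>0\<^sub>i\<^sub>h = p\<^sub>k \<Gamma>\<^sup>k\<^sub>i\<^sub>h\<close>;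
  \<open>delta_q\<close> is \<open>\<delta>/\<delta>q\<^sup>i\<close>.
\<close>

definition fibre_coord :: "'i \<Rightarrow> ('a, 'i, 'n::finite) copoint \<Rightarrow> 'n \<Rightarrow> real"
  where "fibre_coord c u i = snd u c $ i"

definition g_low ::
  "('a, 'i, real ^ 'n) manifold \<Rightarrow> ('a, 'i, 'n::finite) metric \<Rightarrow> 'i \<Rightarrow> ('a, 'i, 'n) copoint \<Rightarrow>
   'n \<Rightarrow> 'n \<Rightarrow> real" where
  "g_low M g c u i j = metric_matrix M g c (fst u) $ i $ j"

definition g_up ::
  "('a, 'i, real ^ 'n) manifold \<Rightarrow> ('a, 'i, 'n::finite) metric \<Rightarrow> 'i \<Rightarrow> ('a, 'i, 'n) copoint \<Rightarrow>
   'n \<Rightarrow> 'n \<Rightarrow> real" where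
  "g_up M g c u i j = inverse_metric_matrix M g c (fst u) $ i $ j"

definition g_up0 ::
  "('a, 'i, real ^ 'n) manifold \<Rightarrow> ('a, 'i, 'n::finite) metric \<Rightarrow> 'i \<Rightarrow> ('a, 'i, 'n) copoint \<Rightarrow>
   'n \<Rightarrow> real" where
  "g_up0 M g c u i = (\<Sum>h\<in>UNIV. fibre_coord c u h * g_up M g c u h i)"

definition energy_density ::
  "('a, 'i, real ^ 'n) manifold \<Rightarrow> ('a, 'i, 'n::finite) metric \<Rightarrow> 'i \<Rightarrow> ('a, 'i, 'n) copoint \<Rightarrow>
   real" where
  "energy_density M g c u =
     1/2 * (\<Sum>i\<in>UNIV. \<Sum>j\<in>UNIV. g_up M g c u i j * fibre_coord c u i * fibre_coord c u j)"

definition partial_q ::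
  "('a, 'i, real ^ 'n) manifold \<Rightarrow> 'i \<Rightarrow> ('a, 'i, 'n::finite) copoint \<Rightarrow> 'n \<Rightarrow>
   'i \<Rightarrow> (real ^ 'n) \<times> (real ^ 'n)" where
  "partial_q M c u i = tangent_vector (cotangent_bundle M) c u (axis i 1, 0)"

definition partial_p ::
  "('a, 'i, real ^ 'n) manifold \<Rightarrow> 'i \<Rightarrow> ('a, 'i, 'n::finite) copoint \<Rightarrow> 'n \<Rightarrow>
   'i \<Rightarrow> (real ^ 'n) \<times> (real ^ 'n)" where
  "partial_p M c u i = tangent_vector (cotangent_bundle M) c u (0, axis i 1)"

definition christoffel0 ::
  "('a, 'i, real ^ 'n) manifold \<Rightarrow> ('a, 'i, 'n::finite) metric \<Rightarrow> 'i \<Rightarrow> ('a, 'i, 'n) copoint \<Rightarrow>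
   'n \<Rightarrow> 'n \<Rightarrow> real" where
  "christoffel0 M g c u i h = (\<Sum>k\<in>UNIV. fibre_coord c u k * christoffel M g c k i h (fst u))"

definition delta_q ::
  "('a, 'i, real ^ 'n) manifold \<Rightarrow> ('a, 'i, 'n::finite) metric \<Rightarrow> 'i \<Rightarrow> ('a, 'i, 'n) copoint \<Rightarrow>
   'n \<Rightarrow> 'i \<Rightarrow> (real ^ 'n) \<times> (real ^ 'n)" where
  "delta_q M g c u i =
     partial_q M c u i + (\<Sum>h\<in>UNIV. christoffel0 M g c u i h *\<^sub>R partial_p M c u h)"

end

theory Submission
  imports Defs
begin

text \<open> Over a chart of \<open>M\<close> the horizontal fields \<open>\<delta>/\<delta>q\<^sup>i\<close> together with their images under \<open>J\<close>
  form a frame, and the Nijenhuis tensor satisfies \<open>N(JX, Y) = - J N(X, Y)\<close>. So \<open>J\<close> is integrable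
  if and only if \<open>N(\<delta>/\<delta>q\<^sup>i, \<delta>/\<delta>q\<^sup>j) = 0\<close> for all \<open>i, j\<close> (\<open>nijenhuis_tensor_J\<close>,
  \<open>nijenhuis_tensor_eq_0I\<close>).

  Write \<open>J \<delta>/\<delta>q\<^sup>i = (\<alpha> g\<^sub>i\<^sub>j + \<beta> p\<^sub>i p\<^sub>j) \<partial>/\<partial>p\<^sub>j\<close> with \<open>\<alpha> = A t \<lambda>\<close> and \<open>\<beta> = b\<^sub>1\<close>. The energy
  density \<open>t\<close>, the metric and the covector \<open>p\<close> are parallel along the horizontal fields. Therefore
  the two mixed brackets in \<open>N\<close> cancel (\<open>bracket_ver_hor\<close>), and what remains is the bracket of the
  two vertical fields minus the bracket of the two horizontal ones, which is the curvature
  (\<open>nijenhuis_tensor_hor\<close>): the component of \<open>N(\<delta>/\<delta>q\<^sup>i, \<delta>/\<delta>q\<^sup>j)\<close> along \<open>\<partial>/\<partial>p\<^sub>l\<close> is \<open>F(t) (p\<^sub>i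
  g\<^sub>j\<^sub>l - p\<^sub>j g\<^sub>i\<^sub>l) - p\<^sub>k R\<^sup>k\<^sub>l\<^sub>i\<^sub>j\<close>, where \<open>F = (\<alpha> + 2 t \<beta>) \<alpha>' - \<alpha> \<beta> = A\<^sup>2 t \<lambda> (\<lambda> + t \<lambda>') + A t
  (\<lambda> + 2 t \<lambda>') b\<^sub>1\<close>.

  If this vanishes, compare \<open>p\<close> with \<open>s p\<close>: the curvature term and the bracket \<open>p\<^sub>i g\<^sub>j\<^sub>l - p\<^sub>j
  g\<^sub>i\<^sub>l\<close>, which is nonzero for suitable \<open>i, j, l\<close> because \<open>n > 1\<close>, both scale by \<open>s\<close>, while \<open>t\<close>
  scales by \<open>s\<^sup>2\<close>. Hence \<open>F\<close> is a constant \<open>\<kappa>\<close> (\<open>curvature_identity_imp_balance_constant\<close>).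
  Solving \<open>F = \<kappa>\<close> for \<open>b\<^sub>1\<close> gives the stated formula, and the remaining identity is linear in \<open>p\<close>
  and says that \<open>M\<close> has constant curvature \<open>\<kappa>\<close>. All steps can be reversed; to recover the
  curvature tensor from sectional curvatures one polarises (\<open>curvature_like_eq_0\<close>), which uses the
  symmetries of the curvature tensor. The final inequality is \<open>A \<lambda> + 2 b\<^sub>1 > 0\<close> with \<open>b\<^sub>1\<close>
  eliminated.

  Tangent vectors are families of components in all charts, and a field must be smooth in every
  chart. Passing between fields on the cotangent bundle and functions on \<open>\<real>\<^sup>n \<times> \<real>\<^sup>n\<close> thus requires
  that the cotangent bundle is itself an atlas with smooth transition maps, and that the Lie
  bracket of two fields is again a tangent vector, for which second derivatives of transition maps
  must commute. \<close>

section \<open>Calculus of \<open>C\<^sup>k\<close> maps\<close>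

lemma Ck_on_SucI:
  assumes "\<And>x. x \<in> S \<Longrightarrow> f differentiable (at x)"
    and "\<And>v. Ck_on k S (\<lambda>x. frechet_derivative f (at x) v)"
  shows "Ck_on (Suc k) S f"
  using assms by simp

lemma Ck_on_Suc_imp: "Ck_on (Suc k) S f \<Longrightarrow> Ck_on k S f"
proof (induction k arbitrary: f)
  case 0
  then show ?case
    by (auto intro!: continuous_at_imp_continuous_on differentiable_imp_continuous_within)
next
  case (Suc k)
  then show ?case by auto
qed

lemma Ck_on_subset: "Ck_on k S f \<Longrightarrow> T \<subseteq> S \<Longrightarrow> Ck_on k T f"
proof (induction k arbitrary: f)
  case 0
  then show ?case using continuous_on_subset by auto
next
  case (Suc k)
  then show ?case by auto
qed

lemma frechet_derivative_eq:
  "(f has_derivative f') (at x) \<Longrightarrow> frechet_derivative f (at x) = f'"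
  by (metis frechet_derivative_at)

lemma Ck_on_cong:
  assumes "open S" "\<And>x. x \<in> S \<Longrightarrow> f x = g x"
  shows "Ck_on k S f \<longleftrightarrow> Ck_on k S g"
proof -
  have imp: "Ck_on k S g" if "Ck_on k S f" "\<And>x. x \<in> S \<Longrightarrow> f x = g x" for f g :: "'a \<Rightarrow> 'b"
    using that
  proof (induction k arbitrary: f g)
    case 0
    then show ?case by (simp cong: continuous_on_cong)
  next
    case (Suc k)
    have d: "(g has_derivative frechet_derivative f (at x)) (at x)" if "x \<in> S" for x
    proof (rule has_derivative_transform_within_open[OF _ assms(1) that])
      show "(f has_derivative frechet_derivative f (at x)) (at x)"
        using Suc.prems(1) that by (simp add: frechet_derivative_works)
    qed (use Suc.prems(2) in simp)
    show ?case
    proof (rule Ck_on_SucI)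
      show "g differentiable (at x)" if "x \<in> S" for x
        using d[OF that] by (auto simp: differentiable_def)
      show "Ck_on k S (\<lambda>x. frechet_derivative g (at x) v)" for v
        by (rule Suc.IH[of "\<lambda>x. frechet_derivative f (at x) v"])
           (use Suc.prems(1) frechet_derivative_eq[OF d] in simp_all)
    qed
  qed
  show ?thesis
    using imp[of f g] imp[of g f] assms(2) by auto
qed

text \<open>Every closure property below is an instance of this induction step: it is enough to know the
  derivative as an expression in functions that are already under control.\<close>

lemma Ck_on_Suc_derivativeI:
  assumes "open S" "\<And>x. x \<in> S \<Longrightarrow> (f has_derivative f' x) (at x)"
    and "\<And>v. Ck_on k S (\<lambda>x. f' x v)"
  shows "Ck_on (Suc k) S f"
proof (rule Ck_on_SucI)
  show "f differentiable (at x)" if "x \<in> S" for x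
    using assms(2)[OF that] by (auto simp: differentiable_def)
  show "Ck_on k S (\<lambda>x. frechet_derivative f (at x) v)" for v
    by (rule iffD1[OF Ck_on_cong[OF assms(1)] assms(3)[of v]])
       (simp add: frechet_derivative_eq[OF assms(2)])
qed

lemma Ck_on_Suc_has_derivative:
  "Ck_on (Suc k) S f \<Longrightarrow> x \<in> S \<Longrightarrow> (f has_derivative frechet_derivative f (at x)) (at x)"
  by (simp add: frechet_derivative_works)

lemma Ck_on_const: "open S \<Longrightarrow> Ck_on k S (\<lambda>x. c)"
  by (induction k arbitrary: c) auto

lemma Ck_on_linear:
  assumes "bounded_linear h" "open S"
  shows "Ck_on k S f \<Longrightarrow> Ck_on k S (\<lambda>x. h (f x))"
proof (induction k arbitrary: f)
  case 0
  then show ?case by (auto intro: bounded_linear.continuous_on[OF assms(1)])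
next
  case (Suc k)
  show ?case
  proof (rule Ck_on_Suc_derivativeI[OF assms(2)])
    show "((\<lambda>x. h (f x)) has_derivative (\<lambda>v. h (frechet_derivative f (at x) v))) (at x)"
      if "x \<in> S" for x
      using bounded_linear.has_derivative[OF assms(1) Ck_on_Suc_has_derivative[OF Suc.prems that]] .
    show "Ck_on k S (\<lambda>x. h (frechet_derivative f (at x) v))" for v
      using Suc.prems by (intro Suc.IH) simp
  qed
qed

lemma Ck_on_add:
  assumes "open S"
  shows "Ck_on k S f \<Longrightarrow> Ck_on k S g \<Longrightarrow> Ck_on k S (\<lambda>x. f x + g x)"
proof (induction k arbitrary: f g)
  case 0
  then show ?case by (simp add: continuous_on_add)
next
  case (Suc k)
  show ?case
  proof (rule Ck_on_Suc_derivativeI[OF assms])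
    show "((\<lambda>x. f x + g x) has_derivative
        (\<lambda>v. frechet_derivative f (at x) v + frechet_derivative g (at x) v)) (at x)"
      if "x \<in> S" for x
      using has_derivative_add[OF Ck_on_Suc_has_derivative[OF Suc.prems(1) that]
          Ck_on_Suc_has_derivative[OF Suc.prems(2) that]] .
    show "Ck_on k S (\<lambda>x. frechet_derivative f (at x) v + frechet_derivative g (at x) v)" for v
      by (rule Suc.IH) (use Suc.prems in simp_all)
  qed
qed

lemma Ck_on_sum:
  assumes "open S" "\<And>i. i \<in> I \<Longrightarrow> Ck_on k S (f i)"
  shows "Ck_on k S (\<lambda>x. \<Sum>i\<in>I. f i x)"
  using assms(2)
proof (induction I rule: infinite_finite_induct)
  case (insert i I)
  then have "Ck_on k S (\<lambda>x. f i x + (\<Sum>i\<in>I. f i x))"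
    by (intro Ck_on_add[OF assms(1)]) simp_all
  then show ?case using insert.hyps by simp
qed (simp_all add: Ck_on_const assms(1))

lemma Ck_on_bilinear:
  assumes h: "bounded_bilinear h" and "open S"
  shows "Ck_on k S f \<Longrightarrow> Ck_on k S g \<Longrightarrow> Ck_on k S (\<lambda>x. h (f x) (g x))"
proof (induction k arbitrary: f g)
  case 0
  then show ?case by (auto intro: bounded_bilinear.continuous_on[OF h])
next
  case (Suc k)
  show ?case
  proof (rule Ck_on_Suc_derivativeI[OF assms(2)])
    show "((\<lambda>x. h (f x) (g x)) has_derivative
       (\<lambda>v. h (f x) (frechet_derivative g (at x) v) + h (frechet_derivative f (at x) v) (g x)))
           (at x)"
      if "x \<in> S" for x
      using bounded_bilinear.FDERIV[OF h Ck_on_Suc_has_derivative[OF Suc.prems(1) that]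
          Ck_on_Suc_has_derivative[OF Suc.prems(2) that]] .
    show "Ck_on k S (\<lambda>x. h (f x) (frechet_derivative g (at x) v)
        + h (frechet_derivative f (at x) v) (g x))" for v
    proof (rule Ck_on_add[OF assms(2)])
      show "Ck_on k S (\<lambda>x. h (f x) (frechet_derivative g (at x) v))"
        using Suc.prems(2) by (intro Suc.IH Ck_on_Suc_imp[OF Suc.prems(1)]) simp
      show "Ck_on k S (\<lambda>x. h (frechet_derivative f (at x) v) (g x))"
        using Suc.prems(1) by (intro Suc.IH Ck_on_Suc_imp[OF Suc.prems(2)]) simp
    qed
  qed
qed

text \<open>A map is recovered from its coordinates; this turns the derivative of a composition into a
  sum of products.\<close>

lemma linear_eq_sum_Basis:
  fixes f :: "'a::euclidean_space \<Rightarrow> 'b::real_vector"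
  assumes "linear f"
  shows "f v = (\<Sum>b\<in>Basis. (v \<bullet> b) *\<^sub>R f b)"
proof -
  have "f v = f (\<Sum>b\<in>Basis. (v \<bullet> b) *\<^sub>R b)" by (simp add: euclidean_representation)
  also have "\<dots> = (\<Sum>b\<in>Basis. (v \<bullet> b) *\<^sub>R f b)"
    by (simp only: linear_sum[OF assms] linear_scale[OF assms])
  finally show ?thesis .
qed

lemma Ck_on_compose:
  fixes g :: "'a::real_normed_vector \<Rightarrow> 'b::euclidean_space"
    and f :: "'b \<Rightarrow> 'c::real_normed_vector"
  assumes "open S" "open T"
  shows "Ck_on k S g \<Longrightarrow> Ck_on k T f \<Longrightarrow> g ` S \<subseteq> T \<Longrightarrow> Ck_on k S (\<lambda>x. f (g x))"
proof (induction k arbitrary: f)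
  case 0
  then show ?case by (auto intro: continuous_on_compose2)
next
  case (Suc k)
  let ?f' = "\<lambda>y. frechet_derivative f (at y)"
  let ?g' = "\<lambda>y. frechet_derivative g (at y)"
  show ?case
  proof (rule Ck_on_Suc_derivativeI[OF assms(1)])
    fix x assume x: "x \<in> S"
    have gx: "g x \<in> T" using x Suc.prems(3) by auto
    have f': "(f has_derivative ?f' (g x)) (at (g x))"
      using Ck_on_Suc_has_derivative[OF Suc.prems(2) gx] .
    have "((\<lambda>x. f (g x)) has_derivative (\<lambda>v. ?f' (g x) (?g' x v))) (at x)"
      using has_derivative_compose[OF Ck_on_Suc_has_derivative[OF Suc.prems(1) x] f'] .
    moreover have "?f' (g x) (?g' x v) = (\<Sum>b\<in>Basis. (?g' x v \<bullet> b) *\<^sub>R ?f' (g x) b)" for v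
      by (rule linear_eq_sum_Basis) (rule has_derivative_linear[OF f'])
    ultimately show "((\<lambda>x. f (g x)) has_derivative
        (\<lambda>v. \<Sum>b\<in>Basis. (?g' x v \<bullet> b) *\<^sub>R ?f' (g x) b)) (at x)"
      by simp
  next
    fix v
    show "Ck_on k S (\<lambda>x. \<Sum>b\<in>Basis. (?g' x v \<bullet> b) *\<^sub>R ?f' (g x) b)"
    proof (intro Ck_on_sum[OF assms(1)]
        Ck_on_bilinear[OF bounded_bilinear_scaleR assms(1)])
      fix b :: 'b
      show "Ck_on k S (\<lambda>x. ?g' x v \<bullet> b)"
        using Suc.prems(1)
        by (intro Ck_on_linear[OF bounded_linear_inner_left assms(1)]) auto
      show "Ck_on k S (\<lambda>x. ?f' (g x) b)"
        by (rule Suc.IH) (use Suc.prems Ck_on_Suc_imp[OF Suc.prems(1)] in auto)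
    qed
  qed
qed

lemma Ck_on_Pair:
  assumes "open S" "Ck_on k S f" "Ck_on k S g"
  shows "Ck_on k S (\<lambda>x. (f x, g x))"
proof -
  have "Ck_on k S (\<lambda>x. (f x, 0) + (0, g x))"
    by (intro Ck_on_add[OF assms(1)]
        Ck_on_linear[OF bounded_linear_Pair[OF bounded_linear_ident bounded_linear_zero] assms(1)]
        Ck_on_linear[OF bounded_linear_Pair[OF bounded_linear_zero bounded_linear_ident] assms(1)]
        assms(2,3))
  then show ?thesis by simp
qed

lemma Ck_on_ident: "open S \<Longrightarrow> Ck_on k S (\<lambda>x. x)"
proof (cases k)
  case (Suc l)
  assume "open S"
  then show ?thesis
    unfolding Suc by (auto intro: Ck_on_const)
qed auto

lemma smooth_on_differentiable: "smooth_on S f \<Longrightarrow> x \<in> S \<Longrightarrow> f differentiable (at x)"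
  unfolding smooth_on_def by (metis Ck_on.simps(2))

lemma smooth_on_has_derivative:
  "smooth_on S f \<Longrightarrow> x \<in> S \<Longrightarrow> (f has_derivative frechet_derivative f (at x)) (at x)"
  using smooth_on_differentiable frechet_derivative_works by blast

lemma smooth_on_frechet_derivative:
  "smooth_on S f \<Longrightarrow> smooth_on S (\<lambda>x. frechet_derivative f (at x) v)"
  unfolding smooth_on_def by (metis Ck_on.simps(2))

lemma smooth_on_imp_continuous_on: "smooth_on S f \<Longrightarrow> continuous_on S f"
  unfolding smooth_on_def by (metis Ck_on.simps(1))

lemma smooth_on_compose:
  fixes g :: "'a::real_normed_vector \<Rightarrow> 'b::euclidean_space"
  assumes "open S" "open T" "smooth_on S g" "smooth_on T f" "g ` S \<subseteq> T"
  shows "smooth_on S (\<lambda>x. f (g x))"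
  using assms unfolding smooth_on_def by (auto intro: Ck_on_compose)

lemma smooth_on_cong:
  assumes "open S" "\<And>x. x \<in> S \<Longrightarrow> f x = g x"
  shows "smooth_on S f \<longleftrightarrow> smooth_on S g"
  unfolding smooth_on_def using Ck_on_cong[of S f g] assms by auto

lemma smooth_on_subset: "smooth_on S f \<Longrightarrow> T \<subseteq> S \<Longrightarrow> smooth_on T f"
  unfolding smooth_on_def using Ck_on_subset by blast

section \<open>Symmetry of second derivatives\<close>

text \<open>Two applications of the mean value theorem, first along \<open>u\<close> and then along \<open>v\<close>, express the
  mixed second difference of \<open>f\<close> by a single value of the iterated derivative.\<close>

lemma second_difference_mean_value:
  fixes f :: "'a::real_normed_vector \<Rightarrow> real"
  assumes h: "h > 0"
    and dom: "\<And>s r. 0 \<le> s \<Longrightarrow> s \<le> h \<Longrightarrow> 0 \<le> r \<Longrightarrow> r \<le> h \<Longrightarrow> x + s *\<^sub>R u + r *\<^sub>R v \<in> S"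
    and f: "\<And>y. y \<in> S \<Longrightarrow> (f has_derivative f' y) (at y)"
    and f': "\<And>y. y \<in> S \<Longrightarrow> ((\<lambda>y. f' y u) has_derivative f'' y) (at y)"
  obtains s r where "0 < s" "s < h" "0 < r" "r < h"
    "f (x + h *\<^sub>R u + h *\<^sub>R v) - f (x + h *\<^sub>R u) - f (x + h *\<^sub>R v) + f x
       = h\<^sup>2 * f'' (x + s *\<^sub>R u + r *\<^sub>R v) v"
proof -
  define \<psi> where "\<psi> s = f (x + s *\<^sub>R u + h *\<^sub>R v) - f (x + s *\<^sub>R u + 0 *\<^sub>R v)" for s
  have \<psi>: "(\<psi> has_real_derivative
      f' (x + s *\<^sub>R u + h *\<^sub>R v) u - f' (x + s *\<^sub>R u + 0 *\<^sub>R v) u) (at s)" if "0 \<le> s" "s \<le> h" for s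
  proof -
    have *: "((\<lambda>s. f (x + s *\<^sub>R u + r *\<^sub>R v)) has_real_derivative f' (x + s *\<^sub>R u + r *\<^sub>R v) u)
        (at s)"
      if r: "0 \<le> r" "r \<le> h" for r
    proof -
      have S: "x + s *\<^sub>R u + r *\<^sub>R v \<in> S" using dom \<open>0 \<le> s\<close> \<open>s \<le> h\<close> r by blast
      have "((\<lambda>s. x + s *\<^sub>R u + r *\<^sub>R v) has_derivative (\<lambda>k. k *\<^sub>R u)) (at s)"
        by (auto intro!: derivative_eq_intros)
      from has_derivative_compose[OF this f[OF S]] show ?thesis
        unfolding has_field_derivative_def
        by (rule has_derivative_eq_rhs)
           (simp add: linear_scale[OF has_derivative_linear[OF f[OF S]]] mult.commute fun_eq_iff)
    qed
    show ?thesis unfolding \<psi>_def using h by (intro DERIV_diff *) auto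
  qed
  obtain s where s: "0 < s" "s < h" and 1: "\<psi> h - \<psi> 0 =
      (h - 0) * (f' (x + s *\<^sub>R u + h *\<^sub>R v) u - f' (x + s *\<^sub>R u + 0 *\<^sub>R v) u)"
    using MVT2[OF h \<psi>] by blast
  define \<phi> where "\<phi> r = f' (x + s *\<^sub>R u + r *\<^sub>R v) u" for r
  have \<phi>: "(\<phi> has_real_derivative f'' (x + s *\<^sub>R u + r *\<^sub>R v) v) (at r)" if r: "0 \<le> r" "r \<le> h" for r
  proof -
    have S: "x + s *\<^sub>R u + r *\<^sub>R v \<in> S" using dom s r by auto
    have "((\<lambda>r. x + s *\<^sub>R u + r *\<^sub>R v) has_derivative (\<lambda>k. k *\<^sub>R v)) (at r)"
      by (auto intro!: derivative_eq_intros)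
    from has_derivative_compose[OF this f'[OF S]] show ?thesis
      unfolding has_field_derivative_def \<phi>_def
      by (rule has_derivative_eq_rhs)
         (simp add: linear_scale[OF has_derivative_linear[OF f'[OF S]]] mult.commute fun_eq_iff)
  qed
  obtain r where r: "0 < r" "r < h" and 2: "\<phi> h - \<phi> 0 = (h - 0) * f'' (x + s *\<^sub>R u + r *\<^sub>R v) v"
    using MVT2[OF h \<phi>] by blast
  have "f (x + h *\<^sub>R u + h *\<^sub>R v) - f (x + h *\<^sub>R u) - f (x + h *\<^sub>R v) + f x = \<psi> h - \<psi> 0"
    by (simp add: \<psi>_def)
  also have "\<dots> = h\<^sup>2 * f'' (x + s *\<^sub>R u + r *\<^sub>R v) v"
    using 1 2 by (simp add: \<phi>_def power2_eq_square)
  finally show ?thesis using that s r by blast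
qed

text \<open>Both orders of differentiation compute the same mixed second difference, up to the
  evaluation point; continuity lets the points tend to \<open>x\<close>.\<close>

lemma symmetric_second_derivative_real:
  fixes f :: "'a::real_normed_vector \<Rightarrow> real"
  assumes S: "open S" "x \<in> S"
    and f: "\<And>y. y \<in> S \<Longrightarrow> (f has_derivative f' y) (at y)"
    and fu: "\<And>y. y \<in> S \<Longrightarrow> ((\<lambda>y. f' y u) has_derivative fu y) (at y)"
    and fv: "\<And>y. y \<in> S \<Longrightarrow> ((\<lambda>y. f' y v) has_derivative fv y) (at y)"
    and cont: "isCont (\<lambda>y. fu y v) x" "isCont (\<lambda>y. fv y u) x"
  shows "fu x v = fv x u"
proof (rule ccontr)
  assume neq: "fu x v \<noteq> fv x u"
  define e where "e = \<bar>fu x v - fv x u\<bar> / 2"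
  have e: "e > 0" using neq by (simp add: e_def)
  obtain d1 where d1: "d1 > 0" "ball x d1 \<subseteq> S" using S open_contains_ball by blast
  obtain d2 where d2: "d2 > 0" "\<And>y. dist y x < d2 \<Longrightarrow> \<bar>fu y v - fu x v\<bar> < e"
    using cont(1) e unfolding continuous_at_eps_delta dist_real_def by blast
  obtain d3 where d3: "d3 > 0" "\<And>y. dist y x < d3 \<Longrightarrow> \<bar>fv y u - fv x u\<bar> < e"
    using cont(2) e unfolding continuous_at_eps_delta dist_real_def by blast
  define d where "d = min d1 (min d2 d3)"
  define h where "h = d / (2 * (norm u + norm v + 1))"
  have d: "d > 0" using d1 d2 d3 by (simp add: d_def)
  have h: "h > 0" using d by (auto simp: h_def intro!: divide_pos_pos add_nonneg_pos)
  have near: "dist (x + s *\<^sub>R u + r *\<^sub>R v) x < d" if "0 \<le> s" "s \<le> h" "0 \<le> r" "r \<le> h" for s r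
  proof -
    have "dist (x + s *\<^sub>R u + r *\<^sub>R v) x = norm (s *\<^sub>R u + r *\<^sub>R v)"
      by (simp add: dist_norm algebra_simps)
    also have "\<dots> \<le> s * norm u + r * norm v"
      using that norm_triangle_ineq[of "s *\<^sub>R u" "r *\<^sub>R v"] by simp
    also have "\<dots> \<le> h * norm u + h * norm v"
      using that by (intro add_mono mult_right_mono) auto
    also have "\<dots> \<le> h * (norm u + norm v + 1)" using h by (simp add: algebra_simps)
    also have "\<dots> = d / 2"
      using add_nonneg_pos[of "norm u + norm v" 1] by (simp add: h_def field_simps)
    also have "\<dots> < d" using d by simp
    finally show ?thesis .
  qed
  have in_S: "x + s *\<^sub>R u + r *\<^sub>R v \<in> S" if "0 \<le> s" "s \<le> h" "0 \<le> r" "r \<le> h" for s r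
    using near[OF that] d1(2) by (auto simp: d_def dist_commute)
  have in_S': "x + s *\<^sub>R v + r *\<^sub>R u \<in> S" if "0 \<le> s" "s \<le> h" "0 \<le> r" "r \<le> h" for s r
    using in_S[OF that(3,4,1,2)] by (simp add: algebra_simps)
  obtain s r where sr: "0 < s" "s < h" "0 < r" "r < h" and
    1: "f (x + h *\<^sub>R u + h *\<^sub>R v) - f (x + h *\<^sub>R u) - f (x + h *\<^sub>R v) + f x
       = h\<^sup>2 * fu (x + s *\<^sub>R u + r *\<^sub>R v) v"
    using second_difference_mean_value[where f = f, OF h in_S f fu] by blast
  obtain s' r' where sr': "0 < s'" "s' < h" "0 < r'" "r' < h" and
    2: "f (x + h *\<^sub>R v + h *\<^sub>R u) - f (x + h *\<^sub>R v) - f (x + h *\<^sub>R u) + f x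
       = h\<^sup>2 * fv (x + s' *\<^sub>R v + r' *\<^sub>R u) u"
    using second_difference_mean_value[where f = f, OF h in_S' f fv] by blast
  have sw: "x + h *\<^sub>R v + h *\<^sub>R u = x + h *\<^sub>R u + h *\<^sub>R v"
    "x + s' *\<^sub>R v + r' *\<^sub>R u = x + r' *\<^sub>R u + s' *\<^sub>R v" by (simp_all add: algebra_simps)
  have "h\<^sup>2 * fu (x + s *\<^sub>R u + r *\<^sub>R v) v = h\<^sup>2 * fv (x + r' *\<^sub>R u + s' *\<^sub>R v) u"
    using 1 2 unfolding sw by linarith
  then have "fu (x + s *\<^sub>R u + r *\<^sub>R v) v = fv (x + r' *\<^sub>R u + s' *\<^sub>R v) u"
    using h by simp
  moreover have "\<bar>fu (x + s *\<^sub>R u + r *\<^sub>R v) v - fu x v\<bar> < e"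
    using d2(2) near[of s r] sr by (simp add: d_def)
  moreover have "\<bar>fv (x + r' *\<^sub>R u + s' *\<^sub>R v) u - fv x u\<bar> < e"
    using d3(2) near[of r' s'] sr' by (simp add: d_def)
  moreover have "\<bar>fu x v - fv x u\<bar> = 2 * e" by (simp add: e_def)
  ultimately show False by linarith
qed

lemma symmetric_second_derivative:
  fixes f :: "'a::real_normed_vector \<Rightarrow> 'b::euclidean_space"
  assumes "open S" "smooth_on S f" "x \<in> S"
  shows "frechet_derivative (\<lambda>y. frechet_derivative f (at y) u) (at x) v
       = frechet_derivative (\<lambda>y. frechet_derivative f (at y) v) (at x) u"
proof (rule euclidean_eqI)
  fix b :: 'b assume "b \<in> Basis"
  let ?D = "\<lambda>w y. frechet_derivative (\<lambda>y. frechet_derivative f (at y) w) (at y)"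
  have 1: "((\<lambda>y. f y \<bullet> b) has_derivative (\<lambda>w. frechet_derivative f (at y) w \<bullet> b)) (at y)"
    if "y \<in> S" for y
    using has_derivative_inner_left[OF smooth_on_has_derivative[OF assms(2) that]] .
  have 2: "((\<lambda>y. frechet_derivative f (at y) w \<bullet> b) has_derivative (\<lambda>w'. ?D w y w' \<bullet> b)) (at y)"
    if "y \<in> S" for y w
    by (intro has_derivative_inner_left
        smooth_on_has_derivative[OF smooth_on_frechet_derivative[OF assms(2)] that])
  have 3: "isCont (\<lambda>y. ?D w y w' \<bullet> b) x" for w w'
  proof -
    have "continuous_on S (\<lambda>y. ?D w y w')"
      by (intro smooth_on_imp_continuous_on smooth_on_frechet_derivative assms(2))
    then have "isCont (\<lambda>y. ?D w y w') x"
      using assms(1,3) continuous_on_eq_continuous_at by blast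
    then show ?thesis by (intro continuous_intros)
  qed
  show "?D u x v \<bullet> b = ?D v x u \<bullet> b"
    using symmetric_second_derivative_real[OF assms(1,3) 1 2 2 3 3] .
qed

section \<open>Linear families of maps and the local Nijenhuis tensor\<close>

text \<open>The product rule for a map that is linear in its second argument: writing the argument in
  coordinates reduces it to finitely many products of differentiable functions.\<close>

lemma has_derivative_linear_family:
  fixes B :: "'a::real_normed_vector \<Rightarrow> 'e::euclidean_space \<Rightarrow> 'f::real_normed_vector"
  assumes X: "(X has_derivative X') (at z)" and U: "open U" "z \<in> U"
    and lin: "\<And>y. y \<in> U \<Longrightarrow> linear (B y)"
    and B: "\<And>b. b \<in> Basis \<Longrightarrow> (\<lambda>y. B y b) differentiable (at z)"
  shows "((\<lambda>y. B y (X y)) has_derivative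
           (\<lambda>v. B z (X' v) + frechet_derivative (\<lambda>y. B y (X z)) (at z) v)) (at z)"
proof -
  let ?D = "\<lambda>b. frechet_derivative (\<lambda>y. B y b) (at z)"
  have gen: "((\<lambda>y. B y (Y y)) has_derivative
      (\<lambda>v. \<Sum>b\<in>Basis. (Y z \<bullet> b) *\<^sub>R ?D b v + (Y' v \<bullet> b) *\<^sub>R B z b)) (at z)"
    if Y: "(Y has_derivative Y') (at z)" for Y Y'
  proof (rule has_derivative_transform_within_open[OF _ U])
    show "((\<lambda>y. \<Sum>b\<in>Basis. (Y y \<bullet> b) *\<^sub>R B y b) has_derivative
      (\<lambda>v. \<Sum>b\<in>Basis. (Y z \<bullet> b) *\<^sub>R ?D b v + (Y' v \<bullet> b) *\<^sub>R B z b)) (at z)"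
      by (intro has_derivative_sum has_derivative_scaleR has_derivative_inner_left Y
          frechet_derivative_works[THEN iffD1] B)
    show "(\<Sum>b\<in>Basis. (Y y \<bullet> b) *\<^sub>R B y b) = B y (Y y)" if "y \<in> U" for y
      by (rule linear_eq_sum_Basis[OF lin[OF that], symmetric])
  qed
  have c: "frechet_derivative (\<lambda>y. B y (X z)) (at z) v = (\<Sum>b\<in>Basis. (X z \<bullet> b) *\<^sub>R ?D b v)" for v
    using frechet_derivative_eq[OF gen[OF has_derivative_const[of "X z"]]] by simp
  have "B z (X' v) = (\<Sum>b\<in>Basis. (X' v \<bullet> b) *\<^sub>R B z b)" for v
    by (rule linear_eq_sum_Basis[OF lin[OF U(2)]])
  with gen[OF X] show ?thesis by (simp add: c sum.distrib add.commute)
qed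

text \<open>Linearity is asked near \<open>z\<close>, so that it passes to the derivative; differentiability only at
  \<open>z\<close>.\<close>

definition linear_family_at ::
  "('e::euclidean_space \<Rightarrow> 'e \<Rightarrow> 'e) \<Rightarrow> 'e set \<Rightarrow> 'e \<Rightarrow> bool" where
  "linear_family_at B U z \<longleftrightarrow> open U \<and> z \<in> U \<and> (\<forall>y\<in>U. linear (B y)) \<and>
     (\<forall>e. (\<lambda>y. B y e) differentiable (at z))"

abbreviation family_deriv ::
  "('e::euclidean_space \<Rightarrow> 'e \<Rightarrow> 'e) \<Rightarrow> 'e \<Rightarrow> 'e \<Rightarrow> 'e \<Rightarrow> 'e" where
  "family_deriv B z v e \<equiv> frechet_derivative (\<lambda>y. B y e) (at z) v"

lemma linear_family_apply:
  assumes "linear_family_at B U z" "(X has_derivative X') (at z)"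
  shows "((\<lambda>y. B y (X y)) has_derivative (\<lambda>v. B z (X' v) + family_deriv B z v (X z))) (at z)"
  using assms unfolding linear_family_at_def by (intro has_derivative_linear_family) auto

lemma linear_family_deriv:
  assumes "linear_family_at B U z"
  shows "linear (\<lambda>v. family_deriv B z v e)" "linear (\<lambda>e. family_deriv B z v e)"
proof -
  have B: "(\<lambda>y. B y e) differentiable (at z)" for e
    using assms unfolding linear_family_at_def by blast
  show "linear (\<lambda>v. family_deriv B z v e)"
    using linear_frechet_derivative[OF B] .
  have *: "((\<lambda>y. B y e) has_derivative (\<lambda>v. family_deriv B z v e)) (at z)" for e
    using B frechet_derivative_works by blast
  have U: "open U" "z \<in> U" using assms unfolding linear_family_at_def by auto
  have lin: "linear (B y)" if "y \<in> U" for y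
    using assms that unfolding linear_family_at_def by auto
  show "linear (\<lambda>e. family_deriv B z v e)"
  proof (rule linearI)
    fix e f :: 'a and r :: real
    have "((\<lambda>y. B y (e + f)) has_derivative
        (\<lambda>v. family_deriv B z v e + family_deriv B z v f)) (at z)"
      by (rule has_derivative_transform_within_open[OF has_derivative_add[OF * *] U(1,2)])
         (simp add: linear_add[OF lin])
    then show "family_deriv B z v (e + f) = family_deriv B z v e + family_deriv B z v f"
      by (simp add: frechet_derivative_eq)
    have "((\<lambda>y. B y (r *\<^sub>R e)) has_derivative (\<lambda>v. r *\<^sub>R family_deriv B z v e)) (at z)"
      by (rule has_derivative_transform_within_open[OF has_derivative_scaleR_right[OF *] U(1,2)])
         (simp add: linear_scale[OF lin])
    then show "family_deriv B z v (r *\<^sub>R e) = r *\<^sub>R family_deriv B z v e"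
      by (simp add: frechet_derivative_eq)
  qed
qed

definition local_bracket :: "('e::euclidean_space \<Rightarrow> 'e) \<Rightarrow> ('e \<Rightarrow> 'e) \<Rightarrow> 'e \<Rightarrow> 'e" where
  "local_bracket X Y z = frechet_derivative Y (at z) (X z) - frechet_derivative X (at z) (Y z)"

definition nijenhuis_tensor ::
  "('e::euclidean_space \<Rightarrow> 'e \<Rightarrow> 'e) \<Rightarrow> 'e \<Rightarrow> 'e \<Rightarrow> 'e \<Rightarrow> 'e" where
  "nijenhuis_tensor B z x y =
     family_deriv B z (B z x) y - family_deriv B z (B z y) x
     + B z (family_deriv B z y x) - B z (family_deriv B z x y)"

text \<open>The derivatives of \<open>X\<close> and \<open>Y\<close> cancel from the Nijenhuis expression when \<open>B\<^sup>2 = -1\<close>, which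
  leaves an expression in the values of \<open>X\<close> and \<open>Y\<close> at the point.\<close>

lemma local_nijenhuis_tensorial:
  assumes B: "linear_family_at B U z" and sq: "\<And>e. B z (B z e) = - e"
    and X: "X differentiable (at z)" and Y: "Y differentiable (at z)"
  defines "JX \<equiv> \<lambda>y. B y (X y)" and "JY \<equiv> \<lambda>y. B y (Y y)"
  shows "local_bracket JX JY z - B z (local_bracket JX Y z) - B z (local_bracket X JY z)
         - local_bracket X Y z = nijenhuis_tensor B z (X z) (Y z)"
proof -
  have dJX: "frechet_derivative JX (at z) v =
      B z (frechet_derivative X (at z) v) + family_deriv B z v (X z)" for v
    unfolding JX_def
      frechet_derivative_eq[OF linear_family_apply[OF B X[unfolded frechet_derivative_works]]] ..
  have dJY: "frechet_derivative JY (at z) v =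
      B z (frechet_derivative Y (at z) v) + family_deriv B z v (Y z)" for v
    unfolding JY_def
      frechet_derivative_eq[OF linear_family_apply[OF B Y[unfolded frechet_derivative_works]]] ..
  have lin: "linear (B z)" using B unfolding linear_family_at_def by auto
  have J: "JX z = B z (X z)" "JY z = B z (Y z)" by (simp_all add: JX_def JY_def)
  show ?thesis
    unfolding local_bracket_def nijenhuis_tensor_def dJX dJY J
    by (simp add: linear_add[OF lin] linear_diff[OF lin] sq)
qed

lemma nijenhuis_tensor_antisym: "nijenhuis_tensor B z y x = - nijenhuis_tensor B z x y"
  by (simp add: nijenhuis_tensor_def)

lemma linear_nijenhuis_tensor:
  assumes B: "linear_family_at B U z"
  shows "linear (\<lambda>x. nijenhuis_tensor B z x y)" "linear (\<lambda>y. nijenhuis_tensor B z x y)"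
proof -
  have lin: "linear (B z)" using B unfolding linear_family_at_def by auto
  note [simp] = linear_add[OF lin] linear_scale[OF lin]
    linear_add[OF linear_family_deriv(1)[OF B]] linear_scale[OF linear_family_deriv(1)[OF B]]
    linear_add[OF linear_family_deriv(2)[OF B]] linear_scale[OF linear_family_deriv(2)[OF B]]
  show "linear (\<lambda>x. nijenhuis_tensor B z x y)" "linear (\<lambda>y. nijenhuis_tensor B z x y)"
    by (rule linearI; simp add: nijenhuis_tensor_def algebra_simps)+
qed

text \<open>Differentiating \<open>B\<^sup>2 = -1\<close> shows that \<open>B\<close> anticommutes with its derivatives.\<close>

lemma nijenhuis_tensor_J:
  assumes B: "linear_family_at B U z" and sq: "\<And>y e. y \<in> U \<Longrightarrow> B y (B y e) = - e"
  shows "nijenhuis_tensor B z (B z x) y = - B z (nijenhuis_tensor B z x y)"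
proof -
  have U: "open U" "z \<in> U" and lin: "linear (B z)" and diff: "\<And>e. (\<lambda>y. B y e) differentiable (at z)"
    using B unfolding linear_family_at_def by auto
  have anti: "family_deriv B z v (B z e) = - B z (family_deriv B z v e)" for v e
  proof -
    have "((\<lambda>y. B y (B y e)) has_derivative
        (\<lambda>v. B z (family_deriv B z v e) + family_deriv B z v (B z e))) (at z)"
      using diff[of e] by (intro linear_family_apply[OF B]) (simp add: frechet_derivative_works)
    moreover have "((\<lambda>y. B y (B y e)) has_derivative (\<lambda>v. 0)) (at z)"
      by (rule has_derivative_transform_within_open[OF has_derivative_const[of "- e"] U])
         (simp add: sq)
    ultimately have "(\<lambda>v. B z (family_deriv B z v e) + family_deriv B z v (B z e)) = (\<lambda>v. 0)"
      by (rule has_derivative_unique)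
    from fun_cong[OF this, of v] show ?thesis by (simp add: eq_neg_iff_add_eq_0 add.commute)
  qed
  have neg: "family_deriv B z (- v) e = - family_deriv B z v e" for v e
    using linear_neg[OF linear_family_deriv(1)[OF B]] .
  show ?thesis
    by (simp add: nijenhuis_tensor_def anti sq[OF U(2)] neg linear_add[OF lin]
        linear_diff[OF lin] linear_neg[OF lin])
qed

text \<open>Since \<open>N(Bx, y) = - B N(x, y)\<close>, the tensor vanishes as soon as it vanishes on vectors that
  span the space together with their images under \<open>B\<close>. This is what makes the horizontal fields
  suffice.\<close>

lemma nijenhuis_tensor_eq_0I:
  assumes B: "linear_family_at B U z" and sq: "\<And>y e. y \<in> U \<Longrightarrow> B y (B y e) = - e"
    and frame: "\<And>v. \<exists>a b. v = (\<Sum>i\<in>(UNIV::'i::finite set). a i *\<^sub>R d i) + B z (\<Sum>i\<in>UNIV. b i *\<^sub>R d i)"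
    and 0: "\<And>i j. nijenhuis_tensor B z (d i) (d j) = 0"
  shows "nijenhuis_tensor B z x y = 0"
proof -
  let ?N = "nijenhuis_tensor B z"
  note l = linear_nijenhuis_tensor[OF B]
  have lin: "linear (B z)" using B unfolding linear_family_at_def by auto
  have J1: "?N (B z x) y = - B z (?N x y)" for x y
    by (rule nijenhuis_tensor_J[OF B sq])
  have J2: "?N x (B z y) = - B z (?N x y)" for x y
  proof -
    have "?N x (B z y) = B z (?N y x)"
      using nijenhuis_tensor_antisym[of B z x "B z y"] by (simp add: J1)
    also have "\<dots> = - B z (?N x y)"
      unfolding nijenhuis_tensor_antisym[of B z y x] by (simp add: linear_neg[OF lin])
    finally show ?thesis .
  qed
  have 1: "?N (\<Sum>i\<in>UNIV. a i *\<^sub>R d i) (\<Sum>i\<in>UNIV. b i *\<^sub>R d i) = 0" for a b :: "'i \<Rightarrow> real"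
    by (simp add: linear_sum[OF l(1)] linear_sum[OF l(2)] linear_scale[OF l(1)]
        linear_scale[OF l(2)] 0)
  obtain a b where x: "x = (\<Sum>i\<in>UNIV. a i *\<^sub>R d i) + B z (\<Sum>i\<in>UNIV. b i *\<^sub>R d i)"
    using frame by blast
  obtain a' b' where y: "y = (\<Sum>i\<in>UNIV. a' i *\<^sub>R d i) + B z (\<Sum>i\<in>UNIV. b' i *\<^sub>R d i)"
    using frame by blast
  show ?thesis
    unfolding x y linear_add[OF l(1)] linear_add[OF l(2)] J1 J2 1
    by (simp add: linear_0[OF lin])
qed

lemma scaleR_fun_apply: "(r *\<^sub>R f) x = r *\<^sub>R f x"
  by (simp add: scaleR_fun_def)

section \<open>Charts, tangent spaces and the Lie bracket\<close>

text \<open>The part of the manifold axioms that concerns only charts; the cotangent bundle satisfies it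
  as well.\<close>

locale smooth_atlas =
  fixes N :: "('a, 'i, 'e::euclidean_space) manifold"
  assumes inj_chart: "i \<in> charts N \<Longrightarrow> inj_on (chart_map N i) (chart_dom N i)"
    and open_overlap: "i \<in> charts N \<Longrightarrow> j \<in> charts N \<Longrightarrow>
          open (chart_map N i ` (chart_dom N i \<inter> chart_dom N j))"
    and smooth_transition: "i \<in> charts N \<Longrightarrow> j \<in> charts N \<Longrightarrow>
          smooth_on (chart_map N i ` (chart_dom N i \<inter> chart_dom N j))
            (chart_map N j \<circ> chart_inv N i)"
begin

lemma chart_inv_map: "i \<in> charts N \<Longrightarrow> x \<in> chart_dom N i \<Longrightarrow> chart_inv N i (chart_map N i x) = x"
  unfolding chart_inv_def by (rule inv_into_f_f[OF inj_chart])

lemma chart_inv_charts_at: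
  "i \<in> charts_at N x \<Longrightarrow> chart_inv N i (chart_map N i x) = x"
  by (simp add: charts_at_def chart_inv_map)

lemma transition_has_derivative:
  assumes "i \<in> charts_at N x" "j \<in> charts_at N x"
  shows "(chart_map N j \<circ> chart_inv N i has_derivative transition_deriv N i j x)
           (at (chart_map N i x))"
  unfolding transition_deriv_def
  by (rule smooth_on_has_derivative[OF smooth_transition])
     (use assms in \<open>auto simp: charts_at_def\<close>)

lemma linear_transition:
  assumes "i \<in> charts_at N x" "j \<in> charts_at N x"
  shows "linear (transition_deriv N i j x)"
  using has_derivative_linear[OF transition_has_derivative[OF assms]] .

text \<open>The chain rule for transition maps; it makes a vector given in one chart a tangent vector.\<close>

lemma transition_cocycle:
  assumes i: "i \<in> charts_at N x" and j: "j \<in> charts_at N x" and k: "k \<in> charts_at N x"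
  shows "transition_deriv N j k x (transition_deriv N i j x e) = transition_deriv N i k x e"
proof -
  let ?t = "\<lambda>i j. chart_map N j \<circ> chart_inv N i"
  have c: "i \<in> charts N" "j \<in> charts N" "x \<in> chart_dom N i" "x \<in> chart_dom N j"
    using i j by (auto simp: charts_at_def)
  have "?t i j (chart_map N i x) = chart_map N j x"
    using c by (simp add: chart_inv_map)
  then have "(?t j k has_derivative transition_deriv N j k x) (at (?t i j (chart_map N i x)))"
    using transition_has_derivative[OF j k] by simp
  from diff_chain_at[OF transition_has_derivative[OF i j] this]
  have "(?t j k \<circ> ?t i j has_derivative transition_deriv N j k x \<circ> transition_deriv N i j x)
      (at (chart_map N i x))" .
  then have "(?t i k has_derivative transition_deriv N j k x \<circ> transition_deriv N i j x)
      (at (chart_map N i x))"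
    by (rule has_derivative_transform_within_open[OF _ open_overlap[OF c(1,2)]])
       (use c in \<open>auto simp: chart_inv_map\<close>)
  from has_derivative_unique[OF this transition_has_derivative[OF i k]]
  show ?thesis by (simp add: fun_eq_iff)
qed

lemma transition_id:
  assumes i: "i \<in> charts_at N x"
  shows "transition_deriv N i i x e = e"
proof -
  have c: "i \<in> charts N" "x \<in> chart_dom N i"
    using i by (auto simp: charts_at_def)
  have "(chart_map N i \<circ> chart_inv N i has_derivative (\<lambda>v. v)) (at (chart_map N i x))"
    by (rule has_derivative_transform_within_open[OF has_derivative_ident open_overlap[OF c(1,1)]])
       (use c in \<open>auto simp: chart_inv_map\<close>)
  from has_derivative_unique[OF this transition_has_derivative[OF i i]]
  show ?thesis by (simp add: fun_eq_iff)
qed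

lemma tangent_vector_in: "i \<in> charts_at N x \<Longrightarrow> tangent_vector N i x e \<in> tangent_space N x"
  by (simp add: tangent_space_def tangent_vector_def transition_cocycle)

lemma tangent_vector_component: "i \<in> charts_at N x \<Longrightarrow> tangent_vector N i x e i = e"
  by (simp add: tangent_vector_def transition_id)

lemma tangent_space_change_of_chart:
  "v \<in> tangent_space N x \<Longrightarrow> i \<in> charts_at N x \<Longrightarrow> j \<in> charts_at N x \<Longrightarrow>
    v j = transition_deriv N i j x (v i)"
  unfolding tangent_space_def by blast

lemma tangent_space_outside: "v \<in> tangent_space N x \<Longrightarrow> i \<notin> charts_at N x \<Longrightarrow> v i = 0"
  unfolding tangent_space_def by blast

lemma tangent_vector_eq:
  assumes "i \<in> charts_at N x" "v \<in> tangent_space N x"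
  shows "tangent_vector N i x (v i) = v"
proof
  fix j
  show "tangent_vector N i x (v i) j = v j"
    using tangent_space_change_of_chart[OF assms(2,1), of j]
      tangent_space_outside[OF assms(2), of j] by (simp add: tangent_vector_def)
qed

lemma tangent_vector_add:
  "i \<in> charts_at N x \<Longrightarrow>
    tangent_vector N i x (e + f) = tangent_vector N i x e + tangent_vector N i x f"
  by (auto simp: tangent_vector_def fun_eq_iff linear_add[OF linear_transition])

lemma tangent_vector_scale:
  "i \<in> charts_at N x \<Longrightarrow> tangent_vector N i x (r *\<^sub>R e) = r *\<^sub>R tangent_vector N i x e"
  by (auto simp: tangent_vector_def fun_eq_iff scaleR_fun_apply linear_scale[OF linear_transition])

lemma tangent_vector_linear: "i \<in> charts_at N x \<Longrightarrow> linear (tangent_vector N i x)"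
  by (rule linearI) (simp_all add: tangent_vector_add tangent_vector_scale)

text \<open>Openness read off in the charts, for arbitrary atlases.\<close>

definition chart_open :: "'a set \<Rightarrow> bool" where
  "chart_open W \<longleftrightarrow> (\<forall>i\<in>charts N. open (chart_map N i ` (W \<inter> chart_dom N i)))"

definition differentiable_field_at :: "'a set \<Rightarrow> 'a \<Rightarrow> ('a \<Rightarrow> 'i \<Rightarrow> 'e) \<Rightarrow> bool" where
  "differentiable_field_at W x X \<longleftrightarrow> chart_open W \<and> x \<in> W \<and> (\<forall>y\<in>W. X y \<in> tangent_space N y) \<and>
     (\<forall>i\<in>charts_at N x. local_rep N i X differentiable (at (chart_map N i x)))"

text \<open>A change of chart adds to the derivative of the components of a field a term with the second
  derivative of the transition map. This term is symmetric, so it drops out of the Lie bracket.\<close>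

lemma local_rep_change_of_chart:
  assumes X: "differentiable_field_at W x X" and i: "i \<in> charts_at N x" and j: "j \<in> charts_at N x"
  shows "frechet_derivative (local_rep N j X) (at (chart_map N j x)) (transition_deriv N i j x w)
    = transition_deriv N i j x (frechet_derivative (local_rep N i X) (at (chart_map N i x)) w)
      + frechet_derivative (\<lambda>z. frechet_derivative (chart_map N j \<circ> chart_inv N i) (at z) (X x i))
          (at (chart_map N i x)) w"
proof -
  let ?t = "chart_map N j \<circ> chart_inv N i"
  let ?z = "chart_map N i x"
  let ?O = "chart_map N i ` (chart_dom N i \<inter> chart_dom N j)"
  let ?U = "chart_map N i ` (W \<inter> chart_dom N i) \<inter> ?O"
  have c: "i \<in> charts N" "j \<in> charts N" "x \<in> chart_dom N i" "x \<in> chart_dom N j" "x \<in> W"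
    using i j X by (auto simp: charts_at_def differentiable_field_at_def)
  have U: "open ?U" "?z \<in> ?U"
    using X c open_overlap[OF c(1,2)] unfolding differentiable_field_at_def chart_open_def by auto
  have tz: "?t ?z = chart_map N j x" using c by (simp add: chart_inv_map)
  have smooth: "smooth_on ?O ?t" by (rule smooth_transition[OF c(1,2)])
  have diffX: "(local_rep N k X has_derivative frechet_derivative (local_rep N k X) (at (chart_map
      N k x)))
      (at (chart_map N k x))" if "k \<in> charts_at N x" for k
    using X that frechet_derivative_works unfolding differentiable_field_at_def by blast
  have 1: "((\<lambda>z. local_rep N j X (?t z)) has_derivative
      (\<lambda>w. frechet_derivative (local_rep N j X) (at (chart_map N j x)) (transition_deriv N i j x
          w))) (at ?z)"
    using has_derivative_compose[OF transition_has_derivative[OF i j]] diffX[OF j] tz by force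
  have 2: "((\<lambda>z. frechet_derivative ?t (at z) (local_rep N i X z)) has_derivative
      (\<lambda>w. frechet_derivative ?t (at ?z) (frechet_derivative (local_rep N i X) (at ?z) w)
        + frechet_derivative (\<lambda>z. frechet_derivative ?t (at z) (local_rep N i X ?z)) (at ?z) w))
            (at ?z)"
  proof (rule has_derivative_linear_family[OF diffX[OF i] U])
    show "linear (frechet_derivative ?t (at y))" if "y \<in> ?U" for y
      using linear_frechet_derivative smooth_on_differentiable[OF smooth] that by blast
    show "(\<lambda>y. frechet_derivative ?t (at y) b) differentiable (at ?z)" for b
      by (rule smooth_on_differentiable[OF smooth_on_frechet_derivative[OF smooth]]) (use U in auto)
  qed
  have 3: "frechet_derivative ?t (at z) (local_rep N i X z) = local_rep N j X (?t z)"
    if z: "z \<in> ?U" for z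
  proof -
    obtain y where y: "z = chart_map N i y" "y \<in> chart_dom N i" "y \<in> chart_dom N j" using z by auto
    moreover obtain y' where "z = chart_map N i y'" "y' \<in> chart_dom N i" "y' \<in> W" using z by auto
    ultimately have "y \<in> W" using inj_chart[OF c(1)] by (metis inj_onD)
    then have "X y \<in> tangent_space N y" using X unfolding differentiable_field_at_def by blast
    moreover have "i \<in> charts_at N y" "j \<in> charts_at N y" using c y by (auto simp: charts_at_def)
    ultimately have "X y j = transition_deriv N i j y (X y i)"
      by (rule tangent_space_change_of_chart)
    then show ?thesis using y c
      by (simp add: local_rep_def chart_inv_map transition_deriv_def)
  qed
  note has_derivative_unique[OF 1 has_derivative_transform_within_open[OF 2 U 3]]
  from fun_cong[OF this, of w] show ?thesis
    using c by (simp add: local_rep_def chart_inv_map transition_deriv_def)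
qed

lemma lie_bracket_tangent:
  assumes X: "differentiable_field_at W x X" and Y: "differentiable_field_at W x Y"
  shows "lie_bracket N X Y x \<in> tangent_space N x"
  unfolding tangent_space_def
proof (intro CollectI conjI ballI allI impI)
  fix i j assume i: "i \<in> charts_at N x" and j: "j \<in> charts_at N x"
  let ?T = "transition_deriv N i j x"
  have tX: "X x j = ?T (X x i)" and tY: "Y x j = ?T (Y x i)"
    using tangent_space_change_of_chart[OF _ i j] X Y
    unfolding differentiable_field_at_def by blast+
  have sym: "frechet_derivative (\<lambda>z. frechet_derivative (chart_map N j \<circ> chart_inv N i) (at z) (X
      x i))
          (at (chart_map N i x)) (Y x i)
      = frechet_derivative (\<lambda>z. frechet_derivative (chart_map N j \<circ> chart_inv N i) (at z) (Y x i))
          (at (chart_map N i x)) (X x i)"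
    by (rule symmetric_second_derivative[OF open_overlap smooth_transition])
       (use i j in \<open>auto simp: charts_at_def\<close>)
  show "lie_bracket N X Y x j = ?T (lie_bracket N X Y x i)"
    using i j
    by (simp add: lie_bracket_def tX tY local_rep_change_of_chart[OF X i j]
        local_rep_change_of_chart[OF Y i j] linear_diff[OF linear_transition] sym)
next
  show "lie_bracket N X Y x i = 0" if "i \<notin> charts_at N x" for i
    using that by (simp add: lie_bracket_def)
qed

section \<open>The Nijenhuis tensor in a chart\<close>

definition local_endo :: "('a \<Rightarrow> ('i \<Rightarrow> 'e) \<Rightarrow> ('i \<Rightarrow> 'e)) \<Rightarrow> 'i \<Rightarrow> 'e \<Rightarrow> 'e \<Rightarrow> 'e" where
  "local_endo J i z e = J (chart_inv N i z) (tangent_vector N i (chart_inv N i z) e) i"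

lemma endo_component:
  assumes "i \<in> charts_at N x" "v \<in> tangent_space N x"
  shows "J x v i = local_endo J i (chart_map N i x) (v i)"
  using assms by (simp add: local_endo_def chart_inv_charts_at tangent_vector_eq)

lemma linear_local_endo:
  assumes J: "endomorphism_field_on N W J" and x: "x \<in> W" and i: "i \<in> charts_at N x"
  shows "linear (local_endo J i (chart_map N i x))"
proof (rule linearI)
  have J': "J x (a *\<^sub>R v + b *\<^sub>R w) = a *\<^sub>R J x v + b *\<^sub>R J x w"
    if "v \<in> tangent_space N x" "w \<in> tangent_space N x" for v w a b
    using J x that unfolding endomorphism_field_on_def by blast
  note t = tangent_vector_in[OF i]
  show "local_endo J i (chart_map N i x) (e + f)
      = local_endo J i (chart_map N i x) e + local_endo J i (chart_map N i x) f" for e f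
    using J'[OF t t, of 1 e 1 f] i
    by (simp add: local_endo_def chart_inv_charts_at tangent_vector_add)
  show "local_endo J i (chart_map N i x) (r *\<^sub>R e) = r *\<^sub>R local_endo J i (chart_map N i x) e" for
      r e
    using J'[OF t t, of r e 0 e] i
    by (simp add: local_endo_def chart_inv_charts_at tangent_vector_scale scaleR_fun_apply)
qed

text \<open>Each bracket in the Nijenhuis expression is again a tangent vector, so \<open>J\<close> acts on it
  through its component in the chart, and the local computation applies.\<close>

lemma nijenhuis_in_chart:
  assumes J: "endomorphism_field_on N W J"
    and smoothJ: "\<And>i e. i \<in> charts_at N x \<Longrightarrow>
          (\<lambda>z. local_endo J i z e) differentiable (at (chart_map N i x))"
    and sq: "\<And>i e. i \<in> charts_at N x \<Longrightarrow>
          local_endo J i (chart_map N i x) (local_endo J i (chart_map N i x) e) = - e"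
    and X: "differentiable_field_at W x X" and Y: "differentiable_field_at W x Y"
  shows "i \<in> charts_at N x \<Longrightarrow> nijenhuis N J X Y x i =
           nijenhuis_tensor (local_endo J i) (chart_map N i x) (X x i) (Y x i)"
    and "i \<notin> charts_at N x \<Longrightarrow> nijenhuis N J X Y x i = 0"
proof -
  let ?z = "\<lambda>i. chart_map N i x"
  let ?U = "\<lambda>i. chart_map N i ` (W \<inter> chart_dom N i)"
  have W: "chart_open W" "x \<in> W" using X unfolding differentiable_field_at_def by auto
  have fam: "linear_family_at (local_endo J i) (?U i) (?z i)" if i: "i \<in> charts_at N x" for i
    unfolding linear_family_at_def
  proof (intro conjI ballI allI)
    show "open (?U i)" using W i unfolding chart_open_def charts_at_def by auto
    show "?z i \<in> ?U i" using W i unfolding charts_at_def by auto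
    show "linear (local_endo J i y)" if "y \<in> ?U i" for y
      using that i linear_local_endo[OF J] by (auto simp: charts_at_def)
    show "(\<lambda>y. local_endo J i y e) differentiable (at (?z i))" for e
      using smoothJ[OF i] .
  qed
  have rep: "local_rep N i (apply_field J Z) z = local_endo J i z (local_rep N i Z z)"
    if "i \<in> charts_at N x" "z \<in> ?U i" "\<forall>y\<in>W. Z y \<in> tangent_space N y" for i z Z
  proof -
    obtain y where y: "z = chart_map N i y" "y \<in> W" "i \<in> charts_at N y"
      using \<open>z \<in> ?U i\<close> \<open>i \<in> charts_at N x\<close> by (auto simp: charts_at_def)
    then show ?thesis
      using endo_component[of i y "Z y" J] \<open>\<forall>y\<in>W. Z y \<in> tangent_space N y\<close>
      by (simp add: local_rep_def apply_field_def chart_inv_charts_at)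
  qed
  have der: "(local_rep N i (apply_field J Z) has_derivative
      frechet_derivative (\<lambda>z. local_endo J i z (local_rep N i Z z)) (at (?z i))) (at (?z i))"
    if Z: "differentiable_field_at W x Z" and i: "i \<in> charts_at N x" for i Z
  proof (rule has_derivative_transform_within_open)
    have "local_rep N i Z differentiable (at (?z i))"
      using Z i unfolding differentiable_field_at_def by blast
    then have "(\<lambda>z. local_endo J i z (local_rep N i Z z)) differentiable (at (?z i))"
      using linear_family_apply[OF fam[OF i]] unfolding differentiable_def by blast
    then show "((\<lambda>z. local_endo J i z (local_rep N i Z z)) has_derivative
      frechet_derivative (\<lambda>z. local_endo J i z (local_rep N i Z z)) (at (?z i))) (at (?z i))"
      using frechet_derivative_works by blast
    show "open (?U i)" "?z i \<in> ?U i" using fam[OF i] unfolding linear_family_at_def by auto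
    show "local_endo J i z (local_rep N i Z z) = local_rep N i (apply_field J Z) z"
      if "z \<in> ?U i" for z
      using rep[OF i that, of Z] Z unfolding differentiable_field_at_def by simp
  qed
  have JZ: "differentiable_field_at W x (apply_field J Z)" if Z: "differentiable_field_at W x Z"
      for Z
    using Z der[OF Z] J
    unfolding differentiable_field_at_def endomorphism_field_on_def apply_field_def
        differentiable_def
    by blast
  have val: "local_rep N i Z (?z i) = Z x i" if "i \<in> charts_at N x" for i Z
    using that by (simp add: local_rep_def chart_inv_charts_at)
  have valJ: "apply_field J Z x i = local_endo J i (?z i) (Z x i)"
    if "i \<in> charts_at N x" "Z x \<in> tangent_space N x" for i Z
    using endo_component[OF that] by (simp add: apply_field_def)
  have tan: "X x \<in> tangent_space N x" "Y x \<in> tangent_space N x"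
    using X Y W unfolding differentiable_field_at_def by auto
  note br = lie_bracket_tangent[OF JZ[OF X] Y] lie_bracket_tangent[OF X JZ[OF Y]]
    lie_bracket_tangent[OF JZ[OF X] JZ[OF Y]] lie_bracket_tangent[OF X Y]
  show "nijenhuis N J X Y x i =
      nijenhuis_tensor (local_endo J i) (?z i) (X x i) (Y x i)" if i: "i \<in> charts_at N x"
  proof -
    have "local_rep N i X differentiable (at (?z i))" "local_rep N i Y differentiable (at (?z i))"
      using X Y i unfolding differentiable_field_at_def by auto
    from local_nijenhuis_tensorial[OF fam[OF i] sq[OF i] this]
    show ?thesis
      unfolding nijenhuis_def fun_diff_def 
        valJ[where Z = "lie_bracket N (apply_field J X) Y", OF i br(1)]
        valJ[where Z = "lie_bracket N X (apply_field J Y)", OF i br(2)]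
      by (simp add: lie_bracket_def local_bracket_def i val[OF i]
          valJ[where Z = X, OF i tan(1)] valJ[where Z = Y, OF i tan(2)]
          frechet_derivative_eq[OF der[OF X i]] frechet_derivative_eq[OF der[OF Y i]])
  qed
  show "nijenhuis N J X Y x i = 0" if i: "i \<notin> charts_at N x"
  proof -
    have J0: "J x v i = 0" if "v \<in> tangent_space N x" for v
      using tangent_space_outside[OF _ i] J W that unfolding endomorphism_field_on_def by blast
    show ?thesis
      unfolding nijenhuis_def fun_diff_def
      using tangent_space_outside[OF br(3) i] tangent_space_outside[OF br(4) i] J0[OF br(1)]
        J0[OF br(2)]
      by (simp add: apply_field_def)
  qed
qed

text \<open>These fields extend any given tangent vector over a chart domain; they are smooth in every
  other chart because transition maps are.\<close>

lemma smooth_constant_component_field: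
  assumes c: "c \<in> charts N" and V: "V \<subseteq> chart_dom N c" "chart_open V"
  shows "smooth_vector_field_on N V (\<lambda>x. tangent_vector N c x e)"
  unfolding smooth_vector_field_on_def
proof (intro conjI ballI)
  show "tangent_vector N c x e \<in> tangent_space N x" if "x \<in> V" for x
    using that V c by (intro tangent_vector_in) (auto simp: charts_at_def)
  fix i assume i: "i \<in> charts N"
  let ?Oc = "chart_map N c ` (chart_dom N c \<inter> chart_dom N i)"
  let ?U = "chart_map N i ` (V \<inter> chart_dom N i)"
  have U: "open ?U" using V i unfolding chart_open_def by auto
  have inner: "smooth_on ?U (chart_map N c \<circ> chart_inv N i)"
    by (rule smooth_on_subset[OF smooth_transition[OF i c]]) (use V in auto)
  have "(chart_map N c \<circ> chart_inv N i) ` ?U \<subseteq> ?Oc"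
    using V i by (auto simp: chart_inv_map)
  from smooth_on_compose[OF U open_overlap[OF c i] inner
      smooth_on_frechet_derivative[OF smooth_transition[OF c i]] this]
  have "smooth_on ?U (\<lambda>z. frechet_derivative (chart_map N i \<circ> chart_inv N c)
      (at ((chart_map N c \<circ> chart_inv N i) z)) e)" .
  then show "smooth_on ?U (local_rep N i (\<lambda>x. tangent_vector N c x e))"
  proof (rule iffD1[OF smooth_on_cong[OF U], rotated])
    fix z assume "z \<in> ?U"
    then obtain x where x: "z = chart_map N i x" "x \<in> V" "x \<in> chart_dom N i" by auto
    then show "frechet_derivative (chart_map N i \<circ> chart_inv N c)
        (at ((chart_map N c \<circ> chart_inv N i) z)) e = local_rep N i (\<lambda>x. tangent_vector N c x e) z"
      using i by (simp add: local_rep_def chart_inv_map tangent_vector_def charts_at_def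
          transition_deriv_def)
  qed
qed

lemma smooth_field_differentiable:
  assumes "smooth_vector_field_on N V X" "chart_open V" "x \<in> V"
  shows "differentiable_field_at V x X"
  unfolding differentiable_field_at_def
proof (intro conjI ballI)
  show "local_rep N i X differentiable (at (chart_map N i x))" if "i \<in> charts_at N x" for i
  proof (rule smooth_on_differentiable)
    show "smooth_on (chart_map N i ` (V \<inter> chart_dom N i)) (local_rep N i X)"
      using assms(1) that unfolding smooth_vector_field_on_def charts_at_def by blast
    show "chart_map N i x \<in> chart_map N i ` (V \<inter> chart_dom N i)"
      using assms(3) that unfolding charts_at_def by blast
  qed
qed (use assms in \<open>auto simp: smooth_vector_field_on_def\<close>)

end

lemma smooth_manifold_imp_atlas:
  assumes "smooth_manifold N"
  shows "smooth_atlas N"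
proof
  fix i assume i: "i \<in> charts N"
  have hom: "homeomorphic_map (subtopology (space_of N) (chart_dom N i))
          (top_of_set (chart_map N i ` chart_dom N i)) (chart_map N i)"
    and op: "openin (space_of N) (chart_dom N i)" "open (chart_map N i ` chart_dom N i)"
    using assms i unfolding smooth_manifold_def by auto
  have dom: "chart_dom N i \<subseteq> topspace (space_of N)" using openin_subset[OF op(1)] .
  show "inj_on (chart_map N i) (chart_dom N i)"
    using homeomorphic_imp_injective_map[OF hom] dom by (simp add: Int_absorb1)
  fix j assume j: "j \<in> charts N"
  have "openin (space_of N) (chart_dom N j)"
    using assms j unfolding smooth_manifold_def by auto
  then have "openin (subtopology (space_of N) (chart_dom N i)) (chart_dom N i \<inter> chart_dom N j)"
    by (auto simp: openin_subtopology)
  then have "openin (top_of_set (chart_map N i ` chart_dom N i))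
      (chart_map N i ` (chart_dom N i \<inter> chart_dom N j))"
    using homeomorphic_imp_open_map[OF hom] unfolding open_map_def by blast
  then show "open (chart_map N i ` (chart_dom N i \<inter> chart_dom N j))"
    using op(2) by (simp add: openin_open_eq)
  show "smooth_on (chart_map N i ` (chart_dom N i \<inter> chart_dom N j))
          (chart_map N j \<circ> chart_inv N i)"
    using assms i j unfolding smooth_manifold_def by blast
qed

section \<open>The cotangent bundle\<close>

locale cotangent_atlas = smooth_atlas M for M :: "('a, 'i, real ^ 'n::finite) manifold"
begin

definition covector :: "'i \<Rightarrow> 'a \<Rightarrow> real ^ 'n \<Rightarrow> 'i \<Rightarrow> real ^ 'n" where
  "covector c x p = (\<lambda>j. if j \<in> charts_at M x then adjoint (transition_deriv M j c x) p else 0)"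

text \<open>A covector is transported by the adjoint of the Jacobian of the reverse coordinate change,
  which keeps its pairing with tangent vectors.\<close>

lemma covector_inner:
  assumes "c \<in> charts_at M x" "j \<in> charts_at M x"
  shows "covector c x p j \<bullet> e = p \<bullet> transition_deriv M j c x e"
  using assms adjoint_works[OF linear_transition[OF assms(2,1)], of e p]
  by (simp add: covector_def inner_commute)

lemma covector_component:
  assumes c: "c \<in> charts_at M x"
  shows "covector c x p c = p"
proof -
  have "covector c x p c \<bullet> e = p \<bullet> e" for e
    by (simp add: covector_inner c transition_id)
  then show ?thesis by (metis vector_eq_rdot)
qed

lemma covector_in:
  assumes c: "c \<in> charts_at M x"
  shows "covector c x p \<in> cotangent_space M x"
  unfolding cotangent_space_def
proof (intro CollectI conjI ballI allI impI)
  have "covector c x p i \<bullet> v i = p \<bullet> v c"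
    if "i \<in> charts_at M x" "v \<in> tangent_space M x" for i v
    using that tangent_space_change_of_chart[OF that(2,1) c] by (simp add: covector_inner c)
  then show "covector c x p i \<bullet> v i = covector c x p j \<bullet> v j"
    if "v \<in> tangent_space M x" "i \<in> charts_at M x" "j \<in> charts_at M x" for v i j
    using that by simp
qed (simp add: covector_def)

lemma covector_eq:
  assumes c: "c \<in> charts_at M x" and w: "w \<in> cotangent_space M x"
  shows "covector c x (w c) = w"
proof
  fix j
  show "covector c x (w c) j = w j"
  proof (cases "j \<in> charts_at M x")
    case True
    have "covector c x (w c) j \<bullet> e = w j \<bullet> e" for e
    proof -
      have "w c \<bullet> tangent_vector M j x e c = w j \<bullet> tangent_vector M j x e j"
        using w tangent_vector_in[OF True] c True unfolding cotangent_space_def by blast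
      then show ?thesis
        using c by (simp add: covector_inner[OF c True] tangent_vector_component[OF True])
           (simp add: tangent_vector_def)
    qed
    then show ?thesis by (metis vector_eq_rdot)
  next
    case False
    then show ?thesis using w by (simp add: covector_def cotangent_space_def)
  qed
qed

lemma covector_zero_iff:
  assumes c: "c \<in> charts_at M x" and w: "w \<in> cotangent_space M x"
  shows "w = 0 \<longleftrightarrow> w c = 0"
proof
  assume "w c = 0"
  then have "covector c x 0 = w" using covector_eq[OF c w] by simp
  moreover have "0 \<in> cotangent_space M x" by (simp add: cotangent_space_def)
  ultimately show "w = 0" using covector_eq[OF c, of 0] by simp
qed simp

abbreviation "T \<equiv> cotangent_bundle M"

lemma bundle_simps [simp]:
  "charts T = charts M" "chart_dom T = induced_chart_dom M" "chart_map T = induced_chart_map M"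
  by (simp_all add: cotangent_bundle_def)

lemma in_induced_chart_dom:
  "u \<in> induced_chart_dom M c \<longleftrightarrow> fst u \<in> chart_dom M c \<and> snd u \<in> cotangent_space M (fst u)"
  by (auto simp: induced_chart_dom_def split: prod.splits)

lemma induced_chart_map_eq: "induced_chart_map M c u = (chart_map M c (fst u), snd u c)"
  by (simp add: induced_chart_map_def split: prod.splits)

lemma inj_induced_chart:
  assumes c: "c \<in> charts M"
  shows "inj_on (induced_chart_map M c) (induced_chart_dom M c)"
proof (rule inj_onI)
  fix u v assume u: "u \<in> induced_chart_dom M c" and v: "v \<in> induced_chart_dom M c"
    and eq: "induced_chart_map M c u = induced_chart_map M c v"
  have 1: "fst u = fst v"
    using u v eq inj_onD[OF inj_chart[OF c]] by (auto simp: in_induced_chart_dom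
        induced_chart_map_eq)
  have "c \<in> charts_at M (fst u)" using u c by (simp add: charts_at_def in_induced_chart_dom)
  then have "snd u = snd v"
    using u v eq covector_eq[of c "fst u"] 1
    by (metis in_induced_chart_dom induced_chart_map_eq snd_conv)
  with 1 show "u = v" by (simp add: prod_eq_iff)
qed

lemma image_induced_overlap:
  assumes c: "c \<in> charts M"
  shows "induced_chart_map M c ` (induced_chart_dom M c \<inter> induced_chart_dom M d)
    = chart_map M c ` (chart_dom M c \<inter> chart_dom M d) \<times> UNIV"
proof (intro subset_antisym subsetI)
  fix w assume "w \<in> chart_map M c ` (chart_dom M c \<inter> chart_dom M d) \<times> (UNIV :: (real ^ 'n) set)"
  then obtain x where x: "fst w = chart_map M c x" "x \<in> chart_dom M c" "x \<in> chart_dom M d" by auto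
  have cx: "c \<in> charts_at M x" using x c by (simp add: charts_at_def)
  show "w \<in> induced_chart_map M c ` (induced_chart_dom M c \<inter> induced_chart_dom M d)"
    using x by (intro image_eqI[of _ _ "(x, covector c x (snd w))"])
      (simp_all add: in_induced_chart_dom induced_chart_map_eq covector_in[OF cx]
        covector_component[OF cx] prod_eq_iff)
qed (auto simp: in_induced_chart_dom induced_chart_map_eq)

lemma induced_chart_inv:
  assumes c: "c \<in> charts M" and z: "z \<in> chart_map M c ` chart_dom M c"
  shows "chart_inv T c (z, p) = (chart_inv M c z, covector c (chart_inv M c z) p)"
proof -
  obtain x where x: "z = chart_map M c x" "x \<in> chart_dom M c" using z by auto
  have cx: "c \<in> charts_at M x" using x c by (simp add: charts_at_def)
  have "inv_into (induced_chart_dom M c) (induced_chart_map M c)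
      (induced_chart_map M c (x, covector c x p)) = (x, covector c x p)"
    using x by (intro inv_into_f_f[OF inj_induced_chart[OF c]])
      (simp add: in_induced_chart_dom covector_in[OF cx])
  then show ?thesis
    by (simp add: chart_inv_def[of T] induced_chart_map_eq covector_component[OF cx] x
        chart_inv_map[OF c])
qed

text \<open>The fibre part of a transition map is linear in \<open>p\<close> with coefficients from the Jacobian of
  the transition map of the base, taken in the opposite direction.\<close>

lemma smooth_induced_transition:
  assumes c: "c \<in> charts M" and d: "d \<in> charts M"
  shows "smooth_on (chart_map M c ` (chart_dom M c \<inter> chart_dom M d) \<times> UNIV)
           (induced_chart_map M d \<circ> chart_inv T c)"
proof -
  let ?O = "\<lambda>c d. chart_map M c ` (chart_dom M c \<inter> chart_dom M d)"
  let ?t = "\<lambda>c d. chart_map M d \<circ> chart_inv M c"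
  let ?S = "?O c d \<times> (UNIV :: (real ^ 'n) set)"
  have S: "open ?S" using open_overlap[OF c d] by (intro open_Times) auto
  have fst: "smooth_on ?S (\<lambda>w. ?t c d (fst w))"
    by (rule smooth_on_compose[OF S open_overlap[OF c d] _ smooth_transition[OF c d]])
       (auto simp: smooth_on_def intro!: Ck_on_linear[OF bounded_linear_fst S] Ck_on_ident[OF S])
  have B: "smooth_on ?S (\<lambda>w. frechet_derivative (?t d c) (at (?t c d (fst w))) b)" for b
    by (rule smooth_on_compose[OF S open_overlap[OF d c] fst
          smooth_on_frechet_derivative[OF smooth_transition[OF d c]]])
       (use c d in \<open>auto simp: chart_inv_map\<close>)
  have "smooth_on ?S (\<lambda>w. (?t c d (fst w),
      \<Sum>b\<in>Basis. (snd w \<bullet> frechet_derivative (?t d c) (at (?t c d (fst w))) b) *\<^sub>R b))"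
    unfolding smooth_on_def
    by (intro allI Ck_on_Pair[OF S] fst[unfolded smooth_on_def, rule_format] Ck_on_sum[OF S]
        Ck_on_linear[OF bounded_linear_scaleR_left S] Ck_on_bilinear[OF bounded_bilinear_inner S]
        Ck_on_linear[OF bounded_linear_snd S] Ck_on_ident[OF S] B[unfolded smooth_on_def,
            rule_format])
  then show ?thesis
  proof (rule iffD1[OF smooth_on_cong[OF S], rotated])
    fix w assume "w \<in> ?S"
    then obtain x where x: "fst w = chart_map M c x" "x \<in> chart_dom M c" "x \<in> chart_dom M d" by auto
    have cx: "c \<in> charts_at M x" and dx: "d \<in> charts_at M x"
      using x c d by (simp_all add: charts_at_def)
    have "chart_inv T c (fst w, snd w) = (x, covector c x (snd w))"
      using induced_chart_inv[OF c, of "fst w" "snd w"] x c by (auto simp: chart_inv_map)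
    then have "chart_inv T c w = (x, covector c x (snd w))" by simp
    moreover have "covector c x (snd w) d = (\<Sum>b\<in>Basis. (covector c x (snd w) d \<bullet> b) *\<^sub>R b)"
      by (rule euclidean_representation[symmetric])
    ultimately show "(?t c d (fst w),
      \<Sum>b\<in>Basis. (snd w \<bullet> frechet_derivative (?t d c) (at (?t c d (fst w))) b) *\<^sub>R b)
      = (induced_chart_map M d \<circ> chart_inv T c) w"
      using x c d
      by (simp add: induced_chart_map_eq covector_inner[OF cx dx] chart_inv_map
          transition_deriv_def)
  qed
qed

sublocale cotan: smooth_atlas T
proof
  fix c d assume "c \<in> charts T"
  then have c: "c \<in> charts M" by simp
  show "inj_on (chart_map T c) (chart_dom T c)" using inj_induced_chart[OF c] by simp
  assume "d \<in> charts T"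
  then have d: "d \<in> charts M" by simp
  show "open (chart_map T c ` (chart_dom T c \<inter> chart_dom T d))"
    using open_overlap[OF c d] by (simp add: image_induced_overlap[OF c] open_Times)
  show "smooth_on (chart_map T c ` (chart_dom T c \<inter> chart_dom T d)) (chart_map T d \<circ> chart_inv T c)"
    using smooth_induced_transition[OF c d] by (simp add: image_induced_overlap[OF c])
qed

lemma bundle_charts_at:
  "u \<in> induced_chart_dom M c \<Longrightarrow> charts_at T u = charts_at M (fst u)"
  by (auto simp: charts_at_def in_induced_chart_dom)

text \<open>The topology of the bundle is generated by chart preimages of open sets, so the claim need
  only be checked on generators, where it is continuity of the transition maps.\<close>

lemma openin_bundle_imp_chart_open:
  assumes "openin (space_of T) V"
  shows "cotan.chart_open V"
proof -
  let ?B = "{{u \<in> induced_chart_dom M c. induced_chart_map M c u \<in> S} | c S. c \<in> charts M \<and> open S}"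
  have "generate_topology_on ?B V"
    using assms by (simp add: cotangent_bundle_def openin_topology_generated_by_iff)
  then show ?thesis
  proof induction
    case Empty
    then show ?case by (simp add: cotan.chart_open_def)
  next
    case (Int a b)
    show ?case unfolding cotan.chart_open_def
    proof
      fix c assume c: "c \<in> charts T"
      have "chart_map T c ` (a \<inter> b \<inter> chart_dom T c)
          = chart_map T c ` ((a \<inter> chart_dom T c) \<inter> (b \<inter> chart_dom T c))"
        by (rule arg_cong[where f = "\<lambda>A. chart_map T c ` A"]) auto
      also have "\<dots> = chart_map T c ` (a \<inter> chart_dom T c) \<inter> chart_map T c ` (b \<inter> chart_dom T c)"
        by (rule inj_on_image_Int[OF cotan.inj_chart[OF c]]) auto
      finally show "open (chart_map T c ` (a \<inter> b \<inter> chart_dom T c))"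
        using Int.IH c unfolding cotan.chart_open_def by (simp add: open_Int)
    qed
  next
    case (UN K)
    show ?case unfolding cotan.chart_open_def
    proof
      fix c assume c: "c \<in> charts T"
      have "chart_map T c ` (\<Union>K \<inter> chart_dom T c) = (\<Union>k\<in>K. chart_map T c ` (k \<inter> chart_dom T c))"
        by blast
      then show "open (chart_map T c ` (\<Union>K \<inter> chart_dom T c))"
        using UN.IH c unfolding cotan.chart_open_def by (simp add: open_UN)
    qed
  next
    case (Basis s)
    then obtain d S where s: "s = {u \<in> induced_chart_dom M d. induced_chart_map M d u \<in> S}"
      and d: "d \<in> charts M" and S: "open S" by blast
    show ?case unfolding cotan.chart_open_def
    proof
      fix c assume c: "c \<in> charts T"
      let ?O = "chart_map T c ` (chart_dom T c \<inter> chart_dom T d)"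
      let ?t = "chart_map T d \<circ> chart_inv T c"
      have "chart_map T c ` (s \<inter> chart_dom T c) = ?O \<inter> ?t -` S"
      proof (intro subset_antisym subsetI)
        fix w assume "w \<in> ?O \<inter> ?t -` S"
        then obtain u where u: "w = chart_map T c u" "u \<in> chart_dom T c" "u \<in> chart_dom T d" "?t w
            \<in> S"
          by blast
        then have "u \<in> s" using cotan.chart_inv_map[OF c u(2)] by (simp add: s)
        then show "w \<in> chart_map T c ` (s \<inter> chart_dom T c)" using u by blast
      next
        fix w assume "w \<in> chart_map T c ` (s \<inter> chart_dom T c)"
        then obtain u where u: "w = chart_map T c u" "u \<in> chart_dom T c" "u \<in> s" by blast
        then have "?t w \<in> S" using cotan.chart_inv_map[OF c u(2)] by (simp add: s)
        then show "w \<in> ?O \<inter> ?t -` S" using u by (auto simp: s)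
      qed
      moreover have "open (?O \<inter> ?t -` S)"
        using d by (intro continuous_open_preimage smooth_on_imp_continuous_on
            cotan.smooth_transition[OF c] cotan.open_overlap[OF c] S) simp_all
      ultimately show "open (chart_map T c ` (s \<inter> chart_dom T c))" by simp
    qed
  qed
qed

text \<open>The part of the chart domain over which the structure \<open>J\<close> lives; its points have coordinates
  \<open>(x, p)\<close> with \<open>p \<noteq> 0\<close>.\<close>

definition nonzero_chart_dom :: "'i \<Rightarrow> ('a, 'i, 'n) copoint set" where
  "nonzero_chart_dom c = {u \<in> induced_chart_dom M c. induced_chart_map M c u \<in> {w. snd w \<noteq> 0}}"

lemma openin_nonzero_chart_dom:
  assumes "c \<in> charts M"
  shows "openin (space_of T) (nonzero_chart_dom c)"
proof -
  have "open {w :: (real ^ 'n) \<times> (real ^ 'n). snd w \<noteq> 0}"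
    by (intro open_Collect_neq continuous_intros)
  with assms have "nonzero_chart_dom c \<in>
      {{u \<in> induced_chart_dom M c. induced_chart_map M c u \<in> S} | c S. c \<in> charts M \<and> open S}"
    unfolding nonzero_chart_dom_def by blast
  then show ?thesis
    by (simp add: cotangent_bundle_def topology_generated_by_Basis)
qed

lemma nonzero_chart_dom_eq:
  assumes c: "c \<in> charts M" and points: "chart_dom M c \<subseteq> points M"
  shows "nonzero_chart_dom c = nonzero_cotangent M \<inter> induced_chart_dom M c"
proof -
  have "snd u \<noteq> 0 \<longleftrightarrow> snd u c \<noteq> 0" if "u \<in> induced_chart_dom M c" for u
    using covector_zero_iff[of c "fst u" "snd u"] that c
    by (auto simp: in_induced_chart_dom charts_at_def)
  then show ?thesis
    using points
    by (auto simp: nonzero_chart_dom_def nonzero_cotangent_def induced_chart_map_eq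
        in_induced_chart_dom)
qed

end

section \<open>Riemannian metrics on open sets of \<open>\<real>\<^sup>n\<close>\<close>

lemma sum_delta_mult:
  fixes f :: "'n::finite \<Rightarrow> real"
  shows "(\<Sum>m\<in>UNIV. (if i = m then 1 else 0) * f m) = f i"
    "(\<Sum>m\<in>UNIV. (if m = i then 1 else 0) * f m) = f i"
    "(\<Sum>m\<in>UNIV. f m * (if i = m then 1 else 0)) = f i"
    "(\<Sum>m\<in>UNIV. f m * (if m = i then 1 else 0)) = f i"
  by (simp_all add: if_distrib[of "\<lambda>x. x * _"] if_distrib[of "\<lambda>x. _ * x"] cong: if_cong)

definition partial :: "'n::finite \<Rightarrow> (real ^ 'n \<Rightarrow> real) \<Rightarrow> real ^ 'n \<Rightarrow> real" where
  "partial i f z = frechet_derivative f (at z) (axis i 1)"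

lemma partial_eqI: "(f has_derivative f') (at z) \<Longrightarrow> partial i f z = f' (axis i 1)"
  by (simp add: partial_def frechet_derivative_eq)

lemma partial_cong:
  assumes "f differentiable (at z)" "open U" "z \<in> U" "\<And>y. y \<in> U \<Longrightarrow> f y = g y"
  shows "partial i f z = partial i g z"
  unfolding partial_def using frechet_derivative_transform_within_open[OF assms] by simp

lemma differentiable_cong_open:
  assumes "f differentiable (at z)" "open U" "z \<in> U" "\<And>y. y \<in> U \<Longrightarrow> f y = g y"
  shows "g differentiable (at z)"
proof -
  obtain f' where "(f has_derivative f') (at z)" using assms(1) unfolding differentiable_def by
      blast
  from has_derivative_transform_within_open[OF this assms(2,3,4)] show ?thesis
    unfolding differentiable_def by blast
qed

lemma partial_add:
  assumes "f differentiable (at z)" "g differentiable (at z)"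
  shows "partial i (\<lambda>y. f y + g y) z = partial i f z + partial i g z"
  using partial_eqI[OF has_derivative_add[OF assms[unfolded frechet_derivative_works]]]
  by (simp add: partial_def)

lemma partial_sum_mult:
  fixes f g :: "'m::finite \<Rightarrow> real ^ 'n::finite \<Rightarrow> real"
  assumes "\<And>m. f m differentiable (at z)" "\<And>m. g m differentiable (at z)"
  shows "partial i (\<lambda>y. \<Sum>m\<in>UNIV. f m y * g m y) z = (\<Sum>m\<in>UNIV. f m z * partial i (g m) z + partial
      i (f m) z * g m z)"
proof -
  have "((\<lambda>y. \<Sum>m\<in>UNIV. f m y * g m y) has_derivative (\<lambda>v. \<Sum>m\<in>UNIV.
      f m z * frechet_derivative (g m) (at z) v + frechet_derivative (f m) (at z) v * g m z)) (at
          z)"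
    using assms by (intro has_derivative_sum has_derivative_mult) (simp_all add:
        frechet_derivative_works)
  from partial_eqI[OF this] show ?thesis by (simp add: partial_def)
qed

lemma differentiable_prod:
  fixes f :: "'m \<Rightarrow> 'a::real_normed_vector \<Rightarrow> real"
  assumes "finite I" "\<And>i. i \<in> I \<Longrightarrow> f i differentiable (at z)"
  shows "(\<lambda>y. \<Prod>i\<in>I. f i y) differentiable (at z)"
  using assms by (induction I) (auto intro: differentiable_mult)

lemma differentiable_det:
  fixes A :: "'a::real_normed_vector \<Rightarrow> real ^ 'n ^ 'n::finite"
  assumes "\<And>i j. (\<lambda>y. A y $ i $ j) differentiable (at z)"
  shows "(\<lambda>y. det (A y)) differentiable (at z)"
  unfolding det_def
  by (intro differentiable_sum differentiable_mult differentiable_prod assms ballI)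
     (auto simp: finite_permutations)

lemma invertible_matrix_inv:
  fixes A :: "real ^ 'n ^ 'n::finite"
  assumes "invertible A"
  shows "A ** matrix_inv A = mat 1" "matrix_inv A ** A = mat 1"
proof -
  have "A ** matrix_inv A = mat 1 \<and> matrix_inv A ** A = mat 1"
    using assms unfolding invertible_def matrix_inv_def by (rule someI_ex)
  then show "A ** matrix_inv A = mat 1" "matrix_inv A ** A = mat 1" by auto
qed

text \<open>Cramer's rule makes the entries of the inverse quotients of differentiable functions.\<close>

lemma differentiable_matrix_inv:
  fixes A :: "'a::real_normed_vector \<Rightarrow> real ^ 'n ^ 'n::finite"
  assumes U: "open U" "z \<in> U" and A: "\<And>i j. (\<lambda>y. A y $ i $ j) differentiable (at z)"
    and inv: "\<And>y. y \<in> U \<Longrightarrow> invertible (A y)"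
  shows "(\<lambda>y. matrix_inv (A y) $ k $ j) differentiable (at z)"
proof (rule differentiable_cong_open[OF _ U])
  have nz: "det (A y) \<noteq> 0" if "y \<in> U" for y
    using inv[OF that] by (simp add: invertible_det_nz)
  show "(\<lambda>y. det (\<chi> a b. if b = k then axis j 1 $ a else A y $ a $ b) / det (A y))
      differentiable (at z)"
  proof (intro differentiable_divide differentiable_det A)
    show "(\<lambda>y. (\<chi> a b. if b = k then axis j 1 $ a else A y $ a $ b) $ a $ b) differentiable (at z)"
      for a b
      using A[of a b] by (cases "b = k") simp_all
  qed (use nz U in auto)
  show "det (\<chi> a b. if b = k then axis j 1 $ a else A y $ a $ b) / det (A y) = matrix_inv (A y) $
      k $ j"
    if y: "y \<in> U" for y
  proof -
    have *: "A y *v (matrix_inv (A y) *v axis j 1) = axis j 1"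
      by (simp add: matrix_vector_mul_assoc invertible_matrix_inv[OF inv[OF y]])
    show ?thesis
      using cramer_lemma[of k "A y" "matrix_inv (A y) *v axis j 1"] nz[OF y] unfolding *
      by (simp add: matrix_vector_mult_basis column_def)
  qed
qed

locale metric_field =
  fixes gm :: "real ^ 'n::finite \<Rightarrow> real ^ 'n ^ 'n" and U :: "(real ^ 'n) set"
  assumes open_U: "open U"
    and smooth_gm: "smooth_on U (\<lambda>z. gm z $ i $ j)"
    and gm_sym: "z \<in> U \<Longrightarrow> gm z $ i $ j = gm z $ j $ i"
    and gm_pos: "z \<in> U \<Longrightarrow> v \<noteq> 0 \<Longrightarrow> 0 < (\<Sum>i\<in>UNIV. \<Sum>j\<in>UNIV. gm z $ i $ j * v $ i * v $ j)"
begin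

abbreviation g :: "'n \<Rightarrow> 'n \<Rightarrow> real ^ 'n \<Rightarrow> real" where "g i j z \<equiv> gm z $ i $ j"

definition g_inv :: "'n \<Rightarrow> 'n \<Rightarrow> real ^ 'n \<Rightarrow> real" where "g_inv i j z = matrix_inv (gm z) $ i $ j"

definition christ :: "'n \<Rightarrow> 'n \<Rightarrow> 'n \<Rightarrow> real ^ 'n \<Rightarrow> real" where
  "christ k i j z = (\<Sum>l\<in>UNIV. 1/2 * g_inv k l z * (partial i (g j l) z + partial j (g i l) z -
      partial l (g i j) z))"

text \<open>Christoffel symbols of the first kind, that is, with the upper index lowered.\<close>

definition christ_low :: "'n \<Rightarrow> 'n \<Rightarrow> 'n \<Rightarrow> real ^ 'n \<Rightarrow> real" where
  "christ_low k i j z = 1/2 * (partial i (g j k) z + partial j (g i k) z - partial k (g i j) z)"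

definition riem :: "'n \<Rightarrow> 'n \<Rightarrow> 'n \<Rightarrow> 'n \<Rightarrow> real ^ 'n \<Rightarrow> real" where
  "riem k h i j z = partial i (christ k j h) z - partial j (christ k i h) z
     + (\<Sum>m\<in>UNIV. christ k i m z * christ m j h z - christ k j m z * christ m i h z)"

lemma g_differentiable: "z \<in> U \<Longrightarrow> g i j differentiable (at z)"
  using smooth_on_differentiable[OF smooth_gm] .

lemma partial_g_differentiable: "z \<in> U \<Longrightarrow> partial k (g i j) differentiable (at z)"
  unfolding partial_def using smooth_on_differentiable[OF smooth_on_frechet_derivative[OF
      smooth_gm]] .

lemma invertible_gm:
  assumes "z \<in> U"
  shows "invertible (gm z)"
proof -
  have "v = 0" if "gm z *v v = 0" for v
  proof (rule ccontr)
    assume "v \<noteq> 0"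
    have "(\<Sum>j\<in>UNIV. gm z $ i $ j * v $ i * v $ j) = v $ i * (gm z *v v) $ i" for i
      by (simp add: matrix_vector_mult_def sum_distrib_left mult_ac)
    then show False using gm_pos[OF assms \<open>v \<noteq> 0\<close>] that by simp
  qed
  then show ?thesis
    unfolding invertible_left_inverse matrix_left_invertible_ker by blast
qed

lemma g_g_inv: "z \<in> U \<Longrightarrow> (\<Sum>m\<in>UNIV. g i m z * g_inv m j z) = (if i = j then 1 else 0)"
  using invertible_matrix_inv(1)[OF invertible_gm]
  by (simp add: g_inv_def matrix_matrix_mult_def mat_def vec_eq_iff)

lemma g_inv_g: "z \<in> U \<Longrightarrow> (\<Sum>m\<in>UNIV. g_inv i m z * g m j z) = (if i = j then 1 else 0)"
  using invertible_matrix_inv(2)[OF invertible_gm]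
  by (simp add: g_inv_def matrix_matrix_mult_def mat_def vec_eq_iff)

lemma g_inv_sym:
  assumes z: "z \<in> U"
  shows "g_inv i j z = g_inv j i z"
proof -
  (* The middle expression is visibly symmetric, unlike the inverse matrix. *)
  have half: "g_inv i j z = (\<Sum>k\<in>UNIV. \<Sum>l\<in>UNIV. g_inv i k z * g k l z * g_inv j l z)" for i j
  proof -
    have "(\<Sum>l\<in>UNIV. g_inv i k z * g k l z * g_inv j l z) = g_inv i k z * (if j = k then 1 else 0)"
        for k
      using g_inv_g[OF z, of j k, symmetric] gm_sym[OF z, of k]
      by (simp add: sum_distrib_left mult_ac)
    then show ?thesis by (simp add: sum_delta_mult)
  qed
  have "g_inv i j z = (\<Sum>l\<in>UNIV. \<Sum>k\<in>UNIV. g_inv i k z * g k l z * g_inv j l z)"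
    unfolding half[of i j] by (rule sum.swap)
  also have "\<dots> = g_inv j i z"
    unfolding half[of j i] using gm_sym[OF z] by (intro sum.cong) (simp_all add: mult_ac)
  finally show ?thesis .
qed

lemma g_inv_differentiable: "z \<in> U \<Longrightarrow> g_inv i j differentiable (at z)"
  unfolding g_inv_def
  by (rule differentiable_matrix_inv[OF open_U]) (auto intro: g_differentiable invertible_gm)

lemma christ_differentiable: "z \<in> U \<Longrightarrow> christ k i j differentiable (at z)"
  unfolding christ_def
  by (intro differentiable_sum differentiable_mult differentiable_add differentiable_diff
      g_inv_differentiable partial_g_differentiable differentiable_const ballI finite; assumption)

lemma partial_g_sym: "z \<in> U \<Longrightarrow> partial k (g i j) z = partial k (g j i) z"
  by (rule partial_cong[OF g_differentiable open_U]) (auto intro: gm_sym)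

lemma christ_sym: "z \<in> U \<Longrightarrow> christ k i j z = christ k j i z"
  by (simp add: christ_def partial_g_sym[of z _ i j] add.commute)

lemma christ_low_sym: "z \<in> U \<Longrightarrow> christ_low k i j z = christ_low k j i z"
  by (simp add: christ_low_def partial_g_sym[of z _ i j] add.commute)

lemma lower_christ:
  assumes z: "z \<in> U"
  shows "(\<Sum>m\<in>UNIV. g k m z * christ m i j z) = christ_low k i j z"
proof -
  have "(\<Sum>m\<in>UNIV. g k m z * christ m i j z)
      = (\<Sum>m\<in>UNIV. \<Sum>l\<in>UNIV. g k m z * g_inv m l z * christ_low l i j z)"
    by (simp add: christ_def christ_low_def sum_distrib_left mult_ac)
  also have "\<dots> = (\<Sum>l\<in>UNIV. (\<Sum>m\<in>UNIV. g k m z * g_inv m l z) * christ_low l i j z)"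
    by (subst sum.swap) (simp add: sum_distrib_right)
  also have "\<dots> = christ_low k i j z" by (simp add: g_g_inv[OF z] sum_delta_mult)
  finally show ?thesis .
qed

lemma metric_compatible: "z \<in> U \<Longrightarrow> partial k (g i j) z = christ_low i k j z + christ_low j k i z"
  by (simp add: christ_low_def partial_g_sym[of z _ j i] partial_g_sym[of z _ j k]
      partial_g_sym[of z _ i k] field_simps)

subsection \<open>Symmetries of the curvature tensor\<close>

text \<open>In the cyclic sum all terms cancel in pairs by symmetry of the Christoffel symbols.\<close>

lemma first_bianchi:
  assumes z: "z \<in> U"
  shows "riem k h i j z + riem k i j h z + riem k j h i z = 0"
proof -
  have p: "partial a (christ k b c) z = partial a (christ k c b) z" for a b c
    by (rule partial_cong[OF christ_differentiable[OF z] open_U z]) (rule christ_sym)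
  show ?thesis
    unfolding riem_def sum_subtractf
    by (simp add: p[of _ h i] p[of _ h j] p[of _ i j] christ_sym[OF z, of _ h i]
        christ_sym[OF z, of _ h j] christ_sym[OF z, of _ i j])
qed

definition riem_low :: "'n \<Rightarrow> 'n \<Rightarrow> 'n \<Rightarrow> 'n \<Rightarrow> real ^ 'n \<Rightarrow> real" where
  "riem_low k h i j z = (\<Sum>m\<in>UNIV. g k m z * riem m h i j z)"

text \<open>Differentiating metric compatibility once more expresses the part of the lowered curvature
  tensor that is symmetric in the first two indices through commutators of second derivatives of
  the metric.\<close>

lemma riem_low_antisym:
  assumes z: "z \<in> U"
  shows "riem_low k l i j z = - riem_low l k i j z"
proof -
  let ?B = "\<lambda>a b c d. \<Sum>m\<in>UNIV. christ_low m a b z * christ m c d z"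
  have B_sym: "?B a b c d = ?B c d a b" for a b c d
  proof -
    have "?B a b c d = (\<Sum>m\<in>UNIV. \<Sum>n\<in>UNIV. g m n z * christ n a b z * christ m c d z)"
      by (simp add: lower_christ[OF z, symmetric] sum_distrib_right)
    also have "\<dots> = (\<Sum>n\<in>UNIV. \<Sum>m\<in>UNIV. g m n z * christ n a b z * christ m c d z)"
      by (rule sum.swap)
    also have "\<dots> = (\<Sum>n\<in>UNIV. \<Sum>m\<in>UNIV. g n m z * christ m c d z * christ n a b z)"
      by (simp add: gm_sym[OF z, of _ n for n] mult_ac)
    also have "\<dots> = ?B c d a b"
      by (simp add: lower_christ[OF z, symmetric] sum_distrib_right)
    finally show ?thesis .
  qed
  have christ_low_diff: "christ_low a b c differentiable (at z)" for a b c
    unfolding christ_low_def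
    by (intro differentiable_mult differentiable_add differentiable_diff
        partial_g_differentiable[OF z] differentiable_const)
  have dlower: "partial i (christ_low k j l) z
      = (\<Sum>m\<in>UNIV. g k m z * partial i (christ m j l) z) + (\<Sum>m\<in>UNIV. partial i (g k m) z * christ m
          j l z)"
    for i j k l
  proof -
    have "partial i (christ_low k j l) z = partial i (\<lambda>y. \<Sum>m\<in>UNIV. g k m y * christ m j l y) z"
      by (rule partial_cong[OF christ_low_diff open_U z]) (simp add: lower_christ)
    then show ?thesis
      by (simp add: partial_sum_mult g_differentiable[OF z] christ_differentiable[OF z] sum.distrib)
  qed
  have ddg: "partial i (partial j (g k l)) z = partial i (christ_low k j l) z + partial i
      (christ_low l j k) z" for i j k l
  proof -
    have "partial i (partial j (g k l)) z = partial i (\<lambda>y. christ_low k j l y + christ_low l j k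
        y) z"
      by (rule partial_cong[OF partial_g_differentiable[OF z] open_U z]) (rule metric_compatible)
    then show ?thesis by (simp add: partial_add christ_low_diff)
  qed
  have comm: "partial i (partial j (g k l)) z = partial j (partial i (g k l)) z"
    unfolding partial_def using symmetric_second_derivative[OF open_U smooth_gm z] .
  let ?P = "\<lambda>k l i j. \<Sum>m\<in>UNIV. g k m z * partial i (christ m j l) z"
  let ?Q = "\<lambda>k l i j. \<Sum>m\<in>UNIV. christ_low k i m z * christ m j l z"
  have P: "?P k l i j + ?Q k l i j = partial i (christ_low k j l) z - ?B i k j l" for i j k l
    unfolding dlower metric_compatible[OF z]
    by (simp add: distrib_right sum.distrib)
  have R: "riem_low k l i j z = ?P k l i j - ?P k l j i + ?Q k l i j - ?Q k l j i" for k l i j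
  proof -
    have "(\<Sum>m\<in>UNIV. g k m z * (\<Sum>n\<in>UNIV. christ m i n z * christ n j l z)) = ?Q k l i j" for i j
    proof -
      have "(\<Sum>m\<in>UNIV. g k m z * (\<Sum>n\<in>UNIV. christ m i n z * christ n j l z))
          = (\<Sum>n\<in>UNIV. \<Sum>m\<in>UNIV. g k m z * christ m i n z * christ n j l z)"
        by (subst sum.swap) (simp add: sum_distrib_left mult_ac)
      then show ?thesis by (simp add: lower_christ[OF z, symmetric] sum_distrib_right)
    qed
    then show ?thesis
      by (simp add: riem_low_def riem_def sum_subtractf sum.distrib algebra_simps)
  qed
  have "riem_low k l i j z + riem_low l k i j z
      = partial i (christ_low k j l) z - ?B i k j l - (partial j (christ_low k i l) z - ?B j k i l)
        + (partial i (christ_low l j k) z - ?B i l j k) - (partial j (christ_low l i k) z - ?B j l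
            i k)"
    unfolding R P[symmetric] by simp
  also have "\<dots> = 0"
    using ddg[of i j k l] ddg[of j i k l] comm B_sym[of i k j l] B_sym[of i l j k] by simp
  finally show ?thesis by simp
qed

lemma riem_antisym: "riem k h i j z = - riem k h j i z"
  by (simp add: riem_def sum_subtractf)

lemma raise_riem_low:
  assumes z: "z \<in> U"
  shows "riem k h i j z = (\<Sum>l\<in>UNIV. g_inv k l z * riem_low l h i j z)"
proof -
  have "(\<Sum>l\<in>UNIV. g_inv k l z * riem_low l h i j z)
      = (\<Sum>m\<in>UNIV. (\<Sum>l\<in>UNIV. g_inv k l z * g l m z) * riem m h i j z)"
    unfolding riem_low_def sum_distrib_left sum_distrib_right
    by (subst sum.swap) (simp add: mult_ac)
  then show ?thesis by (simp add: g_inv_g[OF z] sum_delta_mult)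
qed

end

section \<open>Constant sectional curvature\<close>

text \<open>The diagonal determines a curvature-like tensor: polarise in the first and third argument
  (using the symmetry under exchange of pairs), then in the second and fourth; the three terms of
  the Bianchi identity become equal.\<close>

lemma curvature_like_eq_0:
  fixes f :: "'v::ab_group_add \<Rightarrow> 'v \<Rightarrow> 'v \<Rightarrow> 'v \<Rightarrow> real"
  assumes add1: "\<And>v v' w x y. f (v + v') w x y = f v w x y + f v' w x y"
    and anti12: "\<And>v w x y. f v w x y = - f w v x y"
    and anti34: "\<And>v w x y. f v w x y = - f v w y x"
    and bianchi: "\<And>v w x y. f v w x y + f v x y w + f v y w x = 0"
    and diag: "\<And>v w. f v w v w = 0"
  shows "f v w x y = 0"
proof -
  have pair: "f v w x y = f x y v w" for v w x y
    using bianchi[of v w x y] bianchi[of w x y v] bianchi[of x y v w] bianchi[of y v w x]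
      anti12[of v x] anti12[of w y] anti12[of y v w x] anti12[of w v x y] anti12[of w x y v]
      anti12[of y x v w] anti34[of v w x y] anti34[of v x y w] anti34[of v y w x]
      anti34[of w x y v] anti34[of x w y v] anti34[of w y v x] anti34[of y w x v]
      anti34[of x y v w] anti34[of x v w y] anti12[of x v w y] anti12[of y w x v]
      anti34[of v x w y] anti34[of y v w x] anti34[of v y x w] anti34[of x w v y]
      anti12[of x w y v] anti34[of w x v y]
    by linarith
  have add3: "f v w (x + x') y = f v w x y + f v w x' y" for v w x x' y
    using pair[of v w "x + x'" y] pair[of v w x y] pair[of v w x' y] add1[of x x' y v w] by simp
  have add2: "f v (w + w') x y = f v w x y + f v w' x y" for v w w' x y
    using anti12[of v "w + w'" x y] anti12[of v w x y] anti12[of v w' x y] add1[of w w' v x y]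
    by simp
  have add4: "f v w x (y + y') = f v w x y + f v w x y'" for v w x y y'
    using anti34[of v w x "y + y'"] anti34[of v w x y] anti34[of v w x y'] add3[of v w y y' x]
    by simp
  have 1: "f v w x w = 0" for v w x
    using diag[of "v + x" w] diag[of v w] diag[of x w] pair[of v w x w] by (simp add: add1 add3)
  have 2: "f v w x y = - f v y x w" for v w x y
    using 1[of v "w + y" x] 1[of v w x] 1[of v y x] by (simp add: add2 add4)
  show ?thesis
    using bianchi[of v w x y] 2[of v w x y] 2[of v x y w] 2[of v y w x]
      anti34[of v w x y] anti34[of v x y w] anti34[of v y w x] by linarith
qed

definition form4 :: "('n \<Rightarrow> 'n \<Rightarrow> 'n \<Rightarrow> 'n \<Rightarrow> real) \<Rightarrow>
    real ^ 'n::finite \<Rightarrow> real ^ 'n \<Rightarrow> real ^ 'n \<Rightarrow> real ^ 'n \<Rightarrow> real" where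
  "form4 S v w x y = (\<Sum>l\<in>UNIV. \<Sum>h\<in>UNIV. \<Sum>i\<in>UNIV. \<Sum>j\<in>UNIV. S l h i j * v $ l * w $ h * x $ i * y $
      j)"

lemma form4_axis:
  "form4 S (axis l 1) (axis h 1) (axis i 1) (axis j 1) = S l h i j"
proof -
  have s: "(\<Sum>m\<in>UNIV. f m * axis k 1 $ m) = f k" for f :: "'a \<Rightarrow> real" and k
    by (simp add: axis_def sum_delta_mult)
  have "form4 S (axis l 1) (axis h 1) (axis i 1) (axis j 1)
     = (\<Sum>l'\<in>UNIV. (\<Sum>h'\<in>UNIV. (\<Sum>i'\<in>UNIV. (\<Sum>j'\<in>UNIV. S l' h' i' j' * axis j 1 $ j') * axis i 1 $ i')
          * axis h 1 $ h') * axis l 1 $ l')"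
    unfolding form4_def sum_distrib_right by (intro sum.cong refl) (simp add: mult_ac)
  then show ?thesis by (simp add: s)
qed

lemma sum_rotate:
  fixes a :: "'n::finite \<Rightarrow> 'n \<Rightarrow> 'n \<Rightarrow> real"
  shows "(\<Sum>h\<in>UNIV. \<Sum>i\<in>UNIV. \<Sum>j\<in>UNIV. a h i j) = (\<Sum>h\<in>UNIV. \<Sum>i\<in>UNIV. \<Sum>j\<in>UNIV. a i j h)"
proof -
  have "(\<Sum>h\<in>UNIV. \<Sum>i\<in>UNIV. \<Sum>j\<in>UNIV. a h i j) = (\<Sum>h\<in>UNIV. \<Sum>j\<in>UNIV. \<Sum>i\<in>UNIV. a h i j)"
    by (intro sum.cong refl sum.swap)
  also have "\<dots> = (\<Sum>j\<in>UNIV. \<Sum>h\<in>UNIV. \<Sum>i\<in>UNIV. a h i j)"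
    by (rule sum.swap)
  finally show ?thesis .
qed

lemma form4_eq_0:
  assumes anti12: "\<And>l h i j. S l h i j = - S h l i j"
    and anti34: "\<And>l h i j. S l h i j = - S l h j i"
    and bianchi: "\<And>l h i j. S l h i j + S l i j h + S l j h i = 0"
    and diag: "\<And>v w. form4 S v w v w = 0"
  shows "S l h i j = 0"
proof -
  have "form4 S v w x y = 0" for v w x y
  proof (rule curvature_like_eq_0[where f = "form4 S"])
    show "form4 S (v + v') w x y = form4 S v w x y + form4 S v' w x y" for v v' w x y
      by (simp add: form4_def algebra_simps sum.distrib)
    show "form4 S v w x y = - form4 S w v x y" for v w x y
    proof -
      have "form4 S w v x y = (\<Sum>h\<in>UNIV. \<Sum>l\<in>UNIV. \<Sum>i\<in>UNIV. \<Sum>j\<in>UNIV.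
          S l h i j * w $ l * v $ h * x $ i * y $ j)"
        unfolding form4_def by (rule sum.swap)
      also have "\<dots> = - form4 S v w x y"
        unfolding form4_def sum_negf[symmetric]
        by (intro sum.cong refl) (subst anti12, simp add: mult_ac)
      finally show ?thesis by simp
    qed
    show "form4 S v w x y = - form4 S v w y x" for v w x y
    proof -
      have "form4 S v w y x = (\<Sum>l\<in>UNIV. \<Sum>h\<in>UNIV. \<Sum>j\<in>UNIV. \<Sum>i\<in>UNIV.
          S l h i j * v $ l * w $ h * y $ i * x $ j)"
        unfolding form4_def by (intro sum.cong refl sum.swap)
      also have "\<dots> = - form4 S v w x y"
        unfolding form4_def sum_negf[symmetric]
        by (intro sum.cong refl) (subst anti34, simp add: mult_ac)
      finally show ?thesis by simp
    qed
    show "form4 S v w x y + form4 S v x y w + form4 S v y w x = 0" for v w x y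
    proof -
      have 1: "form4 S v x y w = (\<Sum>l\<in>UNIV. \<Sum>h\<in>UNIV. \<Sum>i\<in>UNIV. \<Sum>j\<in>UNIV.
          S l i j h * v $ l * x $ i * y $ j * w $ h)"
        unfolding form4_def by (intro sum.cong refl sum_rotate)
      have 2: "form4 S v y w x = (\<Sum>l\<in>UNIV. \<Sum>h\<in>UNIV. \<Sum>i\<in>UNIV. \<Sum>j\<in>UNIV.
          S l j h i * v $ l * y $ j * w $ h * x $ i)"
        unfolding form4_def
        by (rule sum.cong[OF refl], rule trans[OF sum_rotate sum_rotate])
      have "form4 S v w x y + form4 S v x y w + form4 S v y w x
          = (\<Sum>l\<in>UNIV. \<Sum>h\<in>UNIV. \<Sum>i\<in>UNIV. \<Sum>j\<in>UNIV.
            (S l h i j + S l i j h + S l j h i) * (v $ l * w $ h * x $ i * y $ j))"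
        unfolding 1 2 unfolding form4_def sum.distrib[symmetric]
        by (intro sum.cong refl) (simp add: algebra_simps)
      then show ?thesis by (simp add: bianchi)
    qed
    show "form4 S v w v w = 0" for v w by (rule diag)
  qed
  from this[of "axis l 1" "axis h 1" "axis i 1" "axis j 1"] show ?thesis by (simp add: form4_axis)
qed

context metric_field
begin

definition inner_g :: "real ^ 'n \<Rightarrow> real ^ 'n \<Rightarrow> real ^ 'n \<Rightarrow> real" where
  "inner_g z v w = (\<Sum>i\<in>UNIV. \<Sum>j\<in>UNIV. g i j z * v $ i * w $ j)"

definition constant_curvature_form :: "real \<Rightarrow> real ^ 'n \<Rightarrow> bool" where
  "constant_curvature_form \<kappa> z \<longleftrightarrow> (\<forall>k h i j. riem k h i j z =
     \<kappa> * ((if k = i then g j h z else 0) - (if k = j then g i h z else 0)))"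

lemma constant_curvature_form_lowered:
  assumes z: "z \<in> U"
  shows "constant_curvature_form \<kappa> z \<longleftrightarrow>
    (\<forall>k h i j. riem_low k h i j z = \<kappa> * (g k i z * g j h z - g k j z * g i h z))"
proof
  assume *: "constant_curvature_form \<kappa> z"
  show "\<forall>k h i j. riem_low k h i j z = \<kappa> * (g k i z * g j h z - g k j z * g i h z)"
  proof (intro allI)
    fix k h i j
    show "riem_low k h i j z = \<kappa> * (g k i z * g j h z - g k j z * g i h z)"
      using * unfolding riem_low_def constant_curvature_form_def
      by (simp add: right_diff_distrib sum_subtractf if_distrib[of "\<lambda>x. _ * x"] mult_ac
          cong: if_cong)
  qed
next
  assume *: "\<forall>k h i j. riem_low k h i j z = \<kappa> * (g k i z * g j h z - g k j z * g i h z)"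
  show "constant_curvature_form \<kappa> z"
    unfolding constant_curvature_form_def
  proof (intro allI)
    fix k h i j
    have "riem k h i j z = \<kappa> * ((\<Sum>l\<in>UNIV. g_inv k l z * g l i z) * g j h z
        - (\<Sum>l\<in>UNIV. g_inv k l z * g l j z) * g i h z)"
      unfolding raise_riem_low[OF z]
      by (simp add: * sum_distrib_left sum_distrib_right sum_subtractf[symmetric] algebra_simps)
    then show "riem k h i j z = \<kappa> * ((if k = i then g j h z else 0) - (if k = j then g i h z else
        0))"
      by (simp add: g_inv_g[OF z])
  qed
qed

lemma form4_constant_curvature:
  "form4 (\<lambda>k h i j. g k i z * g j h z - g k j z * g i h z) v w x y
     = inner_g z v x * inner_g z y w - inner_g z v y * inner_g z x w"
proof -
  have a: "inner_g z v x * inner_g z y w = (\<Sum>l\<in>UNIV. \<Sum>h\<in>UNIV. \<Sum>i\<in>UNIV. \<Sum>j\<in>UNIV.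
      (g l i z * v $ l * x $ i) * (g j h z * y $ j * w $ h))" for v w x y
  proof -
    have "inner_g z v x * inner_g z y w = (\<Sum>l\<in>UNIV. \<Sum>i\<in>UNIV. \<Sum>j\<in>UNIV. \<Sum>h\<in>UNIV.
      (g l i z * v $ l * x $ i) * (g j h z * y $ j * w $ h))"
      unfolding inner_g_def sum_distrib_right unfolding sum_distrib_left ..
    also have "\<dots> = (\<Sum>l\<in>UNIV. \<Sum>h\<in>UNIV. \<Sum>i\<in>UNIV. \<Sum>j\<in>UNIV.
      (g l i z * v $ l * x $ i) * (g j h z * y $ j * w $ h))"
      by (rule sum.cong[OF refl], rule sum_rotate)
    finally show ?thesis .
  qed
  have b: "inner_g z v y * inner_g z x w = (\<Sum>l\<in>UNIV. \<Sum>h\<in>UNIV. \<Sum>i\<in>UNIV. \<Sum>j\<in>UNIV.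
      (g l j z * v $ l * y $ j) * (g i h z * x $ i * w $ h))"
  proof -
    have "inner_g z v y * inner_g z x w = (\<Sum>l\<in>UNIV. \<Sum>h\<in>UNIV. \<Sum>j\<in>UNIV. \<Sum>i\<in>UNIV.
      (g l j z * v $ l * y $ j) * (g i h z * x $ i * w $ h))"
      by (rule a)
    also have "\<dots> = (\<Sum>l\<in>UNIV. \<Sum>h\<in>UNIV. \<Sum>i\<in>UNIV. \<Sum>j\<in>UNIV.
      (g l j z * v $ l * y $ j) * (g i h z * x $ i * w $ h))"
      by (intro sum.cong refl sum.swap)
    finally show ?thesis .
  qed
  show ?thesis
    unfolding a[of v x y w] b form4_def sum_subtractf[symmetric]
    by (intro sum.cong refl) (simp add: algebra_simps)
qed

text \<open>The difference of the curvature tensor and its constant-curvature model has all algebraic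
  symmetries of a curvature tensor, so it is zero once its diagonal is.\<close>

lemma constant_curvature_form_iff:
  assumes z: "z \<in> U"
  shows "constant_curvature_form \<kappa> z \<longleftrightarrow>
    (\<forall>v w. form4 (\<lambda>k h i j. riem_low k h i j z) v w v w
       = \<kappa> * (inner_g z v v * inner_g z w w - (inner_g z v w)\<^sup>2))"
proof -
  let ?C = "\<lambda>k h i j. g k i z * g j h z - g k j z * g i h z"
  let ?S = "\<lambda>k h i j. riem_low k h i j z - \<kappa> * ?C k h i j"
  have lin: "form4 ?S v w x y = form4 (\<lambda>k h i j. riem_low k h i j z) v w x y - \<kappa> * form4 ?C v w x y"
    for v w x y
    unfolding form4_def sum_distrib_left sum_subtractf[symmetric]
    by (intro sum.cong refl) (simp add: algebra_simps)
  have diag: "form4 ?S v w v w = form4 (\<lambda>k h i j. riem_low k h i j z) v w v w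
      - \<kappa> * (inner_g z v v * inner_g z w w - (inner_g z v w)\<^sup>2)" for v w
    unfolding lin form4_constant_curvature by (simp add: power2_eq_square)
  show ?thesis unfolding constant_curvature_form_lowered[OF z]
  proof
    assume *: "\<forall>k h i j. riem_low k h i j z = \<kappa> * ?C k h i j"
    have "form4 ?S v w v w = 0" for v w using * by (simp add: form4_def)
    then show "\<forall>v w. form4 (\<lambda>k h i j. riem_low k h i j z) v w v w
       = \<kappa> * (inner_g z v v * inner_g z w w - (inner_g z v w)\<^sup>2)"
      unfolding diag by simp
  next
    assume *: "\<forall>v w. form4 (\<lambda>k h i j. riem_low k h i j z) v w v w
       = \<kappa> * (inner_g z v v * inner_g z w w - (inner_g z v w)\<^sup>2)"
    have "?S k h i j = 0" for k h i j
    proof (rule form4_eq_0[where S = ?S])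
      show "?S l h i j = - ?S h l i j" for l h i j
        using riem_low_antisym[OF z, of l h i j] gm_sym[OF z] by (simp add: algebra_simps)
      show "?S l h i j = - ?S l h j i" for l h i j
        using riem_antisym[of _ h i j z] by (simp add: riem_low_def sum_negf algebra_simps)
      show "?S l h i j + ?S l i j h + ?S l j h i = 0" for l h i j
      proof -
        have "riem_low l h i j z + riem_low l i j h z + riem_low l j h i z = 0"
          using first_bianchi[OF z, of _ h i j]
          by (simp add: riem_low_def sum.distrib[symmetric] distrib_left[symmetric])
        moreover have "?C l h i j + ?C l i j h + ?C l j h i = 0"
          using gm_sym[OF z] by (simp add: algebra_simps)
        ultimately show ?thesis by (simp add: algebra_simps) (simp add: distrib_left[symmetric])
      qed
      show "form4 ?S v w v w = 0" for v w using * unfolding diag by simp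
    qed
    then show "\<forall>k h i j. riem_low k h i j z = \<kappa> * ?C k h i j" by simp
  qed
qed

abbreviation gram :: "real ^ 'n \<Rightarrow> real ^ 'n \<Rightarrow> real ^ 'n \<Rightarrow> real" where
  "gram z v w \<equiv> inner_g z v v * inner_g z w w - (inner_g z v w)\<^sup>2"

lemma inner_g_sym:
  assumes z: "z \<in> U"
  shows "inner_g z v w = inner_g z w v"
  unfolding inner_g_def by (subst sum.swap) (simp add: gm_sym[OF z] mult_ac)

lemma inner_g_diff_scale:
  "inner_g z (a *\<^sub>R v - b *\<^sub>R w) u = a * inner_g z v u - b * inner_g z w u"
  by (simp add: inner_g_def sum_distrib_left sum_subtractf[symmetric] algebra_simps)

lemma inner_g_pos: "z \<in> U \<Longrightarrow> v \<noteq> 0 \<Longrightarrow> 0 < inner_g z v v"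
  unfolding inner_g_def by (rule gm_pos)

text \<open>The equality case of the Cauchy--Schwarz inequality: the difference of the two sides has
  squared length \<open>\<langle>w, w\<rangle>\<close> times the Gram determinant.\<close>

lemma gram_eq_0_imp:
  assumes z: "z \<in> U" and 0: "gram z v w = 0"
  shows "inner_g z w w *\<^sub>R v = inner_g z v w *\<^sub>R w"
proof (rule ccontr)
  let ?u = "inner_g z w w *\<^sub>R v - inner_g z v w *\<^sub>R w"
  assume "inner_g z w w *\<^sub>R v \<noteq> inner_g z v w *\<^sub>R w"
  then have "0 < inner_g z ?u ?u" by (intro inner_g_pos z) simp
  moreover have "inner_g z ?u ?u = inner_g z w w * gram z v w"
    unfolding inner_g_diff_scale inner_g_sym[OF z, of _ ?u]
    by (simp add: inner_g_sym[OF z, of w v] algebra_simps power2_eq_square)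
  ultimately show False by (simp add: 0)
qed

lemma gram_proportional:
  shows "gram z (k *\<^sub>R w) w = 0"
proof -
  have "inner_g z (k *\<^sub>R w) u = k * inner_g z w u" "inner_g z u (k *\<^sub>R w) = k * inner_g z u w" for u
    by (simp_all add: inner_g_def sum_distrib_left mult_ac)
  then show ?thesis by (simp add: power2_eq_square)
qed

text \<open>The curvature form vanishes on dependent pairs, on which the sectional curvature is
  undefined.\<close>

lemma riem_low_form_proportional:
  assumes z: "z \<in> U"
  shows "form4 (\<lambda>k h i j. riem_low k h i j z) (k *\<^sub>R w) w (k *\<^sub>R w) w = 0"
proof -
  let ?f = "form4 (\<lambda>k h i j. riem_low k h i j z)"
  have "?f w w w w = (\<Sum>h\<in>UNIV. \<Sum>l\<in>UNIV. \<Sum>i\<in>UNIV. \<Sum>j\<in>UNIV.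
      riem_low l h i j z * w $ l * w $ h * w $ i * w $ j)"
    unfolding form4_def by (rule sum.swap)
  also have "\<dots> = - ?f w w w w"
    unfolding form4_def sum_negf[symmetric]
    by (intro sum.cong refl) (subst riem_low_antisym[OF z], simp add: mult_ac)
  finally have "?f w w w w = 0" by simp
  moreover have "?f (k *\<^sub>R w) w (k *\<^sub>R w) w = k\<^sup>2 * ?f w w w w"
    by (simp add: form4_def sum_distrib_left power2_eq_square mult_ac)
  ultimately show ?thesis by simp
qed

end

section \<open>The almost complex structure in coordinates\<close>

lemma vec_lambda_eq_sum_axis: "(\<chi> j. f j) = (\<Sum>j\<in>UNIV. f j *\<^sub>R axis j (1::real))"
  by (simp add: vec_eq_iff axis_def if_distrib[of "\<lambda>x. _ * x"] cong: if_cong)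

lemma has_derivative_vec_lambda:
  fixes f :: "'n::finite \<Rightarrow> 'a::real_normed_vector \<Rightarrow> real"
  assumes "\<And>j. (f j has_derivative f' j) (at w)"
  shows "((\<lambda>w. \<chi> j. f j w) has_derivative (\<lambda>v. \<chi> j. f' j v)) (at w)"
  unfolding vec_lambda_eq_sum_axis
  by (intro has_derivative_sum has_derivative_scaleR_left assms)

text \<open>The functions \<open>al\<close> and \<open>be\<close> are the coefficients of \<open>g\<^sub>i\<^sub>j\<close> and \<open>p\<^sub>i p\<^sub>j\<close> in \<open>J\<close>, as
  functions of the energy density; \<open>dal\<close> and \<open>dbe\<close> are their derivatives.\<close>

locale diagonal_coefficients = metric_field gm U
  for gm :: "real ^ 'n::finite \<Rightarrow> real ^ 'n ^ 'n" and U +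
  fixes al be dal dbe :: "real \<Rightarrow> real"
  assumes al_deriv: "t > 0 \<Longrightarrow> (al has_real_derivative dal t) (at t)"
    and be_deriv: "t > 0 \<Longrightarrow> (be has_real_derivative dbe t) (at t)"
    and al_nonzero: "t > 0 \<Longrightarrow> al t \<noteq> 0"
    and al_be_nonzero: "t > 0 \<Longrightarrow> al t + 2 * t * be t \<noteq> 0"
begin

definition Z :: "((real ^ 'n) \<times> (real ^ 'n)) set" where "Z = U \<times> {p. p \<noteq> 0}"

text \<open>In the coordinates \<open>w = (x, p)\<close>: \<open>p_sharp\<close> are the components of the vector dual to the
  covector \<open>p\<close>, \<open>energy\<close> is the energy density, \<open>hor\<close> and \<open>ver\<close> are the adapted frame and its
  image under \<open>J\<close>, and \<open>H_mat\<close> is the inverse of the matrix \<open>G_mat\<close> that describes \<open>J\<close> on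
  horizontal vectors.\<close>

definition p_sharp :: "'n \<Rightarrow> (real ^ 'n) \<times> (real ^ 'n) \<Rightarrow> real" where
  "p_sharp i w = (\<Sum>h\<in>UNIV. snd w $ h * g_inv h i (fst w))"

definition energy :: "(real ^ 'n) \<times> (real ^ 'n) \<Rightarrow> real" where
  "energy w = 1/2 * (\<Sum>i\<in>UNIV. \<Sum>j\<in>UNIV. g_inv i j (fst w) * snd w $ i * snd w $ j)"

definition christ0 :: "'n \<Rightarrow> 'n \<Rightarrow> (real ^ 'n) \<times> (real ^ 'n) \<Rightarrow> real" where
  "christ0 i h w = (\<Sum>k\<in>UNIV. snd w $ k * christ k i h (fst w))"

definition G_mat :: "'n \<Rightarrow> 'n \<Rightarrow> (real ^ 'n) \<times> (real ^ 'n) \<Rightarrow> real" where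
  "G_mat i j w = al (energy w) * g i j (fst w) + be (energy w) * snd w $ i * snd w $ j"

definition H_mat :: "'n \<Rightarrow> 'n \<Rightarrow> (real ^ 'n) \<times> (real ^ 'n) \<Rightarrow> real" where
  "H_mat i j w = 1 / al (energy w) * g_inv i j (fst w)
     - be (energy w) / (al (energy w) * (al (energy w) + 2 * energy w * be (energy w))) * p_sharp
         i w * p_sharp j w"

definition hor :: "'n \<Rightarrow> (real ^ 'n) \<times> (real ^ 'n) \<Rightarrow> (real ^ 'n) \<times> (real ^ 'n)" where
  "hor i w = (axis i 1, \<chi> h. christ0 i h w)"

definition ver :: "'n \<Rightarrow> (real ^ 'n) \<times> (real ^ 'n) \<Rightarrow> (real ^ 'n) \<times> (real ^ 'n)" where
  "ver i w = (0, \<chi> j. G_mat i j w)"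

text \<open>The factor of \<open>p\<^sub>i g\<^sub>j\<^sub>l - p\<^sub>j g\<^sub>i\<^sub>l\<close> in the Nijenhuis tensor of two horizontal fields, as a
  function of the energy density.\<close>

definition balance :: "real \<Rightarrow> real" where
  "balance t = (al t + 2 * t * be t) * dal t - al t * be t"

lemma open_Z: "open Z"
  unfolding Z_def by (intro open_Times open_U open_Collect_neq continuous_intros)

lemma Z_D: "w \<in> Z \<Longrightarrow> fst w \<in> U" "w \<in> Z \<Longrightarrow> snd w \<noteq> 0"
  by (auto simp: Z_def)

lemma lower_p_sharp:
  assumes w: "fst w \<in> U"
  shows "(\<Sum>j\<in>UNIV. g i j (fst w) * p_sharp j w) = snd w $ i"
proof -
  have "(\<Sum>j\<in>UNIV. g i j (fst w) * p_sharp j w)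
      = (\<Sum>h\<in>UNIV. (\<Sum>j\<in>UNIV. g i j (fst w) * g_inv j h (fst w)) * snd w $ h)"
    unfolding p_sharp_def sum_distrib_left sum_distrib_right
    by (subst sum.swap) (simp add: g_inv_sym[OF w] mult_ac)
  then show ?thesis by (simp add: g_g_inv[OF w] sum_delta_mult)
qed

lemma energy_p_sharp: "energy w = 1/2 * (\<Sum>j\<in>UNIV. snd w $ j * p_sharp j w)"
proof -
  have "(\<Sum>i\<in>UNIV. \<Sum>j\<in>UNIV. g_inv i j (fst w) * snd w $ i * snd w $ j)
      = (\<Sum>j\<in>UNIV. \<Sum>i\<in>UNIV. g_inv i j (fst w) * snd w $ i * snd w $ j)"
    by (rule sum.swap)
  then show ?thesis by (simp add: energy_def p_sharp_def sum_distrib_left mult_ac)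
qed

lemma sum_p_p_sharp: "(\<Sum>j\<in>UNIV. snd w $ j * p_sharp j w) = 2 * energy w"
  by (simp add: energy_p_sharp)

lemma energy_pos:
  assumes w: "w \<in> Z"
  shows "energy w > 0"
proof -
  define y where "y = (\<chi> j. p_sharp j w)"
  note x = Z_D(1)[OF w]
  have "y \<noteq> 0"
  proof
    assume "y = 0"
    then have "p_sharp j w = 0" for j by (simp add: y_def vec_eq_iff)
    then have "snd w $ i = 0" for i using lower_p_sharp[OF x, of i] by simp
    then show False using Z_D(2)[OF w] by (simp add: vec_eq_iff)
  qed
  have "(\<Sum>i\<in>UNIV. \<Sum>j\<in>UNIV. g i j (fst w) * y $ i * y $ j)
      = (\<Sum>i\<in>UNIV. (\<Sum>j\<in>UNIV. g i j (fst w) * p_sharp j w) * p_sharp i w)"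
    unfolding sum_distrib_right y_def by (intro sum.cong refl) simp
  also have "\<dots> = 2 * energy w" unfolding lower_p_sharp[OF x] by (rule sum_p_p_sharp)
  finally show ?thesis using gm_pos[OF x \<open>y \<noteq> 0\<close>] by simp
qed

lemma energy_scale: "energy (x, s *\<^sub>R p) = s\<^sup>2 * energy (x, p)"
  by (simp add: energy_def sum_distrib_left power2_eq_square mult_ac)

lemma G_mat_sym: "w \<in> Z \<Longrightarrow> G_mat i j w = G_mat j i w"
  using gm_sym[OF Z_D(1)] by (simp add: G_mat_def)

lemma H_mat_sym: "w \<in> Z \<Longrightarrow> H_mat i j w = H_mat j i w"
  using g_inv_sym[OF Z_D(1)] by (simp add: H_mat_def)

text \<open>The inverse of a rank-one perturbation of a multiple of the metric (Sherman--Morrison).\<close>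

lemma G_mat_H_mat:
  assumes w: "w \<in> Z"
  shows "(\<Sum>j\<in>UNIV. G_mat i j w * H_mat j k w) = (if i = k then 1 else 0)"
proof -
  note x = Z_D(1)[OF w] and t = energy_pos[OF w]
  let ?p = "\<lambda>i. snd w $ i"
  define a b c where "a = al (energy w)" and "b = be (energy w)" and "c = b / (a * (a + 2 * energy
      w * b))"
  have a: "a \<noteq> 0" "a + 2 * energy w * b \<noteq> 0"
    using al_nonzero[OF t] al_be_nonzero[OF t] by (auto simp: a_def b_def)
  have G_mat: "G_mat i j w = a * g i j (fst w) + b * ?p i * ?p j" for j
    by (simp add: G_mat_def a_def b_def)
  have H_mat: "H_mat j k w = 1 / a * g_inv j k (fst w) - c * p_sharp j w * p_sharp k w" for j
    by (simp add: H_mat_def a_def b_def c_def)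
  have "(\<Sum>j\<in>UNIV. G_mat i j w * H_mat j k w)
      = (\<Sum>j\<in>UNIV. g i j (fst w) * g_inv j k (fst w)) - a * c * p_sharp k w * (\<Sum>j\<in>UNIV. g i j (fst
          w) * p_sharp j w)
        + b / a * ?p i * (\<Sum>j\<in>UNIV. ?p j * g_inv j k (fst w)) - b * c * ?p i * p_sharp k w *
            (\<Sum>j\<in>UNIV. ?p j * p_sharp j w)"
    unfolding G_mat H_mat
      sum_distrib_left sum_distrib_right sum_subtractf[symmetric] sum.distrib[symmetric]
    by (intro sum.cong refl) (use a(1) in \<open>simp add: algebra_simps\<close>)
  also have "\<dots> = (if i = k then 1 else 0) + ?p i * p_sharp k w * (b / a - c * (a + 2 * energy w *
      b))"
    unfolding g_g_inv[OF x] lower_p_sharp[OF x] sum_p_p_sharp p_sharp_def[symmetric]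
    by (simp add: algebra_simps)
  also have "b / a - c * (a + 2 * energy w * b) = 0"
    using a by (simp add: c_def)
  finally show ?thesis by simp
qed

lemma has_derivative_fst_compose:
  assumes "f differentiable (at (fst w))"
  shows "((\<lambda>w. f (fst w)) has_derivative (\<lambda>v. frechet_derivative f (at (fst w)) (fst v)))
    (at (w :: (real ^ 'n) \<times> (real ^ 'n)))"
  by (rule has_derivative_compose[OF has_derivative_fst[OF has_derivative_ident]
        assms[unfolded frechet_derivative_works]])

lemma has_derivative_snd_nth:
  "((\<lambda>w. snd w $ i) has_derivative (\<lambda>v. snd v $ i)) (at (w :: (real ^ 'n) \<times> (real ^ 'n)))"
  by (rule bounded_linear.has_derivative[OF bounded_linear_vec_nth
        has_derivative_snd[OF has_derivative_ident]])

lemma p_sharp_differentiable: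
  assumes w: "w \<in> Z"
  shows "p_sharp i differentiable (at w)"
proof -
  have "(\<lambda>w. g_inv h i (fst w)) differentiable (at w)" for h
    using has_derivative_fst_compose[OF g_inv_differentiable[OF Z_D(1)[OF w]]]
    unfolding differentiable_def by blast
  moreover have "(\<lambda>w. snd w $ h) differentiable (at w)" for h
    using has_derivative_snd_nth unfolding differentiable_def by blast
  ultimately show ?thesis
    unfolding p_sharp_def by (intro differentiable_sum differentiable_mult ballI finite)
qed

definition d_energy :: "(real ^ 'n) \<times> (real ^ 'n) \<Rightarrow> (real ^ 'n) \<times> (real ^ 'n) \<Rightarrow> real" where
  "d_energy w v = (\<Sum>j\<in>UNIV. p_sharp j w * snd v $ j)
     - 1/2 * (\<Sum>i\<in>UNIV. \<Sum>j\<in>UNIV. p_sharp i w * p_sharp j w * frechet_derivative (g i j) (at (fst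
         w)) (fst v))"

text \<open>Differentiating \<open>g\<^sub>i\<^sub>j y\<^sup>j = p\<^sub>i\<close> avoids the derivative of the inverse matrix.\<close>

lemma energy_has_derivative:
  assumes w: "w \<in> Z"
  shows "(energy has_derivative d_energy w) (at w)"
proof -
  note x = Z_D(1)[OF w]
  define y' where "y' i = frechet_derivative (p_sharp i) (at w)" for i
  define dg where "dg i j v = frechet_derivative (g i j) (at (fst w)) (fst v)" for i j and v ::
      "(real ^ 'n) \<times> (real ^ 'n)"
  have y': "(p_sharp i has_derivative y' i) (at w)" for i
    using p_sharp_differentiable[OF w] unfolding y'_def frechet_derivative_works .
  have g': "((\<lambda>w. g i j (fst w)) has_derivative dg i j) (at w)" for i j
    using has_derivative_fst_compose[OF g_differentiable[OF x]] unfolding dg_def .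
  have lower: "(\<Sum>j\<in>UNIV. g i j (fst w) * y' j v + dg i j v * p_sharp j w) = snd v $ i" for i v
  proof -
    have 1: "((\<lambda>w. \<Sum>j\<in>UNIV. g i j (fst w) * p_sharp j w) has_derivative
        (\<lambda>v. \<Sum>j\<in>UNIV. g i j (fst w) * y' j v + dg i j v * p_sharp j w)) (at w)"
      by (intro has_derivative_sum has_derivative_mult g' y')
    have 2: "((\<lambda>w. \<Sum>j\<in>UNIV. g i j (fst w) * p_sharp j w) has_derivative (\<lambda>v. snd v $ i)) (at w)"
      by (rule has_derivative_transform_within_open[OF has_derivative_snd_nth open_Z w])
         (simp add: lower_p_sharp[OF Z_D(1)])
    show ?thesis using fun_cong[OF has_derivative_unique[OF 1 2], of v] .
  qed
  have "(energy has_derivative (\<lambda>v. 1/2 * (\<Sum>j\<in>UNIV. snd w $ j * y' j v + snd v $ j * p_sharp j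
      w))) (at w)"
    unfolding energy_p_sharp
    by (intro has_derivative_mult_right has_derivative_sum has_derivative_mult
        has_derivative_snd_nth y')
  moreover have "1/2 * (\<Sum>j\<in>UNIV. snd w $ j * y' j v + snd v $ j * p_sharp j w) = d_energy w v" for v
  proof -
    have "(\<Sum>i\<in>UNIV. p_sharp i w * snd v $ i)
        = (\<Sum>i\<in>UNIV. \<Sum>j\<in>UNIV. p_sharp i w * g i j (fst w) * y' j v)
          + (\<Sum>i\<in>UNIV. \<Sum>j\<in>UNIV. p_sharp i w * p_sharp j w * dg i j v)"
      unfolding lower[symmetric] sum_distrib_left sum.distrib[symmetric]
      by (intro sum.cong refl) (simp add: algebra_simps)
    also have "(\<Sum>i\<in>UNIV. \<Sum>j\<in>UNIV. p_sharp i w * g i j (fst w) * y' j v)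
        = (\<Sum>j\<in>UNIV. (\<Sum>i\<in>UNIV. g j i (fst w) * p_sharp i w) * y' j v)"
      unfolding sum_distrib_right by (subst sum.swap) (simp add: gm_sym[OF x] mult_ac)
    finally have "(\<Sum>j\<in>UNIV. snd w $ j * y' j v) = (\<Sum>i\<in>UNIV. p_sharp i w * snd v $ i)
        - (\<Sum>i\<in>UNIV. \<Sum>j\<in>UNIV. p_sharp i w * p_sharp j w * dg i j v)"
      unfolding lower_p_sharp[OF x] by simp
    then show ?thesis by (simp add: d_energy_def dg_def sum.distrib mult_ac)
  qed
  ultimately show ?thesis by simp
qed

text \<open>The horizontal distribution is tangent to the level sets of the energy density: this is
  metric compatibility of the connection.\<close>

lemma d_energy_hor:
  assumes w: "w \<in> Z"
  shows "d_energy w (hor k w) = 0"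
proof -
  note x = Z_D(1)[OF w]
  have c: "christ0 k j w = (\<Sum>l\<in>UNIV. p_sharp l w * christ_low l k j (fst w))" for j
  proof -
    have "christ0 k j w = (\<Sum>m\<in>UNIV. \<Sum>l\<in>UNIV. g l m (fst w) * p_sharp l w * christ m k j (fst w))"
      unfolding christ0_def lower_p_sharp[OF x, symmetric] sum_distrib_right
      by (intro sum.cong refl) (simp add: gm_sym[OF x])
    also have "\<dots> = (\<Sum>l\<in>UNIV. \<Sum>m\<in>UNIV. g l m (fst w) * p_sharp l w * christ m k j (fst w))"
      by (rule sum.swap)
    finally show ?thesis
      by (simp add: lower_christ[OF x, symmetric] sum_distrib_left mult_ac)
  qed
  have 1: "(\<Sum>j\<in>UNIV. p_sharp j w * christ0 k j w)
      = (\<Sum>j\<in>UNIV. \<Sum>l\<in>UNIV. p_sharp j w * p_sharp l w * christ_low l k j (fst w))"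
    by (simp add: c sum_distrib_left mult_ac)
  have 2: "(\<Sum>i\<in>UNIV. \<Sum>j\<in>UNIV. p_sharp i w * p_sharp j w * christ_low i k j (fst w))
      = (\<Sum>j\<in>UNIV. \<Sum>l\<in>UNIV. p_sharp j w * p_sharp l w * christ_low l k j (fst w))"
    by (subst sum.swap) (simp add: mult_ac)
  have 3: "frechet_derivative (g i j) (at (fst w)) (axis k 1) = christ_low i k j (fst w) +
      christ_low j k i (fst w)"
    for i j
    using metric_compatible[OF x, of k i j] by (simp add: partial_def)
  show ?thesis
    by (simp add: d_energy_def hor_def 3 distrib_left sum.distrib 1 2)
qed

text \<open>The matrix of \<open>J\<close> has the vector dual to \<open>p\<close> as an eigenvector relative to the metric.\<close>

lemma d_energy_ver:
  assumes w: "w \<in> Z"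
  shows "d_energy w (ver i w) = (al (energy w) + 2 * energy w * be (energy w)) * snd w $ i"
proof -
  note x = Z_D(1)[OF w]
  have lin: "frechet_derivative (g i j) (at (fst w)) 0 = 0" for i j
    by (rule linear_0[OF linear_frechet_derivative[OF g_differentiable[OF x]]])
  have "d_energy w (ver i w) = (\<Sum>j\<in>UNIV. p_sharp j w * G_mat i j w)"
    by (simp add: d_energy_def ver_def lin)
  also have "\<dots> = al (energy w) * (\<Sum>j\<in>UNIV. g i j (fst w) * p_sharp j w)
      + be (energy w) * snd w $ i * (\<Sum>j\<in>UNIV. snd w $ j * p_sharp j w)"
    unfolding G_mat_def sum_distrib_left sum.distrib[symmetric]
    by (intro sum.cong refl) (simp add: algebra_simps)
  finally show ?thesis unfolding lower_p_sharp[OF x] sum_p_p_sharp by (simp add: algebra_simps)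
qed

lemma G_mat_has_derivative:
  assumes w: "w \<in> Z"
  shows "(G_mat i j has_derivative (\<lambda>v.
      dal (energy w) * d_energy w v * g i j (fst w) + al (energy w) * frechet_derivative (g i j)
          (at (fst w)) (fst v)
      + dbe (energy w) * d_energy w v * snd w $ i * snd w $ j
      + be (energy w) * (snd v $ i * snd w $ j + snd w $ i * snd v $ j))) (at w)"
proof -
  note x = Z_D(1)[OF w] and t = energy_pos[OF w]
  have al': "((\<lambda>w. al (energy w)) has_derivative (\<lambda>v. dal (energy w) * d_energy w v)) (at w)"
    using has_derivative_compose[OF energy_has_derivative[OF w] al_deriv[OF t, unfolded
        has_field_derivative_def]] .
  have be': "((\<lambda>w. be (energy w)) has_derivative (\<lambda>v. dbe (energy w) * d_energy w v)) (at w)"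
    using has_derivative_compose[OF energy_has_derivative[OF w] be_deriv[OF t, unfolded
        has_field_derivative_def]] .
  show ?thesis
    unfolding G_mat_def
    by (rule has_derivative_eq_rhs[OF has_derivative_add[OF
            has_derivative_mult[OF al' has_derivative_fst_compose[OF g_differentiable[OF x]]]
            has_derivative_mult[OF has_derivative_mult[OF be' has_derivative_snd_nth]
                has_derivative_snd_nth]]])
       (simp add: fun_eq_iff algebra_simps)
qed

lemma christ0_has_derivative:
  assumes w: "w \<in> Z"
  shows "(christ0 i h has_derivative (\<lambda>v. \<Sum>k\<in>UNIV.
      snd w $ k * frechet_derivative (christ k i h) (at (fst w)) (fst v) + snd v $ k * christ k i
          h (fst w))) (at w)"
  unfolding christ0_def
  by (intro has_derivative_sum has_derivative_mult has_derivative_snd_nth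
      has_derivative_fst_compose christ_differentiable Z_D(1) w)

lemma hor_has_derivative:
  assumes w: "w \<in> Z"
  shows "(hor i has_derivative (\<lambda>v. (0, \<chi> h. \<Sum>k\<in>UNIV.
      snd w $ k * frechet_derivative (christ k i h) (at (fst w)) (fst v) + snd v $ k * christ k i
          h (fst w)))) (at w)"
  unfolding hor_def
  by (intro has_derivative_Pair has_derivative_const has_derivative_vec_lambda
      christ0_has_derivative w)

lemma ver_has_derivative:
  assumes w: "w \<in> Z"
  shows "(ver i has_derivative (\<lambda>v. (0, \<chi> j.
      dal (energy w) * d_energy w v * g i j (fst w) + al (energy w) * frechet_derivative (g i j)
          (at (fst w)) (fst v)
      + dbe (energy w) * d_energy w v * snd w $ i * snd w $ j
      + be (energy w) * (snd v $ i * snd w $ j + snd w $ i * snd v $ j)))) (at w)"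
  unfolding ver_def
  by (intro has_derivative_Pair has_derivative_const has_derivative_vec_lambda
      G_mat_has_derivative w)

lemma H_mat_differentiable:
  assumes w: "w \<in> Z"
  shows "H_mat i j differentiable (at w)"
proof -
  note x = Z_D(1)[OF w] and t = energy_pos[OF w]
  have "(\<lambda>w. al (energy w)) differentiable (at w)" "(\<lambda>w. be (energy w)) differentiable (at w)"
    "energy differentiable (at w)"
    using has_derivative_compose[OF energy_has_derivative[OF w] al_deriv[OF t, unfolded
        has_field_derivative_def]]
      has_derivative_compose[OF energy_has_derivative[OF w] be_deriv[OF t, unfolded
          has_field_derivative_def]]
      energy_has_derivative[OF w]
    unfolding differentiable_def by blast+
  moreover have "(\<lambda>w. g_inv i j (fst w)) differentiable (at w)"
    using has_derivative_fst_compose[OF g_inv_differentiable[OF x]] unfolding differentiable_def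
        by blast
  ultimately show ?thesis
    unfolding H_mat_def using al_nonzero[OF t] al_be_nonzero[OF t]
    by (intro differentiable_diff differentiable_mult differentiable_divide differentiable_add
        differentiable_const p_sharp_differentiable[OF w]) auto
qed

subsection \<open>Brackets of the adapted frame\<close>

text \<open>The terms with \<open>p\<^sub>i p\<^sub>j p\<^sub>l\<close> are symmetric in \<open>i, j\<close> and cancel; what is left collects in
  \<open>balance\<close>.\<close>

lemma bracket_ver_ver:
  assumes w: "w \<in> Z"
  shows "local_bracket (ver i) (ver j) w
    = (0, \<chi> l. balance (energy w) * (snd w $ i * g j l (fst w) - snd w $ j * g i l (fst w)))"
proof -
  note x = Z_D(1)[OF w]
  have lin: "frechet_derivative (g i j) (at (fst w)) 0 = 0" for i j
    by (rule linear_0[OF linear_frechet_derivative[OF g_differentiable[OF x]]])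
  show ?thesis
    unfolding local_bracket_def frechet_derivative_eq[OF ver_has_derivative[OF w]] d_energy_ver[OF
        w]
    by (simp add: ver_def lin vec_eq_iff G_mat_sym[OF w, of j i])
       (simp add: G_mat_def balance_def algebra_simps)
qed

text \<open>The horizontal derivative of the matrix of \<open>J\<close> vanishes covariantly, since both the metric
  and \<open>p\<close> are parallel; torsion-freeness turns this into the cancellation of the two brackets.\<close>

lemma bracket_ver_hor:
  assumes w: "w \<in> Z"
  shows "local_bracket (ver i) (hor j) w + local_bracket (hor i) (ver j) w = 0"
proof -
  note x = Z_D(1)[OF w]
  have lin: "frechet_derivative (christ k i j) (at (fst w)) 0 = 0" for k i j
    by (rule linear_0[OF linear_frechet_derivative[OF christ_differentiable[OF x]]])
  have partial: "frechet_derivative (g i j) (at (fst w)) (axis k 1) = christ_low i k j (fst w) +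
      christ_low j k i (fst w)"
    for i j k
    using metric_compatible[OF x, of k i j] by (simp add: partial_def)
  have GC: "(\<Sum>k\<in>UNIV. G_mat i k w * christ k j l (fst w))
      = al (energy w) * christ_low i j l (fst w) + be (energy w) * snd w $ i * christ0 j l w" for
          i j l
  proof -
    have "(\<Sum>k\<in>UNIV. G_mat i k w * christ k j l (fst w))
        = al (energy w) * (\<Sum>k\<in>UNIV. g i k (fst w) * christ k j l (fst w))
          + be (energy w) * snd w $ i * (\<Sum>k\<in>UNIV. snd w $ k * christ k j l (fst w))"
      unfolding G_mat_def sum_distrib_left sum.distrib[symmetric]
      by (intro sum.cong refl) (simp add: algebra_simps)
    then show ?thesis by (simp add: lower_christ[OF x] christ0_def)
  qed
  have C0: "christ0 i j w = christ0 j i w"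
    by (simp add: christ0_def christ_sym[OF x, of _ i j])
  show ?thesis
    unfolding local_bracket_def frechet_derivative_eq[OF ver_has_derivative[OF w]]
      frechet_derivative_eq[OF hor_has_derivative[OF w]] d_energy_hor[OF w]
    by (simp add: ver_def[of _ w] hor_def[of _ w] lin prod_eq_iff vec_eq_iff GC partial)
       (simp add: C0 christ_low_sym[OF x, of _ i j] algebra_simps)
qed

text \<open>The curvature measures how far the horizontal distribution is from being integrable.\<close>

lemma bracket_hor_hor:
  assumes w: "w \<in> Z"
  shows "local_bracket (hor i) (hor j) w = (0, \<chi> l. \<Sum>m\<in>UNIV. snd w $ m * riem m l i j (fst w))"
proof -
  have C: "(\<Sum>k\<in>UNIV. christ0 i k w * christ k j l (fst w))
      = (\<Sum>m\<in>UNIV. snd w $ m * (\<Sum>k\<in>UNIV. christ m i k (fst w) * christ k j l (fst w)))" for i j l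
    unfolding christ0_def sum_distrib_right sum_distrib_left
    by (subst sum.swap) (simp add: mult_ac)
  show ?thesis
    unfolding local_bracket_def frechet_derivative_eq[OF hor_has_derivative[OF w]]
    by (simp add: hor_def[of _ w] vec_eq_iff sum.distrib C riem_def sum_subtractf partial_def
        algebra_simps)
qed

end

text \<open>A field of endomorphisms that acts on the adapted frame like the almost complex structure of
  diagonal type.\<close>

locale diagonal_structure = diagonal_coefficients gm U al be dal dbe
  for gm :: "real ^ 'n::finite \<Rightarrow> real ^ 'n ^ 'n" and U al be dal dbe +
  fixes B :: "(real ^ 'n) \<times> (real ^ 'n) \<Rightarrow> (real ^ 'n) \<times> (real ^ 'n) \<Rightarrow> (real ^ 'n) \<times> (real ^ 'n)"
  assumes linear_B: "w \<in> Z \<Longrightarrow> linear (B w)"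
    and B_hor: "w \<in> Z \<Longrightarrow> B w (hor i w) = ver i w"
    and B_vertical: "w \<in> Z \<Longrightarrow> B w (0, axis i 1) = - (\<Sum>j\<in>UNIV. H_mat i j w *\<^sub>R hor j w)"
begin

lemma vertical_eq_sum: "(0 :: real ^ 'n, \<chi> h. f h) = (\<Sum>h\<in>UNIV. f h *\<^sub>R (0, axis h (1::real)))"
  by (simp add: prod_eq_iff fst_sum snd_sum vec_lambda_eq_sum_axis)

lemma B_vertical_vec:
  assumes w: "w \<in> Z"
  shows "B w (0, \<chi> h. f h) = - (\<Sum>j\<in>UNIV. (\<Sum>h\<in>UNIV. f h * H_mat h j w) *\<^sub>R hor j w)"
proof -
  have "B w (0, \<chi> h. f h) = (\<Sum>h\<in>UNIV. f h *\<^sub>R - (\<Sum>j\<in>UNIV. H_mat h j w *\<^sub>R hor j w))"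
    unfolding vertical_eq_sum
    by (simp only: linear_sum[OF linear_B[OF w]] linear_scale[OF linear_B[OF w]] B_vertical[OF w])
  also have "\<dots> = - (\<Sum>h\<in>UNIV. \<Sum>j\<in>UNIV. (f h * H_mat h j w) *\<^sub>R hor j w)"
    by (simp add: sum_negf scaleR_sum_right)
  also have "(\<Sum>h\<in>UNIV. \<Sum>j\<in>UNIV. (f h * H_mat h j w) *\<^sub>R hor j w)
      = (\<Sum>j\<in>UNIV. (\<Sum>h\<in>UNIV. f h * H_mat h j w) *\<^sub>R hor j w)"
    by (subst sum.swap) (simp add: scaleR_sum_left)
  finally show ?thesis .
qed

lemma sum_delta_scaleR:
  fixes f :: "'n \<Rightarrow> 'v::real_vector"
  shows "(\<Sum>j\<in>UNIV. (if i = j then 1 else (0::real)) *\<^sub>R f j) = f i"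
  by (simp add: if_distrib[of "\<lambda>x. x *\<^sub>R _"] cong: if_cong)

lemma B_ver:
  assumes w: "w \<in> Z"
  shows "B w (ver i w) = - hor i w"
  unfolding ver_def B_vertical_vec[OF w] G_mat_H_mat[OF w] by (simp add: sum_delta_scaleR)

definition vert_part :: "(real ^ 'n) \<times> (real ^ 'n) \<Rightarrow> (real ^ 'n) \<times> (real ^ 'n) \<Rightarrow> 'n \<Rightarrow> real" where
  "vert_part w e h = snd e $ h - (\<Sum>i\<in>UNIV. fst e $ i * christ0 i h w)"

lemma horizontal_vertical_split:
  "e = (\<Sum>i\<in>UNIV. fst e $ i *\<^sub>R hor i w) + (0, \<chi> h. vert_part w e h)"
  by (simp add: prod_eq_iff fst_sum snd_sum vec_eq_iff vert_part_def hor_def axis_def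
      if_distrib[of "\<lambda>x. _ * x"] cong: if_cong)

lemma B_eq:
  assumes w: "w \<in> Z"
  shows "B w e = (\<Sum>i\<in>UNIV. fst e $ i *\<^sub>R ver i w)
    - (\<Sum>j\<in>UNIV. (\<Sum>h\<in>UNIV. vert_part w e h * H_mat h j w) *\<^sub>R hor j w)"
proof -
  have "B w e = B w ((\<Sum>i\<in>UNIV. fst e $ i *\<^sub>R hor i w) + (0, \<chi> h. vert_part w e h))"
    using horizontal_vertical_split[of e w] by simp
  then show ?thesis
    by (simp only: linear_add[OF linear_B[OF w]] linear_sum[OF linear_B[OF w]]
        linear_scale[OF linear_B[OF w]] B_hor[OF w] B_vertical_vec[OF w] add_uminus_conv_diff)
qed

text \<open>Vertical vectors are images of horizontal ones, because the matrix of \<open>J\<close> is invertible.\<close>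

lemma vertical_in_image:
  assumes w: "w \<in> Z"
  shows "(0, \<chi> h. f h) = B w (\<Sum>j\<in>UNIV. (\<Sum>h\<in>UNIV. f h * H_mat h j w) *\<^sub>R hor j w)"
proof -
  have "(\<Sum>j\<in>UNIV. (\<Sum>h\<in>UNIV. f h * H_mat h j w) * G_mat j k w) = f k" for k
  proof -
    have "(\<Sum>j\<in>UNIV. (\<Sum>h\<in>UNIV. f h * H_mat h j w) * G_mat j k w)
        = (\<Sum>h\<in>UNIV. f h * (\<Sum>j\<in>UNIV. G_mat k j w * H_mat j h w))"
      unfolding sum_distrib_left sum_distrib_right
      by (subst sum.swap) (simp add: G_mat_sym[OF w, of _ k] H_mat_sym[OF w, of h for h] mult_ac)
    then show ?thesis by (simp add: G_mat_H_mat[OF w] sum_delta_mult)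
  qed
  then show ?thesis
    by (simp add: linear_sum[OF linear_B[OF w]] linear_scale[OF linear_B[OF w]] B_hor[OF w]
        prod_eq_iff fst_sum snd_sum vec_eq_iff ver_def)
qed

lemma B_square:
  assumes w: "w \<in> Z"
  shows "B w (B w e) = - e"
proof -
  let ?s = "\<Sum>j\<in>UNIV. (\<Sum>h\<in>UNIV. vert_part w e h * H_mat h j w) *\<^sub>R hor j w"
  have "B w (B w e) = (\<Sum>i\<in>UNIV. fst e $ i *\<^sub>R - hor i w) - B w ?s"
    unfolding B_eq[OF w, of e]
    by (simp only: linear_diff[OF linear_B[OF w]] linear_sum[OF linear_B[OF w]]
        linear_scale[OF linear_B[OF w]] B_ver[OF w])
  also have "B w ?s = (0, \<chi> h. vert_part w e h)"
    using vertical_in_image[OF w] by simp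
  also have "(\<Sum>i\<in>UNIV. fst e $ i *\<^sub>R - hor i w) - (0, \<chi> h. vert_part w e h)
      = - ((\<Sum>i\<in>UNIV. fst e $ i *\<^sub>R hor i w) + (0, \<chi> h. vert_part w e h))"
    by (simp add: sum_negf)
  finally show ?thesis using horizontal_vertical_split[of e w] by simp
qed

lemma linear_family_B:
  assumes w: "w \<in> Z"
  shows "linear_family_at B Z w"
  unfolding linear_family_at_def
proof (intro conjI ballI allI)
  fix e
  show "(\<lambda>w. B w e) differentiable (at w)"
  proof (rule differentiable_cong_open[OF _ open_Z w B_eq[symmetric]])
    have "hor i differentiable (at w)" "ver i differentiable (at w)" "christ0 i h differentiable
        (at w)"
      for i h
      using hor_has_derivative[OF w] ver_has_derivative[OF w] christ0_has_derivative[OF w]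
      unfolding differentiable_def by blast+
    then show "(\<lambda>w. (\<Sum>i\<in>UNIV. fst e $ i *\<^sub>R ver i w)
        - (\<Sum>j\<in>UNIV. (\<Sum>h\<in>UNIV. vert_part w e h * H_mat h j w) *\<^sub>R hor j w)) differentiable (at w)"
      unfolding vert_part_def
      by (intro differentiable_diff differentiable_sum differentiable_scaleR differentiable_mult
          differentiable_const H_mat_differentiable w ballI finite)
  qed
qed (use open_Z w linear_B in auto)

text \<open>The brackets of a horizontal with a vertical frame field cancel, so that only the vertical
  brackets and the curvature remain.\<close>

lemma nijenhuis_tensor_hor:
  assumes w: "w \<in> Z"
  shows "nijenhuis_tensor B w (hor i w) (hor j w)
    = (0, \<chi> l. balance (energy w) * (snd w $ i * g j l (fst w) - snd w $ j * g i l (fst w))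
        - (\<Sum>m\<in>UNIV. snd w $ m * riem m l i j (fst w)))"
proof -
  let ?J = "\<lambda>i y. B y (hor i y)"
  have diff: "hor i differentiable (at w)" for i
    using hor_has_derivative[OF w] unfolding differentiable_def by blast
  have J: "frechet_derivative (?J i) (at w) = frechet_derivative (ver i) (at w)" "?J i w = ver i
      w" for i
  proof -
    have "(?J i has_derivative frechet_derivative (ver i) (at w)) (at w)"
      by (rule has_derivative_transform_within_open[OF _ open_Z w, of "ver i"])
         (simp_all add: B_hor frechet_derivative_eq[OF ver_has_derivative[OF w]]
             ver_has_derivative[OF w])
    then show "frechet_derivative (?J i) (at w) = frechet_derivative (ver i) (at w)"
      by (rule frechet_derivative_eq)
  qed (rule B_hor[OF w])
  have br: "local_bracket (?J i) Y w = local_bracket (ver i) Y w"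
    "local_bracket Y (?J i) w = local_bracket Y (ver i) w" for i Y
    by (simp_all add: local_bracket_def J)
  have "nijenhuis_tensor B w (hor i w) (hor j w)
      = local_bracket (ver i) (ver j) w - B w (local_bracket (ver i) (hor j) w)
        - B w (local_bracket (hor i) (ver j) w) - local_bracket (hor i) (hor j) w"
    using local_nijenhuis_tensorial[OF linear_family_B[OF w] B_square[OF w] diff[of i] diff[of j]]
    by (simp add: br)
  also have "\<dots> = local_bracket (ver i) (ver j) w
      - B w (local_bracket (ver i) (hor j) w + local_bracket (hor i) (ver j) w)
      - local_bracket (hor i) (hor j) w"
    by (simp add: linear_add[OF linear_B[OF w]])
  also have "\<dots> = local_bracket (ver i) (ver j) w - local_bracket (hor i) (hor j) w"
    by (simp add: bracket_ver_hor[OF w] linear_0[OF linear_B[OF w]])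
  finally show ?thesis
    by (simp add: bracket_ver_ver[OF w] bracket_hor_hor[OF w] vec_eq_iff)
qed

lemma nijenhuis_tensor_eq_0_iff:
  assumes w: "w \<in> Z"
  shows "(\<forall>v v'. nijenhuis_tensor B w v v' = 0) \<longleftrightarrow>
    (\<forall>i j l. balance (energy w) * (snd w $ i * g j l (fst w) - snd w $ j * g i l (fst w))
        = (\<Sum>m\<in>UNIV. snd w $ m * riem m l i j (fst w)))"
proof
  assume *: "\<forall>v v'. nijenhuis_tensor B w v v' = 0"
  show "\<forall>i j l. balance (energy w) * (snd w $ i * g j l (fst w) - snd w $ j * g i l (fst w))
        = (\<Sum>m\<in>UNIV. snd w $ m * riem m l i j (fst w))"
  proof (intro allI)
    fix i j l
    have "nijenhuis_tensor B w (hor i w) (hor j w) = 0" using * by blast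
    from arg_cong[OF this, of "\<lambda>v. snd v $ l"]
    show "balance (energy w) * (snd w $ i * g j l (fst w) - snd w $ j * g i l (fst w))
        = (\<Sum>m\<in>UNIV. snd w $ m * riem m l i j (fst w))"
      by (simp add: nijenhuis_tensor_hor[OF w])
  qed
next
  assume *: "\<forall>i j l. balance (energy w) * (snd w $ i * g j l (fst w) - snd w $ j * g i l (fst w))
        = (\<Sum>m\<in>UNIV. snd w $ m * riem m l i j (fst w))"
  have 0: "nijenhuis_tensor B w (hor i w) (hor j w) = 0" for i j
    by (simp add: nijenhuis_tensor_hor[OF w] * prod_eq_iff vec_eq_iff)
  have frame: "\<exists>a b. v = (\<Sum>i\<in>UNIV. a i *\<^sub>R hor i w) + B w (\<Sum>i\<in>UNIV. b i *\<^sub>R hor i w)" for v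
    using horizontal_vertical_split[of v w]
    unfolding vertical_in_image[OF w, of "vert_part w v"] by (intro exI)
  show "\<forall>v v'. nijenhuis_tensor B w v v' = 0"
    by (intro allI nijenhuis_tensor_eq_0I[OF linear_family_B[OF w] B_square frame 0])
qed

end

context diagonal_coefficients
begin

definition curvature_identity :: "(real ^ 'n) \<times> (real ^ 'n) \<Rightarrow> bool" where
  "curvature_identity w \<longleftrightarrow> (\<forall>i j l.
     balance (energy w) * (snd w $ i * g j l (fst w) - snd w $ j * g i l (fst w))
        = (\<Sum>m\<in>UNIV. snd w $ m * riem m l i j (fst w)))"

text \<open>Along a ray in a cotangent space the curvature side is linear in \<open>p\<close>, while the energy
  density runs through all positive numbers; hence \<open>balance\<close> must be constant.\<close>

lemma curvature_identity_imp_balance_constant: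
  assumes x: "x \<in> U" and n: "CARD('n) > 1"
    and id: "\<And>p. p \<noteq> 0 \<Longrightarrow> curvature_identity (x, p)"
  shows "\<exists>\<kappa>. \<forall>t>0. balance t = \<kappa>"
proof -
  obtain i j :: 'n where ij: "i \<noteq> j"
    using n by (metis (full_types) One_nat_def UNIV_I card_le_Suc0_iff_eq finite linorder_not_le)
  (* Any p with a positive component i and a zero component j would do: the left-hand side of the
     identity at (i, j, j) is then a positive multiple of balance. *)
  define p :: "real ^ 'n" where "p = axis i 1"
  have "p \<noteq> 0" by (simp add: p_def axis_eq_0_iff)
  moreover have "p $ i = 1" "p $ j = 0" using ij by (simp_all add: p_def axis_def)
  ultimately have p: "p \<noteq> 0" "p $ i = 1" "p $ j = 0" by auto
  have "axis j 1 \<noteq> (0 :: real ^ 'n)" by (simp add: axis_eq_0_iff)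
  from gm_pos[OF x this] have gjj: "g j j x > 0"
    by (simp add: axis_def if_distrib[of "\<lambda>x. _ * x"] cong: if_cong)
  let ?t = "energy (x, p)"
  have t0: "?t > 0" using energy_pos[of "(x, p)"] x p by (simp add: Z_def)
  have "balance t = balance ?t" if t: "t > 0" for t
  proof -
    define s where "s = sqrt (t / ?t)"
    have s: "s > 0" using t t0 by (simp add: s_def)
    have "energy (x, s *\<^sub>R p) = t"
      using t t0 by (simp add: energy_scale s_def)
    then have "balance t * (s * g j j x) = s * (\<Sum>m\<in>UNIV. p $ m * riem m j i j x)"
      using id[of "s *\<^sub>R p", unfolded curvature_identity_def, rule_format, of i j j] s p
      by (simp add: sum_distrib_left mult_ac)
    moreover have "balance ?t * g j j x = (\<Sum>m\<in>UNIV. p $ m * riem m j i j x)"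
      using id[of p, unfolded curvature_identity_def, rule_format, of i j j] p by simp
    ultimately have "(balance t * g j j x) * s = (balance ?t * g j j x) * s" by (simp add: mult_ac)
    then show ?thesis using s gjj by simp
  qed
  then show ?thesis by blast
qed

text \<open>Both sides are linear in \<open>p\<close> once \<open>balance\<close> is constant, so it suffices to test on basis
  covectors.\<close>

lemma curvature_identity_iff_constant_curvature:
  assumes x: "x \<in> U" and F: "\<And>t. t > 0 \<Longrightarrow> balance t = \<kappa>"
  shows "(\<forall>p. p \<noteq> 0 \<longrightarrow> curvature_identity (x, p)) \<longleftrightarrow> constant_curvature_form \<kappa> x"
proof
  assume id: "\<forall>p. p \<noteq> 0 \<longrightarrow> curvature_identity (x, p)"
  show "constant_curvature_form \<kappa> x"
    unfolding constant_curvature_form_def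
  proof (intro allI)
    fix k h i j
    have p: "axis k 1 \<noteq> (0 :: real ^ 'n)" by (simp add: axis_eq_0_iff)
    then have "balance (energy (x, axis k 1)) = \<kappa>" using energy_pos[of "(x, axis k 1)"] x by (simp
        add: F Z_def)
    moreover have "curvature_identity (x, axis k 1)" using id p by blast
    ultimately have "\<kappa> * (axis k 1 $ i * g j h x - axis k 1 $ j * g i h x)
        = (\<Sum>m\<in>UNIV. axis k 1 $ m * riem m h i j x)"
      unfolding curvature_identity_def by simp
    also have "\<dots> = riem k h i j x"
      by (simp add: axis_def if_distrib[of "\<lambda>x. x * _"] cong: if_cong)
    finally show "riem k h i j x = \<kappa> * ((if k = i then g j h x else 0) - (if k = j then g i h x
        else 0))"
      by (auto simp: axis_def split: if_splits)
  qed
next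
  assume *: "constant_curvature_form \<kappa> x"
  show "\<forall>p. p \<noteq> 0 \<longrightarrow> curvature_identity (x, p)"
  proof (intro allI impI)
    fix p :: "real ^ 'n" assume "p \<noteq> 0"
    then have "balance (energy (x, p)) = \<kappa>" using energy_pos[of "(x, p)"] x by (simp add: F Z_def)
    moreover have "(\<Sum>m\<in>UNIV. p $ m * riem m l i j x) = \<kappa> * (p $ i * g j l x - p $ j * g i l x)"
        for i j l
    proof -
      have "p $ m * riem m l i j x = (if m = i then \<kappa> * (p $ i * g j l x) else 0)
          - (if m = j then \<kappa> * (p $ j * g i l x) else 0)" for m
      proof -
        have R: "riem m l i j x = \<kappa> * ((if m = i then g j l x else 0) - (if m = j then g i l x
            else 0))"
          using * unfolding constant_curvature_form_def by blast
        show ?thesis by (subst R) (simp add: algebra_simps)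
      qed
      then show ?thesis by (simp add: sum_subtractf right_diff_distrib)
    qed
    ultimately show "curvature_identity (x, p)" by (simp add: curvature_identity_def)
  qed
qed

end

section \<open>Riemannian manifolds in charts\<close>

lemma sum_pull3:
  fixes f :: "'m::finite \<Rightarrow> 'n::finite \<Rightarrow> 'n \<Rightarrow> 'n \<Rightarrow> real"
  shows "(\<Sum>h\<in>UNIV. \<Sum>i\<in>UNIV. \<Sum>j\<in>UNIV. \<Sum>m\<in>UNIV. f m h i j)
    = (\<Sum>m\<in>UNIV. \<Sum>h\<in>UNIV. \<Sum>i\<in>UNIV. \<Sum>j\<in>UNIV. f m h i j)"
proof -
  have "(\<Sum>h\<in>UNIV. \<Sum>i\<in>UNIV. \<Sum>j\<in>UNIV. \<Sum>m\<in>UNIV. f m h i j)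
      = (\<Sum>h\<in>UNIV. \<Sum>i\<in>UNIV. \<Sum>m\<in>UNIV. \<Sum>j\<in>UNIV. f m h i j)"
    by (rule sum.cong[OF refl], rule sum.cong[OF refl], rule sum.swap)
  also have "\<dots> = (\<Sum>h\<in>UNIV. \<Sum>m\<in>UNIV. \<Sum>i\<in>UNIV. \<Sum>j\<in>UNIV. f m h i j)"
    by (rule sum.cong[OF refl], rule sum.swap)
  also have "\<dots> = (\<Sum>m\<in>UNIV. \<Sum>h\<in>UNIV. \<Sum>i\<in>UNIV. \<Sum>j\<in>UNIV. f m h i j)"
    by (rule sum.swap)
  finally show ?thesis .
qed

locale riemannian = cotangent_atlas M for M :: "('a, 'i, real ^ 'n::finite) manifold" +
  fixes gr :: "('a, 'i, 'n) metric"
  assumes manifold: "smooth_manifold M" and metric: "riemannian_metric M gr"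
begin

definition gmat :: "'i \<Rightarrow> real ^ 'n \<Rightarrow> real ^ 'n ^ 'n" where
  "gmat c z = metric_matrix M gr c (chart_inv M c z)"

definition chart_image :: "'i \<Rightarrow> (real ^ 'n) set" where
  "chart_image c = chart_map M c ` chart_dom M c"

lemma chart_dom_points: "c \<in> charts M \<Longrightarrow> chart_dom M c \<subseteq> points M"
  using manifold unfolding smooth_manifold_def by blast

lemma gmat_chart_map: "c \<in> charts_at M x \<Longrightarrow> gmat c (chart_map M c x) = metric_matrix M gr c x"
  by (simp add: gmat_def chart_inv_charts_at)

lemma metric_linear:
  assumes c: "c \<in> charts_at M x" and w: "w \<in> tangent_space M x"
  shows "linear (\<lambda>e. gr x (tangent_vector M c x e) w)"
proof (rule linearI)
  have x: "x \<in> points M" using c chart_dom_points unfolding charts_at_def by blast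
  have lin: "gr x (a *\<^sub>R u + b *\<^sub>R v) w = a * gr x u w + b * gr x v w"
    if "u \<in> tangent_space M x" "v \<in> tangent_space M x" for u v a b
    using metric x w that unfolding riemannian_metric_def by blast
  note t = tangent_vector_in[OF c]
  show "gr x (tangent_vector M c x (e + f)) w
      = gr x (tangent_vector M c x e) w + gr x (tangent_vector M c x f) w" for e f
    using lin[OF t t, of 1 e 1 f] by (simp add: tangent_vector_add[OF c])
  show "gr x (tangent_vector M c x (r *\<^sub>R e)) w = r *\<^sub>R gr x (tangent_vector M c x e) w" for r e
    using lin[OF t t, of r e 0 e] by (simp add: tangent_vector_scale[OF c])
qed

lemma metric_sym:
  assumes c: "c \<in> charts_at M x" and v: "v \<in> tangent_space M x" and w: "w \<in> tangent_space M x"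
  shows "gr x v w = gr x w v"
proof -
  have x: "x \<in> points M" using c chart_dom_points unfolding charts_at_def by blast
  show ?thesis using metric x v w unfolding riemannian_metric_def by blast
qed

lemma metric_in_chart:
  assumes c: "c \<in> charts_at M x" and v: "v \<in> tangent_space M x" and w: "w \<in> tangent_space M x"
  shows "gr x v w = (\<Sum>i\<in>UNIV. \<Sum>j\<in>UNIV. metric_matrix M gr c x $ i $ j * v c $ i * w c $ j)"
proof -
  have exp: "gr x (tangent_vector M c x e) w = (\<Sum>i\<in>UNIV. e $ i * gr x (coord_vector M c x i) w)"
    if w: "w \<in> tangent_space M x" for e w
  proof -
    have "e = (\<Sum>i\<in>UNIV. e $ i *\<^sub>R axis i 1)"
      using vec_lambda_eq_sum_axis[of "\<lambda>i. e $ i"] by (simp add: vec_lambda_eta)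
    then have "gr x (tangent_vector M c x e) w
        = gr x (tangent_vector M c x (\<Sum>i\<in>UNIV. e $ i *\<^sub>R axis i 1)) w" by simp
    also have "\<dots> = (\<Sum>i\<in>UNIV. e $ i *\<^sub>R gr x (tangent_vector M c x (axis i 1)) w)"
      by (simp only: linear_sum[OF metric_linear[OF c w]] linear_scale[OF metric_linear[OF c w]])
    finally show ?thesis by (simp add: coord_vector_def)
  qed
  have co: "coord_vector M c x i \<in> tangent_space M x" for i
    unfolding coord_vector_def by (rule tangent_vector_in[OF c])
  have "gr x v w = (\<Sum>i\<in>UNIV. v c $ i * gr x (coord_vector M c x i) w)"
    using exp[OF w, of "v c"] by (simp add: tangent_vector_eq[OF c v])
  also have "\<dots> = (\<Sum>i\<in>UNIV. v c $ i * (\<Sum>j\<in>UNIV. w c $ j * metric_matrix M gr c x $ j $ i))"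
  proof (intro sum.cong refl arg_cong2[where f = "(*)"])
    fix i
    have "gr x (coord_vector M c x i) w = gr x w (coord_vector M c x i)"
      by (rule metric_sym[OF c co w])
    also have "\<dots> = (\<Sum>j\<in>UNIV. w c $ j * gr x (coord_vector M c x j) (coord_vector M c x i))"
      using exp[OF co, of "w c"] by (simp add: tangent_vector_eq[OF c w])
    finally show "gr x (coord_vector M c x i) w = (\<Sum>j\<in>UNIV. w c $ j * metric_matrix M gr c x $ j $
        i)"
      by (simp add: metric_matrix_def)
  qed
  also have "\<dots> = (\<Sum>i\<in>UNIV. \<Sum>j\<in>UNIV. metric_matrix M gr c x $ i $ j * v c $ i * w c $ j)"
    using metric_sym[OF c co co] by (simp add: sum_distrib_left metric_matrix_def mult_ac)
  finally show ?thesis .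
qed

lemma chart_image_E:
  assumes "c \<in> charts M" "z \<in> chart_image c"
  obtains x where "z = chart_map M c x" "c \<in> charts_at M x"
  using assms by (auto simp: chart_image_def charts_at_def)

lemma metric_field_chart:
  assumes c: "c \<in> charts M"
  shows "metric_field (gmat c) (chart_image c)"
proof
  show "open (chart_image c)"
    using open_overlap[OF c c] by (simp add: chart_image_def)
  show "smooth_on (chart_image c) (\<lambda>z. gmat c z $ i $ j)" for i j
  proof -
    have "\<forall>c\<in>charts M. \<forall>i j. smooth_on (chart_map M c ` chart_dom M c)
        (\<lambda>z. metric_matrix M gr c (chart_inv M c z) $ i $ j)"
      using metric unfolding riemannian_metric_def by (rule conjunct2)
    then show ?thesis using c unfolding gmat_def chart_image_def by auto
  qed
next
  fix z assume "z \<in> chart_image c"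
  then obtain x where z: "z = chart_map M c x" and cx: "c \<in> charts_at M x"
    using chart_image_E[OF c] by blast
  show "gmat c z $ i $ j = gmat c z $ j $ i" for i j
    using metric_sym[OF cx tangent_vector_in[OF cx] tangent_vector_in[OF cx]]
    by (simp add: z gmat_chart_map[OF cx] metric_matrix_def coord_vector_def)
  fix v :: "real ^ 'n" assume v: "v \<noteq> 0"
  let ?v = "tangent_vector M c x v"
  have x: "x \<in> points M" using cx chart_dom_points unfolding charts_at_def by blast
  have "?v \<noteq> 0" using v tangent_vector_component[OF cx, of v] by auto
  then have "gr x ?v ?v > 0"
    using metric x tangent_vector_in[OF cx] unfolding riemannian_metric_def by blast
  then show "0 < (\<Sum>i\<in>UNIV. \<Sum>j\<in>UNIV. gmat c z $ i $ j * v $ i * v $ j)"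
    by (simp add: metric_in_chart[OF cx tangent_vector_in[OF cx] tangent_vector_in[OF cx]]
        tangent_vector_component[OF cx] z gmat_chart_map[OF cx])
qed

lemma christoffel_in_chart:
  assumes c: "c \<in> charts_at M x"
  shows "christoffel M gr c k i j x = metric_field.christ (gmat c) k i j (chart_map M c x)"
proof -
  interpret metric_field "gmat c" "chart_image c"
    using c by (intro metric_field_chart) (simp add: charts_at_def)
  have "partial_deriv M c i (\<lambda>y. metric_matrix M gr c y $ j $ l) x = partial i (g j l) (chart_map
      M c x)"
    for i j l
    by (simp add: partial_deriv_def partial_def o_def gmat_def)
  then show ?thesis
    by (simp add: christoffel_def christ_def g_inv_def inverse_metric_matrix_def gmat_chart_map[OF
        c])
qed

lemma curvature_in_chart:
  assumes c: "c \<in> charts_at M x"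
  shows "curvature_coeff M gr c k h i j x = metric_field.riem (gmat c) k h i j (chart_map M c x)"
proof -
  have c': "c \<in> charts M" and z: "chart_map M c x \<in> chart_image c"
    using c by (auto simp: charts_at_def chart_image_def)
  interpret metric_field "gmat c" "chart_image c" by (rule metric_field_chart[OF c'])
  have "partial_deriv M c a (christoffel M gr c k i j) x = partial a (christ k i j) (chart_map M c
      x)" for a k i j
  proof -
    have "partial a (christ k i j) (chart_map M c x) = partial a (christoffel M gr c k i j \<circ>
        chart_inv M c) (chart_map M c x)"
    proof (rule partial_cong[OF christ_differentiable[OF z] open_U z])
      fix y assume "y \<in> chart_image c"
      then obtain x' where "y = chart_map M c x'" "c \<in> charts_at M x'"
        using chart_image_E[OF c'] by blast
      then show "christ k i j y = (christoffel M gr c k i j \<circ> chart_inv M c) y"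
        by (simp add: christoffel_in_chart chart_inv_charts_at)
    qed
    then show ?thesis by (simp add: partial_deriv_def partial_def)
  qed
  then show ?thesis
    by (simp add: curvature_coeff_def riem_def christoffel_in_chart[OF c])
qed

lemma sectional_curvature_in_chart:
  assumes c: "c \<in> charts_at M x" and v: "v \<in> tangent_space M x" and w: "w \<in> tangent_space M x"
  shows "sectional_curvature M gr c x v w
    = form4 (\<lambda>k h i j. metric_field.riem_low (gmat c) k h i j (chart_map M c x)) (v c) (w c) (v c)
        (w c)
      / (metric_field.inner_g (gmat c) (chart_map M c x) (v c) (v c)
           * metric_field.inner_g (gmat c) (chart_map M c x) (w c) (w c)
         - (metric_field.inner_g (gmat c) (chart_map M c x) (v c) (w c))\<^sup>2)"
proof -
  have c': "c \<in> charts M" and z: "chart_map M c x \<in> chart_image c"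
    using c by (auto simp: charts_at_def chart_image_def)
  interpret metric_field "gmat c" "chart_image c" by (rule metric_field_chart[OF c'])
  let ?z = "chart_map M c x"
  have inner: "gr x a b = inner_g ?z (a c) (b c)" if "a \<in> tangent_space M x" "b \<in> tangent_space M
      x" for a b
    using metric_in_chart[OF c that] by (simp add: inner_g_def gmat_chart_map[OF c])
  have cur: "curvature M gr c x v w w c
      = (\<chi> k. \<Sum>h\<in>UNIV. \<Sum>i\<in>UNIV. \<Sum>j\<in>UNIV. riem k h i j ?z * v c $ i * w c $ j * w c $ h)"
    unfolding curvature_def tangent_vector_component[OF c] curvature_in_chart[OF c] ..
  have "curvature M gr c x v w w \<in> tangent_space M x"
    unfolding curvature_def by (rule tangent_vector_in[OF c])
  from inner[OF this v]
  have "gr x (curvature M gr c x v w w) v = (\<Sum>k\<in>UNIV. \<Sum>l\<in>UNIV. g k l ?z *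
      (\<Sum>h\<in>UNIV. \<Sum>i\<in>UNIV. \<Sum>j\<in>UNIV. riem k h i j ?z * v c $ i * w c $ j * w c $ h) * v c $ l)"
    by (simp add: cur inner_g_def)
  also have "\<dots> = (\<Sum>l\<in>UNIV. \<Sum>k\<in>UNIV. g k l ?z *
      (\<Sum>h\<in>UNIV. \<Sum>i\<in>UNIV. \<Sum>j\<in>UNIV. riem k h i j ?z * v c $ i * w c $ j * w c $ h) * v c $ l)"
    by (rule sum.swap)
  also have "\<dots> = (\<Sum>l\<in>UNIV. \<Sum>k\<in>UNIV. \<Sum>h\<in>UNIV. \<Sum>i\<in>UNIV. \<Sum>j\<in>UNIV.
      g l k ?z * riem k h i j ?z * v c $ l * w c $ h * v c $ i * w c $ j)"
    unfolding sum_distrib_left sum_distrib_right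
    by (intro sum.cong refl) (simp add: gm_sym[OF z] mult_ac)
  also have "\<dots> = form4 (\<lambda>k h i j. riem_low k h i j ?z) (v c) (w c) (v c) (w c)"
    unfolding form4_def riem_low_def sum_distrib_right
    by (rule sum.cong[OF refl], rule sum_pull3[symmetric])
  finally show ?thesis
    by (simp add: sectional_curvature_def inner[OF v v] inner[OF v w] inner[OF w w])
qed

text \<open>Sectional curvature only constrains independent pairs, that is, pairs with nonzero Gram
  determinant; on dependent pairs both sides of the polarised identity vanish.\<close>

lemma constant_sectional_curvature_in_charts:
  "constant_sectional_curvature M gr \<kappa> \<longleftrightarrow>
    (\<forall>c\<in>charts M. \<forall>z\<in>chart_image c. metric_field.constant_curvature_form (gmat c) \<kappa> z)"
proof
  assume *: "\<forall>c\<in>charts M. \<forall>z\<in>chart_image c. metric_field.constant_curvature_form (gmat c) \<kappa> z"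
  show "constant_sectional_curvature M gr \<kappa>"
    unfolding constant_sectional_curvature_def
  proof (intro ballI impI)
    fix c x v w
    assume c': "c \<in> charts M" and x: "x \<in> chart_dom M c"
      and v: "v \<in> tangent_space M x" and w: "w \<in> tangent_space M x"
      and ind: "v \<noteq> w \<and> independent {v, w}"
    have c: "c \<in> charts_at M x" using c' x by (simp add: charts_at_def)
    have z: "chart_map M c x \<in> chart_image c" using x by (simp add: chart_image_def)
    interpret metric_field "gmat c" "chart_image c" by (rule metric_field_chart[OF c'])
    let ?z = "chart_map M c x"
    have "gram ?z (v c) (w c) \<noteq> 0"
    proof
      assume "gram ?z (v c) (w c) = 0"
      then have eq: "inner_g ?z (w c) (w c) *\<^sub>R v c = inner_g ?z (v c) (w c) *\<^sub>R w c"
        by (rule gram_eq_0_imp[OF z])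
      have "w \<noteq> 0" using ind dependent_zero[of "{v, w}"] by auto
      then have "w c \<noteq> 0"
        using tangent_vector_eq[OF c w] linear_0[OF tangent_vector_linear[OF c]] by auto
      then have pos: "inner_g ?z (w c) (w c) \<noteq> 0" using inner_g_pos[OF z] by force
      define k where "k = inner_g ?z (v c) (w c) / inner_g ?z (w c) (w c)"
      have "v c = (1 / inner_g ?z (w c) (w c)) *\<^sub>R (inner_g ?z (w c) (w c) *\<^sub>R v c)"
        using pos by simp
      also have "\<dots> = k *\<^sub>R w c" unfolding eq by (simp add: k_def)
      finally have "v = k *\<^sub>R w"
        using tangent_vector_eq[OF c v] tangent_vector_eq[OF c w] tangent_vector_scale[OF c, of k
            "w c"]
        by simp
      then have "v \<in> span {w}" by (simp add: span_scale span_base)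
      then show False using ind by (simp add: independent_insert)
    qed
    moreover have "form4 (\<lambda>k h i j. riem_low k h i j ?z) (v c) (w c) (v c) (w c) = \<kappa> * gram ?z (v
        c) (w c)"
      using * c' z constant_curvature_form_iff[OF z] by blast
    ultimately show "sectional_curvature M gr c x v w = \<kappa>"
      by (simp add: sectional_curvature_in_chart[OF c v w])
  qed
next
  assume *: "constant_sectional_curvature M gr \<kappa>"
  show "\<forall>c\<in>charts M. \<forall>z\<in>chart_image c. metric_field.constant_curvature_form (gmat c) \<kappa> z"
  proof (intro ballI)
    fix c z assume c': "c \<in> charts M" and z: "z \<in> chart_image c"
    interpret metric_field "gmat c" "chart_image c" by (rule metric_field_chart[OF c'])
    obtain x where zx: "z = chart_map M c x" and c: "c \<in> charts_at M x"
      using chart_image_E[OF c' z] by blast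
    have "form4 (\<lambda>k h i j. riem_low k h i j z) a b a b = \<kappa> * gram z a b" for a b
    proof (cases "gram z a b = 0")
      case False
      let ?v = "tangent_vector M c x a" and ?w = "tangent_vector M c x b"
      have v: "?v \<in> tangent_space M x" and w: "?w \<in> tangent_space M x"
        by (simp_all add: tangent_vector_in c)
      have not_scaled: "a \<noteq> k *\<^sub>R b" for k using False gram_proportional[of z k b] by blast
      have "b \<noteq> 0" using False by (auto simp: inner_g_def)
      then have "?w \<noteq> 0" using tangent_vector_component[OF c, of b] by auto
      moreover have nv: "?v \<noteq> k *\<^sub>R ?w" for k
      proof
        assume "?v = k *\<^sub>R ?w"
        then have "?v c = k *\<^sub>R ?w c" by (simp add: scaleR_fun_apply)
        then show False using not_scaled by (simp add: tangent_vector_component[OF c])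
      qed
      ultimately have "?v \<noteq> ?w \<and> independent {?v, ?w}"
        using nv[of 1] by (auto simp: independent_insert span_singleton)
      then have "sectional_curvature M gr c x ?v ?w = \<kappa>"
        using * c v w unfolding constant_sectional_curvature_def charts_at_def by blast
      then show ?thesis
        using False by (simp add: sectional_curvature_in_chart[OF c v w]
            tangent_vector_component[OF c] zx
            field_simps)
    next
      case True
      have "form4 (\<lambda>k h i j. riem_low k h i j z) a b a b = 0"
      proof (cases "b = 0")
        case True
        then show ?thesis by (simp add: form4_def)
      next
        case False
        define k where "k = inner_g z a b / inner_g z b b"
        have pos: "inner_g z b b \<noteq> 0" using inner_g_pos[OF z False] by simp
        have "a = (1 / inner_g z b b) *\<^sub>R (inner_g z b b *\<^sub>R a)" using pos by simp
        also have "\<dots> = k *\<^sub>R b" unfolding gram_eq_0_imp[OF z True] by (simp add: k_def)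
        finally show ?thesis using riem_low_form_proportional[OF z] by simp
      qed
      with True show ?thesis by simp
    qed
    then show "constant_curvature_form \<kappa> z" using constant_curvature_form_iff[OF z] by blast
  qed
qed

text \<open>Integrability is a condition on fields, but the Nijenhuis expression is a tensor, and every
  vector extends to a field with constant components in a chart.\<close>

lemma integrable_iff_local:
  fixes J :: "('a, 'i, 'n) copoint \<Rightarrow> ('i \<Rightarrow> (real ^ 'n) \<times> (real ^ 'n)) \<Rightarrow>
              ('i \<Rightarrow> (real ^ 'n) \<times> (real ^ 'n))"
  assumes J: "endomorphism_field_on T (nonzero_cotangent M) J"
    and smoothJ: "\<And>c u e. c \<in> charts_at T u \<Longrightarrow> u \<in> nonzero_cotangent M \<Longrightarrow>
          (\<lambda>w. cotan.local_endo J c w e) differentiable (at (induced_chart_map M c u))"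
    and sq: "\<And>c u e. c \<in> charts_at T u \<Longrightarrow> u \<in> nonzero_cotangent M \<Longrightarrow>
          cotan.local_endo J c (induced_chart_map M c u)
            (cotan.local_endo J c (induced_chart_map M c u) e) = - e"
  shows "nijenhuis_integrable_on T (nonzero_cotangent M) J \<longleftrightarrow>
    (\<forall>u\<in>nonzero_cotangent M. \<forall>c\<in>charts_at T u. \<forall>v v'.
       nijenhuis_tensor (cotan.local_endo J c) (induced_chart_map M c u) v v' = 0)"
proof
  assume int: "nijenhuis_integrable_on T (nonzero_cotangent M) J"
  show "\<forall>u\<in>nonzero_cotangent M. \<forall>c\<in>charts_at T u. \<forall>v v'.
       nijenhuis_tensor (cotan.local_endo J c) (induced_chart_map M c u) v v' = 0"
  proof (intro ballI allI)
    fix u c v v' assume u: "u \<in> nonzero_cotangent M" and cu: "c \<in> charts_at T u"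
    have c: "c \<in> charts M" and udom: "u \<in> induced_chart_dom M c" using cu by (auto simp:
        charts_at_def)
    let ?V = "nonzero_chart_dom c"
    have V: "openin (space_of T) ?V" "?V \<subseteq> nonzero_cotangent M" "?V \<subseteq> chart_dom T c" "u \<in> ?V"
      using openin_nonzero_chart_dom[OF c] nonzero_chart_dom_eq[OF c chart_dom_points[OF c]] u udom
      by auto
    have op: "cotan.chart_open ?V" by (rule openin_bundle_imp_chart_open[OF V(1)])
    let ?X = "\<lambda>e u. tangent_vector T c u e"
    have X: "smooth_vector_field_on T ?V (?X e)" for e
      by (rule cotan.smooth_constant_component_field) (use c V op in auto)
    have D: "cotan.differentiable_field_at ?V u (?X e)" for e
      by (rule cotan.smooth_field_differentiable[OF X op V(4)])
    have JV: "endomorphism_field_on T ?V J" using J V(2) unfolding endomorphism_field_on_def by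
        blast
    have "nijenhuis T J (?X v) (?X v') u = 0"
      using int V X unfolding nijenhuis_integrable_on_def by blast
    then have "nijenhuis T J (?X v) (?X v') u c = 0" by simp
    moreover have "nijenhuis T J (?X v) (?X v') u c
        = nijenhuis_tensor (cotan.local_endo J c) (induced_chart_map M c u) v v'"
      using cotan.nijenhuis_in_chart(1)[OF JV _ _ D D cu] smoothJ sq u
      by (simp add: cotan.tangent_vector_component[OF cu])
    ultimately show "nijenhuis_tensor (cotan.local_endo J c) (induced_chart_map M c u) v v' = 0"
      by simp
  qed
next
  assume *: "\<forall>u\<in>nonzero_cotangent M. \<forall>c\<in>charts_at T u. \<forall>v v'.
       nijenhuis_tensor (cotan.local_endo J c) (induced_chart_map M c u) v v' = 0"
  show "nijenhuis_integrable_on T (nonzero_cotangent M) J"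
    unfolding nijenhuis_integrable_on_def
  proof (intro allI impI ballI, elim conjE)
    fix V X Y u
    assume V: "openin (space_of T) V" "V \<subseteq> nonzero_cotangent M" and u: "u \<in> V"
      and X: "smooth_vector_field_on T V X" and Y: "smooth_vector_field_on T V Y"
    have op: "cotan.chart_open V" by (rule openin_bundle_imp_chart_open[OF V(1)])
    have JV: "endomorphism_field_on T V J" using J V(2) unfolding endomorphism_field_on_def by blast
    have u': "u \<in> nonzero_cotangent M" using u V by blast
    note D = cotan.smooth_field_differentiable[OF X op u] cotan.smooth_field_differentiable[OF Y
        op u]
    show "nijenhuis T J X Y u = 0"
    proof
      fix i
      show "nijenhuis T J X Y u i = 0 i"
      proof (cases "i \<in> charts_at T u")
        case True
        then show ?thesis
          using cotan.nijenhuis_in_chart(1)[OF JV _ _ D True] smoothJ sq u' * by simp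
      next
        case False
        then show ?thesis
          using cotan.nijenhuis_in_chart(2)[OF JV _ _ D False] smoothJ sq u' by simp
      qed
    qed
  qed
qed

end

section \<open>Integrability of structures of diagonal type\<close>

locale diagonal_type = riemannian M gr
  for M :: "('a, 'i, real ^ 'n::finite) manifold" and gr :: "('a, 'i, 'n) metric" +
  fixes A :: real and lam b1 :: "real \<Rightarrow> real"
    and J :: "('a, 'i, 'n) copoint \<Rightarrow> ('i \<Rightarrow> (real ^ 'n) \<times> (real ^ 'n)) \<Rightarrow>
              ('i \<Rightarrow> (real ^ 'n) \<times> (real ^ 'n))"
  assumes A: "A > 0"
    and lam_smooth: "smooth_on {0<..} lam" and b1_smooth: "smooth_on {0<..} b1"
    and lam_pos: "\<And>t. t > 0 \<Longrightarrow> lam t > 0"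
    and lam_b1_pos: "\<And>t. t > 0 \<Longrightarrow> A * lam t + 2 * b1 t > 0"
    and J: "endomorphism_field_on T (nonzero_cotangent M) J"
    and J_delta_q: "\<And>c u t i. c \<in> charts M \<Longrightarrow> u \<in> nonzero_cotangent M \<Longrightarrow>
        u \<in> induced_chart_dom M c \<Longrightarrow> t = energy_density M gr c u \<Longrightarrow>
        J u (delta_q M gr c u i) =
          (\<Sum>j\<in>UNIV. (A * t * lam t * g_low M gr c u i j
                      + b1 t * fibre_coord c u i * fibre_coord c u j) *\<^sub>R partial_p M c u j)"
    and J_partial_p: "\<And>c u t i. c \<in> charts M \<Longrightarrow> u \<in> nonzero_cotangent M \<Longrightarrow>
        u \<in> induced_chart_dom M c \<Longrightarrow> t = energy_density M gr c u \<Longrightarrow>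
        J u (partial_p M c u i) =
          - (\<Sum>j\<in>UNIV. (1 / (A * t * lam t) * g_up M gr c u i j
                        - b1 t / (A * t\<^sup>2 * lam t * (A * lam t + 2 * b1 t))
                          * g_up0 M gr c u i * g_up0 M gr c u j) *\<^sub>R delta_q M gr c u j)"
begin

definition al :: "real \<Rightarrow> real" where "al t = A * t * lam t"
definition dal :: "real \<Rightarrow> real" where "dal t = A * (lam t + t * deriv lam t)"

lemma has_deriv_on_positive:
  assumes "smooth_on {0<..} f" "t > 0"
  shows "(f has_real_derivative deriv f t) (at t)"
  using smooth_on_differentiable[OF assms(1)] assms(2)
  by (simp add: DERIV_deriv_iff_real_differentiable)

lemma coefficients:
  assumes c: "c \<in> charts M"
  shows "diagonal_coefficients (gmat c) (chart_image c) al b1 dal (deriv b1)"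
proof -
  interpret metric_field "gmat c" "chart_image c" by (rule metric_field_chart[OF c])
  show ?thesis
  proof
    fix t :: real assume t: "t > 0"
    show "(al has_real_derivative dal t) (at t)"
      unfolding al_def dal_def
      by (auto intro!: derivative_eq_intros has_deriv_on_positive[OF lam_smooth t] simp:
          algebra_simps)
    show "(b1 has_real_derivative deriv b1 t) (at t)" by (rule has_deriv_on_positive[OF b1_smooth
        t])
    show "al t \<noteq> 0" using A lam_pos[OF t] t by (simp add: al_def)
    have "al t + 2 * t * b1 t = t * (A * lam t + 2 * b1 t)" by (simp add: al_def algebra_simps)
    then show "al t + 2 * t * b1 t \<noteq> 0" using lam_b1_pos[OF t] t by simp
  qed
qed

lemma chart_point:
  assumes c: "c \<in> charts M" and w: "fst w \<in> chart_image c" "snd w \<noteq> 0"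
  obtains u where "u \<in> nonzero_cotangent M" "u \<in> induced_chart_dom M c"
    "induced_chart_map M c u = w"
proof -
  obtain x where x: "fst w = chart_map M c x" "c \<in> charts_at M x" using chart_image_E[OF c w(1)]
      by blast
  let ?u = "(x, covector c x (snd w))"
  have dom: "?u \<in> induced_chart_dom M c"
    using x by (simp add: in_induced_chart_dom covector_in charts_at_def)
  have map: "induced_chart_map M c ?u = w"
    using x by (simp add: induced_chart_map_eq covector_component prod_eq_iff)
  have "?u \<in> nonzero_chart_dom c" using dom map w(2) by (simp add: nonzero_chart_dom_def)
  then show ?thesis
    using that dom map nonzero_chart_dom_eq[OF c chart_dom_points[OF c]] by blast
qed

text \<open>The given formulas for \<open>J\<close> on the adapted frame, read in the induced chart, are the ones of
  the local model with \<open>\<alpha> = A t \<lambda>\<close> and \<open>\<beta> = b\<^sub>1\<close>.\<close>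

lemma structure_in_chart:
  assumes c: "c \<in> charts M"
  shows "diagonal_structure (gmat c) (chart_image c) al b1 dal (deriv b1) (cotan.local_endo J c)"
proof -
  interpret diagonal_coefficients "gmat c" "chart_image c" al b1 dal "deriv b1"
    by (rule coefficients[OF c])
  have point: "\<exists>u. u \<in> nonzero_cotangent M \<and> u \<in> induced_chart_dom M c \<and> c \<in> charts_at T u
      \<and> induced_chart_map M c u = w" if w: "w \<in> Z" for w
  proof -
    obtain u where "u \<in> nonzero_cotangent M" "u \<in> induced_chart_dom M c" "induced_chart_map M c u
        = w"
      by (rule chart_point[OF c Z_D(1)[OF w] Z_D(2)[OF w]])
    then show ?thesis using c by (intro exI[of _ u]) (simp add: charts_at_def)
  qed
  have frame: "delta_q M gr c u i = tangent_vector T c u (hor i w)"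
    "partial_p M c u i = tangent_vector T c u (0, axis i 1)"
    "energy_density M gr c u = energy w" "g_low M gr c u i j = g i j (fst w)"
    "g_up M gr c u i j = g_inv i j (fst w)" "g_up0 M gr c u i = p_sharp i w" "fibre_coord c u i =
        snd w $ i"
    if u: "u \<in> induced_chart_dom M c" "c \<in> charts_at T u" and w: "induced_chart_map M c u = w" for
        u w i j
  proof -
    have cx: "c \<in> charts_at M (fst u)" using u by (simp add: bundle_charts_at)
    have fw: "fst w = chart_map M c (fst u)" "snd w = snd u c"
      using w by (auto simp: induced_chart_map_eq)
    show p: "fibre_coord c u i = snd w $ i" for i by (simp add: fibre_coord_def fw)
    show "g_low M gr c u i j = g i j (fst w)"
      by (simp add: g_low_def gmat_chart_map[OF cx] fw)
    show up: "g_up M gr c u i j = g_inv i j (fst w)" for i j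
      by (simp add: g_up_def g_inv_def inverse_metric_matrix_def gmat_chart_map[OF cx] fw)
    show "g_up0 M gr c u i = p_sharp i w" by (simp add: g_up0_def p_sharp_def p up)
    show "energy_density M gr c u = energy w" by (simp add: energy_density_def energy_def p up)
    show "partial_p M c u i = tangent_vector T c u (0, axis i 1)" by (simp add: partial_p_def)
    have C: "christoffel0 M gr c u i h = christ0 i h w" for h
      by (simp add: christoffel0_def christ0_def p christoffel_in_chart[OF cx] fw)
    have "hor i w = (axis i 1, 0) + (\<Sum>h\<in>UNIV. christ0 i h w *\<^sub>R (0, axis h 1))"
      by (simp add: hor_def prod_eq_iff fst_sum snd_sum vec_lambda_eq_sum_axis)
    then show "delta_q M gr c u i = tangent_vector T c u (hor i w)"
      unfolding delta_q_def partial_q_def partial_p_def C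
      by (simp only: linear_add[OF cotan.tangent_vector_linear[OF u(2)]]
          linear_sum[OF cotan.tangent_vector_linear[OF u(2)]]
          linear_scale[OF cotan.tangent_vector_linear[OF u(2)]])
  qed
  show ?thesis
  proof (rule diagonal_structure.intro[OF coefficients[OF c]], rule diagonal_structure_axioms.intro)
    fix w assume w: "w \<in> Z"
    then obtain u where u: "u \<in> nonzero_cotangent M" "u \<in> induced_chart_dom M c" "c \<in> charts_at T u"
      and uw: "induced_chart_map M c u = w" using point by blast
    note f = frame[OF u(2,3) uw]
    have endo: "cotan.local_endo J c w e = J u (tangent_vector T c u e) c" for e
      using cotan.chart_inv_charts_at[OF u(3)] by (simp add: cotan.local_endo_def uw)
    note lin = cotan.tangent_vector_linear[OF u(3)]
    show "linear (cotan.local_endo J c w)"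
      using cotan.linear_local_endo[OF J u(1,3)] by (simp add: uw)
    show "cotan.local_endo J c w (hor i w) = ver i w" for i
    proof -
      have "J u (tangent_vector T c u (hor i w)) = (\<Sum>j\<in>UNIV. G_mat i j w *\<^sub>R tangent_vector T c u
          (0, axis j 1))"
        using J_delta_q[OF c u(1,2) refl, of i] unfolding f by (simp add: G_mat_def al_def)
      also have "\<dots> = tangent_vector T c u (ver i w)"
      proof -
        have "ver i w = (\<Sum>j\<in>UNIV. G_mat i j w *\<^sub>R (0, axis j 1))"
          by (simp add: ver_def prod_eq_iff fst_sum snd_sum vec_lambda_eq_sum_axis)
        then show ?thesis by (simp only: linear_sum[OF lin] linear_scale[OF lin])
      qed
      finally show ?thesis by (simp add: endo cotan.tangent_vector_component[OF u(3)])
    qed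
    show "cotan.local_endo J c w (0, axis i 1) = - (\<Sum>j\<in>UNIV. H_mat i j w *\<^sub>R hor j w)" for i
    proof -
      have H: "H_mat i j w = 1 / (A * energy w * lam (energy w)) * g_inv i j (fst w)
          - b1 (energy w) / (A * (energy w)\<^sup>2 * lam (energy w) * (A * lam (energy w) + 2 * b1
              (energy w))) * p_sharp i w * p_sharp j w" for j
      proof -
        have "al (energy w) * (al (energy w) + 2 * energy w * b1 (energy w))
            = A * (energy w)\<^sup>2 * lam (energy w) * (A * lam (energy w) + 2 * b1 (energy w))"
          by (simp add: al_def power2_eq_square algebra_simps)
        then show ?thesis by (simp add: H_mat_def) (simp add: al_def)
      qed
      have "J u (tangent_vector T c u (0, axis i 1))
          = - (\<Sum>j\<in>UNIV. H_mat i j w *\<^sub>R tangent_vector T c u (hor j w))"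
        using J_partial_p[OF c u(1,2) refl, of i] by (simp only: f H)
      also have "\<dots> = tangent_vector T c u (- (\<Sum>j\<in>UNIV. H_mat i j w *\<^sub>R hor j w))"
        by (simp only: linear_neg[OF lin] linear_sum[OF lin] linear_scale[OF lin])
      finally show ?thesis by (simp add: endo cotan.tangent_vector_component[OF u(3)])
    qed
  qed
qed

lemma integrable_iff_curvature_identity:
  "nijenhuis_integrable_on T (nonzero_cotangent M) J \<longleftrightarrow>
    (\<forall>c\<in>charts M. \<forall>x\<in>chart_image c. \<forall>p. p \<noteq> 0 \<longrightarrow>
      diagonal_coefficients.curvature_identity (gmat c) al b1 dal (x, p))"
proof -
  have st: "diagonal_structure (gmat c) (chart_image c) al b1 dal (deriv b1) (cotan.local_endo J c)"
    and inZ: "induced_chart_map M c u \<in> diagonal_coefficients.Z (chart_image c)"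
    if "c \<in> charts_at T u" "u \<in> nonzero_cotangent M" for c u
  proof -
    have c: "c \<in> charts M" and u: "u \<in> induced_chart_dom M c" using that by (auto simp:
        charts_at_def)
    show "diagonal_structure (gmat c) (chart_image c) al b1 dal (deriv b1) (cotan.local_endo J c)"
      by (rule structure_in_chart[OF c])
    interpret diagonal_coefficients "gmat c" "chart_image c" al b1 dal "deriv b1"
      by (rule coefficients[OF c])
    have "u \<in> nonzero_chart_dom c"
      using that(2) u nonzero_chart_dom_eq[OF c chart_dom_points[OF c]] by blast
    then show "induced_chart_map M c u \<in> Z"
      unfolding Z_def nonzero_chart_dom_def
      by (auto simp: induced_chart_map_eq in_induced_chart_dom chart_image_def)
  qed
  have "nijenhuis_integrable_on T (nonzero_cotangent M) J \<longleftrightarrow>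
    (\<forall>u\<in>nonzero_cotangent M. \<forall>c\<in>charts_at T u. \<forall>v v'.
       nijenhuis_tensor (cotan.local_endo J c) (induced_chart_map M c u) v v' = 0)"
  proof (rule integrable_iff_local[OF J])
    fix c u e assume cu: "c \<in> charts_at T u" "u \<in> nonzero_cotangent M"
    interpret diagonal_structure "gmat c" "chart_image c" al b1 dal "deriv b1" "cotan.local_endo J
        c"
      by (rule st[OF cu])
    show "(\<lambda>w. cotan.local_endo J c w e) differentiable (at (induced_chart_map M c u))"
      using linear_family_B[OF inZ[OF cu]] unfolding linear_family_at_def by blast
    show "cotan.local_endo J c (induced_chart_map M c u)
            (cotan.local_endo J c (induced_chart_map M c u) e) = - e"
      by (rule B_square[OF inZ[OF cu]])
  qed
  also have "\<dots> \<longleftrightarrow> (\<forall>c\<in>charts M. \<forall>x\<in>chart_image c. \<forall>p. p \<noteq> 0 \<longrightarrow>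
      diagonal_coefficients.curvature_identity (gmat c) al b1 dal (x, p))"
  proof
    assume *: "\<forall>u\<in>nonzero_cotangent M. \<forall>c\<in>charts_at T u. \<forall>v v'.
       nijenhuis_tensor (cotan.local_endo J c) (induced_chart_map M c u) v v' = 0"
    show "\<forall>c\<in>charts M. \<forall>x\<in>chart_image c. \<forall>p. p \<noteq> 0 \<longrightarrow>
      diagonal_coefficients.curvature_identity (gmat c) al b1 dal (x, p)"
    proof (intro ballI allI impI)
      fix c x and p :: "real ^ 'n"
      assume c: "c \<in> charts M" and x: "x \<in> chart_image c" and p: "p \<noteq> 0"
      interpret diagonal_structure "gmat c" "chart_image c" al b1 dal "deriv b1" "cotan.local_endo
          J c"
        by (rule structure_in_chart[OF c])
      have w: "(x, p) \<in> Z" using x p by (simp add: Z_def)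
      obtain u where u: "u \<in> nonzero_cotangent M" "u \<in> induced_chart_dom M c"
        "induced_chart_map M c u = (x, p)" using chart_point[of c "(x, p)"] c x p by auto
      have "c \<in> charts_at T u" using c u by (simp add: charts_at_def)
      then have "\<forall>v v'. nijenhuis_tensor (cotan.local_endo J c) (x, p) v v' = 0"
        using * u by metis
      then show "curvature_identity (x, p)"
        unfolding nijenhuis_tensor_eq_0_iff[OF w] curvature_identity_def .
    qed
  next
    assume *: "\<forall>c\<in>charts M. \<forall>x\<in>chart_image c. \<forall>p. p \<noteq> 0 \<longrightarrow>
      diagonal_coefficients.curvature_identity (gmat c) al b1 dal (x, p)"
    show "\<forall>u\<in>nonzero_cotangent M. \<forall>c\<in>charts_at T u. \<forall>v v'.
       nijenhuis_tensor (cotan.local_endo J c) (induced_chart_map M c u) v v' = 0"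
    proof (intro ballI)
      fix u c assume u: "u \<in> nonzero_cotangent M" and cu: "c \<in> charts_at T u"
      interpret diagonal_structure "gmat c" "chart_image c" al b1 dal "deriv b1" "cotan.local_endo
          J c"
        by (rule st[OF cu u])
      have w: "induced_chart_map M c u \<in> Z" by (rule inZ[OF cu u])
      have "curvature_identity (induced_chart_map M c u)"
        using * cu w Z_D[OF w]
        by (cases "induced_chart_map M c u") (auto simp: charts_at_def)
      then show "\<forall>v v'. nijenhuis_tensor (cotan.local_endo J c) (induced_chart_map M c u) v v' = 0"
        unfolding nijenhuis_tensor_eq_0_iff[OF w] curvature_identity_def .
    qed
  qed
  finally show ?thesis .
qed

lemma balance_eq_iff:
  assumes c: "c \<in> charts M" and t: "t > 0" and nz: "lam t + 2 * t * deriv lam t \<noteq> 0"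
  shows "diagonal_coefficients.balance al b1 dal t = \<kappa> \<longleftrightarrow>
    b1 t = (\<kappa> - A\<^sup>2 * t * lam t * (lam t + t * deriv lam t)) / (A * t * (lam t + 2 * t * deriv lam
        t))"
proof -
  interpret diagonal_coefficients "gmat c" "chart_image c" al b1 dal "deriv b1"
    by (rule coefficients[OF c])
  have "A * t * (lam t + 2 * t * deriv lam t) \<noteq> 0" using A t nz by simp
  moreover have "balance t = A\<^sup>2 * t * lam t * (lam t + t * deriv lam t) + b1 t * (A * t * (lam t
      + 2 * t * deriv lam t))"
    by (simp add: balance_def al_def dal_def power2_eq_square algebra_simps)
  ultimately show ?thesis by (simp add: eq_divide_eq eq_diff_eq add.commute)
qed

text \<open>The constant value of \<open>balance\<close> is found over a single point and is then the curvature at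
  every point of every chart.\<close>

lemma integrable_iff:
  assumes nonempty: "points M \<noteq> {}" and n: "CARD('n) > 1"
    and nz: "\<And>t. t > 0 \<Longrightarrow> lam t + 2 * t * deriv lam t \<noteq> 0"
  shows "nijenhuis_integrable_on T (nonzero_cotangent M) J \<longleftrightarrow>
    (\<exists>\<kappa>. constant_sectional_curvature M gr \<kappa> \<and>
      (\<forall>t>0. b1 t = (\<kappa> - A\<^sup>2 * t * lam t * (lam t + t * deriv lam t))
                     / (A * t * (lam t + 2 * t * deriv lam t))))"
proof -
  obtain c0 x0 where c0: "c0 \<in> charts M" "x0 \<in> chart_dom M c0"
    using nonempty manifold unfolding smooth_manifold_def by blast
  then have x0: "chart_map M c0 x0 \<in> chart_image c0" by (simp add: chart_image_def)
  let ?F = "diagonal_coefficients.balance al b1 dal"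
  let ?id = "\<lambda>c x. \<forall>p. p \<noteq> 0 \<longrightarrow> diagonal_coefficients.curvature_identity (gmat c) al b1 dal (x, p)"
  have const: "(\<forall>c\<in>charts M. \<forall>x\<in>chart_image c. ?id c x) \<longleftrightarrow> constant_sectional_curvature M gr \<kappa>"
    if F: "\<And>t. t > 0 \<Longrightarrow> ?F t = \<kappa>" for \<kappa>
  proof -
    have "?id c x \<longleftrightarrow> metric_field.constant_curvature_form (gmat c) \<kappa> x"
      if c: "c \<in> charts M" and x: "x \<in> chart_image c" for c x
    proof -
      interpret diagonal_coefficients "gmat c" "chart_image c" al b1 dal "deriv b1"
        by (rule coefficients[OF c])
      show ?thesis by (rule curvature_identity_iff_constant_curvature[OF x F])
    qed
    then show ?thesis unfolding constant_sectional_curvature_in_charts by blast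
  qed
  have exF: "\<exists>\<kappa>. \<forall>t>0. ?F t = \<kappa>" if "\<forall>c\<in>charts M. \<forall>x\<in>chart_image c. ?id c x"
  proof -
    interpret diagonal_coefficients "gmat c0" "chart_image c0" al b1 dal "deriv b1"
      by (rule coefficients[OF c0(1)])
    show ?thesis by (rule curvature_identity_imp_balance_constant[OF x0 n]) (use that c0 x0 in
        blast)
  qed
  have b1: "(\<forall>t>0. b1 t = (\<kappa> - A\<^sup>2 * t * lam t * (lam t + t * deriv lam t))
                     / (A * t * (lam t + 2 * t * deriv lam t))) \<longleftrightarrow> (\<forall>t>0. ?F t = \<kappa>)" for \<kappa>
    using balance_eq_iff[OF c0(1) _ nz] by simp
  show ?thesis
    unfolding integrable_iff_curvature_identity b1
  proof
    assume id: "\<forall>c\<in>charts M. \<forall>x\<in>chart_image c. ?id c x"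
    obtain \<kappa> where F: "\<forall>t>0. ?F t = \<kappa>" using exF[OF id] by blast
    then have "constant_sectional_curvature M gr \<kappa>" using const[of \<kappa>] id by simp
    with F show "\<exists>\<kappa>. constant_sectional_curvature M gr \<kappa> \<and> (\<forall>t>0. ?F t = \<kappa>)" by blast
  next
    assume "\<exists>\<kappa>. constant_sectional_curvature M gr \<kappa> \<and> (\<forall>t>0. ?F t = \<kappa>)"
    then obtain \<kappa> where k: "constant_sectional_curvature M gr \<kappa>" and F: "\<forall>t>0. ?F t = \<kappa>" by blast
    show "\<forall>c\<in>charts M. \<forall>x\<in>chart_image c. ?id c x" using const[of \<kappa>] k F by simp
  qed
qed

end

text \<open>The second inequality is \<open>A \<lambda> + 2 b\<^sub>1 > 0\<close> after elimination of \<open>b\<^sub>1\<close>.\<close>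

lemma parameter_condition:
  fixes A l l' b \<kappa> t :: real
  assumes A: "A > 0" and t: "t > 0" and nz: "l + 2 * t * l' \<noteq> 0" and pos: "A * l + 2 * b > 0"
    and b: "b = (\<kappa> - A\<^sup>2 * t * l * (l + t * l')) / (A * t * (l + 2 * t * l'))"
  shows "(2 * \<kappa> - A\<^sup>2 * t * l\<^sup>2) / (l + 2 * t * l') > 0"
proof -
  define d where "d = l + 2 * t * l'"
  have d: "d \<noteq> 0" "A * t * d \<noteq> 0" using nz A t by (auto simp: d_def)
  have "b * (A * t * d) = \<kappa> - A\<^sup>2 * t * l * (l + t * l')" using d b by (simp add: d_def[symmetric])
  then have "(A * l + 2 * b) * (A * t * d) = 2 * \<kappa> - A\<^sup>2 * t * l\<^sup>2"
    by (simp add: d_def power2_eq_square algebra_simps)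
  then have "(2 * \<kappa> - A\<^sup>2 * t * l\<^sup>2) / d = (A * l + 2 * b) * (A * t)"
    using d by (simp add: field_simps)
  then show ?thesis using pos A t by (simp add: d_def)
qed

theorem theorem4:
  fixes M :: "('a, 'i, real ^ 'n::finite) manifold"
    and g :: "('a, 'i, 'n) metric"
    and A :: real
    and lam b1 :: "real \<Rightarrow> real"
    and J :: "('a, 'i, 'n) copoint \<Rightarrow> ('i \<Rightarrow> (real ^ 'n) \<times> (real ^ 'n)) \<Rightarrow>
              ('i \<Rightarrow> (real ^ 'n) \<times> (real ^ 'n))"
  assumes "smooth_manifold M" and "points M \<noteq> {}" and "riemannian_metric M g"
    and "CARD('n) > 1"
    and "A > 0"
    and "smooth_on {0<..} lam" and "smooth_on {0<..} b1"
    and "\<And>t. t > 0 \<Longrightarrow> lam t > 0"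
    and "\<And>t. t > 0 \<Longrightarrow> A * lam t + 2 * b1 t > 0"
    and "\<And>t. t > 0 \<Longrightarrow> lam t + 2 * t * deriv lam t \<noteq> 0"
    and "endomorphism_field_on (cotangent_bundle M) (nonzero_cotangent M) J"
    and J_delta_q: "\<And>c u t i. c \<in> charts M \<Longrightarrow> u \<in> nonzero_cotangent M \<Longrightarrow>
        u \<in> induced_chart_dom M c \<Longrightarrow> t = energy_density M g c u \<Longrightarrow>
        J u (delta_q M g c u i) =
          (\<Sum>j\<in>UNIV. (A * t * lam t * g_low M g c u i j
                      + b1 t * fibre_coord c u i * fibre_coord c u j) *\<^sub>R partial_p M c u j)"
    and J_partial_p: "\<And>c u t i. c \<in> charts M \<Longrightarrow> u \<in> nonzero_cotangent M \<Longrightarrow>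
        u \<in> induced_chart_dom M c \<Longrightarrow> t = energy_density M g c u \<Longrightarrow>
        J u (partial_p M c u i) =
          - (\<Sum>j\<in>UNIV. (1 / (A * t * lam t) * g_up M g c u i j
                        - b1 t / (A * t\<^sup>2 * lam t * (A * lam t + 2 * b1 t))
                          * g_up0 M g c u i * g_up0 M g c u j) *\<^sub>R delta_q M g c u j)"
    and "\<exists>L. ((\<lambda>t. A * t * (lam t + 2 * t * deriv lam t) * (b1 t + A * lam t)) \<longlongrightarrow> L) (at_right 0)"
  shows "(nijenhuis_integrable_on (cotangent_bundle M) (nonzero_cotangent M) J \<longleftrightarrow>
           (\<exists>\<kappa>. constant_sectional_curvature M g \<kappa> \<and>
             (\<forall>t>0. b1 t = (\<kappa> - A\<^sup>2 * t * lam t * (lam t + t * deriv lam t))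
                            / (A * t * (lam t + 2 * t * deriv lam t)))))
       \<and> (\<forall>\<kappa>. constant_sectional_curvature M g \<kappa> \<and>
             (\<forall>t>0. b1 t = (\<kappa> - A\<^sup>2 * t * lam t * (lam t + t * deriv lam t))
                            / (A * t * (lam t + 2 * t * deriv lam t))) \<longrightarrow>
             (\<forall>t>0. lam t > 0 \<and>
                (2 * \<kappa> - A\<^sup>2 * t * (lam t)\<^sup>2) / (lam t + 2 * t * deriv lam t) > 0))"
proof -
  interpret diagonal_type M g A lam b1 J
  proof (intro diagonal_type.intro riemannian.intro cotangent_atlas.intro riemannian_axioms.intro
      diagonal_type_axioms.intro)
    show "smooth_atlas M" by (rule smooth_manifold_imp_atlas[OF assms(1)])
  qed (fact assms)+
  show ?thesis
  proof (intro conjI allI impI)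
    show "nijenhuis_integrable_on T (nonzero_cotangent M) J \<longleftrightarrow>
        (\<exists>\<kappa>. constant_sectional_curvature M g \<kappa> \<and>
          (\<forall>t>0. b1 t = (\<kappa> - A\<^sup>2 * t * lam t * (lam t + t * deriv lam t))
                         / (A * t * (lam t + 2 * t * deriv lam t))))"
      by (rule integrable_iff[OF assms(2) assms(4) assms(10)])
  next
    fix t :: real assume t: "t > 0"
    show "lam t > 0" by (rule assms(8)[OF t])
  next
    fix \<kappa> t :: real
    assume \<kappa>: "constant_sectional_curvature M g \<kappa> \<and>
          (\<forall>t>0. b1 t = (\<kappa> - A\<^sup>2 * t * lam t * (lam t + t * deriv lam t))
                         / (A * t * (lam t + 2 * t * deriv lam t)))" and t: "t > 0"
    show "(2 * \<kappa> - A\<^sup>2 * t * (lam t)\<^sup>2) / (lam t + 2 * t * deriv lam t) > 0"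
      using \<kappa> t by (intro parameter_condition[OF assms(5) t assms(10)[OF t] assms(9)[OF t]]) simp
  qed
qed

end
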